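(* Let $n\geq 2$. The homomorphism $f_*:\pi_1(PB_n(\mathbb{C}))\to\pi_1(PB_{n-1}(\mathbb{C}))$, induced by the projection to the first $n-1$ coordinates $f:PB_n(\mathbb{C})\to PB_{n-1}(\mathbb{C})$, has kernel freely generated by the elements $B^{(n)}_{in}$ for $i=1,2,\ldots,n-1$.
   Context: $PB_n(\mathbb{C})\subset\mathbb{C}^n$ is the space of $n$-tuples of pairwise distinct points, $B_n(\mathbb{C})=PB_n(\mathbb{C})/S_n$. With $\sigma_1,\ldots,\sigma_{n-1}$ the standard Artin generators of the braid group $\pi_1(B_n(\mathbb{C}))$ (base point consisting of $n$ points on the real line numbered from left to right), for $i<j$, $$B^{(n)}_{ij}=\sigma_{j-1}\sigma_{j-2}\cdots\sigma_{i+1}\sigma_i^2\sigma_{i+1}^{-1}\cdots\sigma_{j-2}^{-1}\sigma_{j-1}^{-1}\in\pi_1(PB_n(\mathbb{C})).$$ *)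

theory Defs
  imports "HOL-Analysis.Analysis" "HOL-Algebra.Coset" "HOL-Combinatorics.Permutations"
begin

section \<open>The fundamental group of a pointed topological space\<close>

definition loop_in :: "'a topology \<Rightarrow> 'a \<Rightarrow> (real \<Rightarrow> 'a) \<Rightarrow> bool" where
  "loop_in X x p \<longleftrightarrow> pathin X p \<and> p 0 = x \<and> p 1 = x"

definition loop_homotopic :: "'a topology \<Rightarrow> 'a \<Rightarrow> (real \<Rightarrow> 'a) \<Rightarrow> (real \<Rightarrow> 'a) \<Rightarrow> bool" where
  "loop_homotopic X x = homotopic_with (\<lambda>r. r 0 = x \<and> r 1 = x) (top_of_set {0..1}) X"

definition loop_class :: "'a topology \<Rightarrow> 'a \<Rightarrow> (real \<Rightarrow> 'a) \<Rightarrow> (real \<Rightarrow> 'a) set" where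
  "loop_class X x p = {q. loop_homotopic X x p q}"

text \<open>
  The same formula as \<^const>\<open>joinpaths\<close>, whose type class constraint excludes
  the quotient space of unordered configurations.
\<close>
definition loop_join :: "(real \<Rightarrow> 'a) \<Rightarrow> (real \<Rightarrow> 'a) \<Rightarrow> real \<Rightarrow> 'a" where
  "loop_join p q = (\<lambda>t. if t \<le> 1 / 2 then p (2 * t) else q (2 * t - 1))"

text \<open>The product of two classes is represented by the first loop followed by the second one.\<close>
definition fundamental_group :: "'a topology \<Rightarrow> 'a \<Rightarrow> (real \<Rightarrow> 'a) set monoid" where
  "fundamental_group X x =
     \<lparr>carrier = loop_class X x ` {p. loop_in X x p},
      mult = (\<lambda>A B. {r. \<exists>p\<in>A. \<exists>q\<in>B. loop_homotopic X x (loop_join p q) r}),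
      one = loop_class X x (\<lambda>_. x)\<rparr>"

definition induced_hom ::
    "'b topology \<Rightarrow> 'b \<Rightarrow> ('a \<Rightarrow> 'b) \<Rightarrow> (real \<Rightarrow> 'a) set \<Rightarrow> (real \<Rightarrow> 'b) set" where
  "induced_hom Y y f A = {r. \<exists>p\<in>A. loop_homotopic Y y (f \<circ> p) r}"

lemma loop_homotopic_refl: "loop_homotopic X x p p \<longleftrightarrow> loop_in X x p"
  by (auto simp: loop_homotopic_def loop_in_def pathin_def)

lemma loop_homotopic_sym: "loop_homotopic X x p q \<Longrightarrow> loop_homotopic X x q p"
  unfolding loop_homotopic_def by (rule homotopic_with_symD)

lemma loop_homotopic_trans:
  "loop_homotopic X x p q \<Longrightarrow> loop_homotopic X x q r \<Longrightarrow> loop_homotopic X x p r"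
  unfolding loop_homotopic_def by (rule homotopic_with_trans)

lemma loop_homotopic_imp_loop:
  assumes "loop_homotopic X x p q"
  shows "loop_in X x p" "loop_in X x q"
  using assms loop_homotopic_sym loop_homotopic_trans loop_homotopic_refl by metis+

lemma loop_class_eq_iff:
  "loop_in X x p \<Longrightarrow> loop_class X x p = loop_class X x q \<longleftrightarrow> loop_homotopic X x p q"
  unfolding loop_class_def
  by (smt (verit) Collect_cong loop_homotopic_refl loop_homotopic_sym loop_homotopic_trans mem_Collect_eq)

lemma loop_in_join:
  assumes "loop_in X x p" "loop_in X x q"
  shows "loop_in X x (loop_join p q)"
proof -
  have "continuous_map (top_of_set {0..1}) X
          (\<lambda>t::real. if t \<le> 1/2 then p (2 * t) else q (2 * t - 1))"
  proof (rule continuous_map_cases_le)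
    show "continuous_map (subtopology (top_of_set {0..1}) {t \<in> topspace (top_of_set {0..1}). t \<le> 1/2})
            X (\<lambda>t::real. p (2 * t))"
      using assms(1) unfolding loop_in_def pathin_def
      by (intro continuous_map_compose[of _ "top_of_set {0..1}" "\<lambda>t. 2 * t" X p, unfolded o_def])
        (auto simp: subtopology_subtopology intro!: continuous_intros)
    show "continuous_map (subtopology (top_of_set {0..1}) {t \<in> topspace (top_of_set {0..1}). 1/2 \<le> t})
            X (\<lambda>t::real. q (2 * t - 1))"
      using assms(2) unfolding loop_in_def pathin_def
      by (intro continuous_map_compose[of _ "top_of_set {0..1}" "\<lambda>t. 2 * t - 1" X q, unfolded o_def])
        (auto simp: subtopology_subtopology intro!: continuous_intros)
    show "p (2 * t) = q (2 * t - 1)" if "t \<in> topspace (top_of_set {0..1})" "t = 1/2" for t :: real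
      using assms unfolding that(2) by (simp add: loop_in_def)
  qed (auto intro!: continuous_intros)
  thus ?thesis
    using assms by (auto simp: loop_in_def loop_join_def pathin_def)
qed

lemma loop_homotopic_join:
  assumes "loop_homotopic X x p p'" "loop_homotopic X x q q'"
  shows "loop_homotopic X x (loop_join p q) (loop_join p' q')"
proof -
  define I where "I = top_of_set {0..1::real}"
  obtain h where h: "continuous_map (prod_topology I I) X h"
    "\<And>t. h (0, t) = p t" "\<And>t. h (1, t) = p' t"
    "\<And>s. s \<in> {0..1} \<Longrightarrow> h (s, 0) = x \<and> h (s, 1) = x"
    using assms(1) unfolding loop_homotopic_def homotopic_with_def I_def by blast
  obtain k where k: "continuous_map (prod_topology I I) X k"
    "\<And>t. k (0, t) = q t" "\<And>t. k (1, t) = q' t"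
    "\<And>s. s \<in> {0..1} \<Longrightarrow> k (s, 0) = x \<and> k (s, 1) = x"
    using assms(2) unfolding loop_homotopic_def homotopic_with_def I_def by blast
  have II: "prod_topology I I = top_of_set ({0..1} \<times> {0..1})"
    by (simp add: I_def prod_topology_subtopology_eu)
  have "continuous_map (prod_topology I I) X
          (\<lambda>z. if snd z \<le> 1/2 then h (fst z, 2 * snd z) else k (fst z, 2 * snd z - 1))"
    unfolding II
  proof (rule continuous_map_cases_le)
    show "continuous_map (subtopology (top_of_set ({0..1} \<times> {0..1}))
            {z \<in> topspace (top_of_set ({0..1} \<times> {0..1})). snd z \<le> 1/2}) X
            (\<lambda>z::real\<times>real. h (fst z, 2 * snd z))"
      using h(1) unfolding II
      by (intro continuous_map_compose[of _ _ "\<lambda>z. (fst z, 2 * snd z)" X h, unfolded o_def])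
        (auto simp: subtopology_subtopology intro!: continuous_intros)
    show "continuous_map (subtopology (top_of_set ({0..1} \<times> {0..1}))
            {z \<in> topspace (top_of_set ({0..1} \<times> {0..1})). 1/2 \<le> snd z}) X
            (\<lambda>z::real\<times>real. k (fst z, 2 * snd z - 1))"
      using k(1) unfolding II
      by (intro continuous_map_compose[of _ _ "\<lambda>z. (fst z, 2 * snd z - 1)" X k, unfolded o_def])
        (auto simp: subtopology_subtopology intro!: continuous_intros)
    show "h (fst z, 2 * snd z) = k (fst z, 2 * snd z - 1)"
      if "z \<in> topspace (top_of_set ({0..1} \<times> {0..1}))" "snd z = 1/2" for z :: "real \<times> real"
      using that(1) h(4) k(4) unfolding that(2) by auto
  qed (auto intro!: continuous_intros)
  thus ?thesis
    unfolding loop_homotopic_def homotopic_with_def I_def[symmetric]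
    by (intro exI[of _ "\<lambda>z. if snd z \<le> 1/2 then h (fst z, 2 * snd z) else k (fst z, 2 * snd z - 1)"])
      (use h k in \<open>auto simp: loop_join_def\<close>)
qed

lemma loop_homotopic_reparam:
  assumes p: "pathin X p"
    and \<phi>: "continuous_on {0..1} \<phi>" "\<phi> ` {0..1} \<subseteq> {0..1::real}"
    and \<psi>: "continuous_on {0..1} \<psi>" "\<psi> ` {0..1} \<subseteq> {0..1::real}"
    and "\<phi> 0 = \<psi> 0" "\<phi> 1 = \<psi> 1" "p (\<phi> 0) = x" "p (\<phi> 1) = x"
  shows "loop_homotopic X x (\<lambda>t. p (\<phi> t)) (\<lambda>t. p (\<psi> t))"
proof -
  let ?l = "\<lambda>z::real\<times>real. (1 - fst z) * \<phi> (snd z) + fst z * \<psi> (snd z)"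
  have range: "?l z \<in> {0..1}" if "z \<in> {0..1} \<times> {0..1}" for z
  proof -
    have "\<phi> (snd z) \<in> {0..1}" "\<psi> (snd z) \<in> {0..1}" using that \<phi>(2) \<psi>(2) by auto
    hence "(1 - fst z) *\<^sub>R \<phi> (snd z) + fst z *\<^sub>R \<psi> (snd z) \<in> {0..1}"
      using that by (intro convexD) auto
    thus ?thesis by simp
  qed
  have "continuous_on ({0..1} \<times> {0..1}) ?l"
    by (intro continuous_intros continuous_on_compose2[OF \<phi>(1)] continuous_on_compose2[OF \<psi>(1)]) auto
  hence "continuous_map (prod_topology (top_of_set {0..1}) (top_of_set {0..1})) (top_of_set {0..1}) ?l"
    using range by (auto simp: prod_topology_subtopology_eu)
  hence "continuous_map (prod_topology (top_of_set {0..1}) (top_of_set {0..1})) X (p \<circ> ?l)"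
    using p unfolding pathin_def by (rule continuous_map_compose)
  thus ?thesis
    unfolding loop_homotopic_def homotopic_with_def
    by (intro exI[of _ "p \<circ> ?l"]) (use assms in \<open>auto simp: algebra_simps\<close>)
qed

lemma loop_homotopic_const_join:
  assumes "loop_in X x p"
  shows "loop_homotopic X x (loop_join (\<lambda>_. x) p) p"
proof -
  have "loop_homotopic X x (\<lambda>t. p (max 0 (2 * t - 1))) (\<lambda>t. p t)"
    using assms by (intro loop_homotopic_reparam) (auto simp: loop_in_def intro!: continuous_intros)
  also have "(\<lambda>t. p (max 0 (2 * t - 1))) = loop_join (\<lambda>_. x) p"
  proof
    fix t :: real
    show "p (max 0 (2 * t - 1)) = loop_join (\<lambda>_. x) p t"
      using assms by (cases "t \<le> 1/2") (auto simp: loop_in_def loop_join_def)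
  qed
  finally show ?thesis .
qed

definition loop_rev :: "(real \<Rightarrow> 'a) \<Rightarrow> real \<Rightarrow> 'a" where
  "loop_rev p = (\<lambda>t. p (1 - t))"

lemma loop_in_rev: "loop_in X x p \<Longrightarrow> loop_in X x (loop_rev p)"
  unfolding loop_in_def loop_rev_def pathin_def
  by (auto intro!: continuous_map_compose[of _ "top_of_set {0..1}" "\<lambda>t. 1 - t" X p, unfolded o_def] continuous_intros)

lemma loop_homotopic_rev_join:
  assumes "loop_in X x p"
  shows "loop_homotopic X x (loop_join (loop_rev p) p) (\<lambda>_. x)"
proof -
  have "loop_homotopic X x (\<lambda>t. p \<bar>1 - 2 * t\<bar>) (\<lambda>t. p 1)"
    using assms by (intro loop_homotopic_reparam) (auto simp: loop_in_def intro!: continuous_intros)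
  also have "(\<lambda>t. p \<bar>1 - 2 * t\<bar>) = loop_join (loop_rev p) p"
    by (auto simp: loop_rev_def loop_join_def fun_eq_iff abs_if)
  finally show ?thesis using assms by (simp add: loop_in_def)
qed

lemma loop_homotopic_assoc:
  assumes "loop_in X x p" "loop_in X x q" "loop_in X x r"
  shows "loop_homotopic X x (loop_join (loop_join p q) r) (loop_join p (loop_join q r))"
proof -
  let ?\<phi> = "\<lambda>t::real. min (2 * t) (min (t + 1/4) (t/2 + 1/2))"
  have l: "loop_in X x (loop_join p (loop_join q r))"
    using assms by (intro loop_in_join)
  have "loop_homotopic X x (\<lambda>t. loop_join p (loop_join q r) (?\<phi> t)) (\<lambda>t. loop_join p (loop_join q r) t)"
    using l by (intro loop_homotopic_reparam) (auto simp: loop_in_def intro!: continuous_intros)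
  also have "(\<lambda>t. loop_join p (loop_join q r) (?\<phi> t)) = loop_join (loop_join p q) r"
  proof
    fix t :: real
    consider "t \<le> 1/4" | "1/4 < t" "t \<le> 1/2" | "1/2 < t" by linarith
    then show "loop_join p (loop_join q r) (?\<phi> t) = loop_join (loop_join p q) r t"
    proof cases
      case 1
      hence "?\<phi> t = 2 * t" by simp
      thus ?thesis using 1 by (simp add: loop_join_def)
    next
      case 2
      hence "?\<phi> t = t + 1/4" by simp
      thus ?thesis using 2 by (simp add: loop_join_def algebra_simps)
    next
      case 3
      hence "?\<phi> t = t/2 + 1/2" by simp
      thus ?thesis using 3 by (simp add: loop_join_def algebra_simps)
    qed
  qed
  finally show ?thesis .
qed

lemma loop_in_const: "x \<in> topspace X \<Longrightarrow> loop_in X x (\<lambda>_. x)"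
  by (simp add: loop_in_def pathin_def)

lemma fundamental_group_mult:
  assumes "loop_in X x p" "loop_in X x q"
  shows "loop_class X x p \<otimes>\<^bsub>fundamental_group X x\<^esub> loop_class X x q = loop_class X x (loop_join p q)"
proof -
  have "(\<exists>p'\<in>loop_class X x p. \<exists>q'\<in>loop_class X x q. loop_homotopic X x (loop_join p' q') r)
          \<longleftrightarrow> loop_homotopic X x (loop_join p q) r" for r
    using assms loop_homotopic_refl loop_homotopic_trans loop_homotopic_join
    unfolding loop_class_def mem_Collect_eq by (metis mem_Collect_eq)
  thus ?thesis by (simp add: fundamental_group_def loop_class_def)
qed

theorem group_fundamental_group:
  assumes "x \<in> topspace X"
  shows "group (fundamental_group X x)"
proof (rule groupI)
  note [simp] = assms loop_in_const loop_in_join loop_in_rev fundamental_group_mult loop_class_eq_iff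
  have carr: "carrier (fundamental_group X x) = loop_class X x ` {p. loop_in X x p}"
    and one: "\<one>\<^bsub>fundamental_group X x\<^esub> = loop_class X x (\<lambda>_. x)"
    by (simp_all add: fundamental_group_def)
  show "\<one>\<^bsub>fundamental_group X x\<^esub> \<in> carrier (fundamental_group X x)"
    by (auto simp: carr one)
  fix A assume "A \<in> carrier (fundamental_group X x)"
  then obtain p where p: "A = loop_class X x p" "loop_in X x p" by (auto simp: carr)
  show "\<one>\<^bsub>fundamental_group X x\<^esub> \<otimes>\<^bsub>fundamental_group X x\<^esub> A = A"
    using p by (simp add: one loop_homotopic_const_join)
  show "\<exists>B\<in>carrier (fundamental_group X x). B \<otimes>\<^bsub>fundamental_group X x\<^esub> A = \<one>\<^bsub>fundamental_group X x\<^esub>"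
    by (rule bexI[of _ "loop_class X x (loop_rev p)"])
      (use p in \<open>auto simp: one carr loop_homotopic_rev_join\<close>)
  fix B assume "B \<in> carrier (fundamental_group X x)"
  then obtain q where q: "B = loop_class X x q" "loop_in X x q" by (auto simp: carr)
  show "A \<otimes>\<^bsub>fundamental_group X x\<^esub> B \<in> carrier (fundamental_group X x)"
    using p q by (auto simp: carr)
  fix C assume "C \<in> carrier (fundamental_group X x)"
  then obtain r where r: "C = loop_class X x r" "loop_in X x r" by (auto simp: carr)
  show "A \<otimes>\<^bsub>fundamental_group X x\<^esub> B \<otimes>\<^bsub>fundamental_group X x\<^esub> C =
        A \<otimes>\<^bsub>fundamental_group X x\<^esub> (B \<otimes>\<^bsub>fundamental_group X x\<^esub> C)"
    using p q r by (simp add: loop_homotopic_assoc)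
qed

lemma loop_homotopic_compose:
  assumes "continuous_map X Y f" "loop_homotopic X x p q"
  shows "loop_homotopic Y (f x) (f \<circ> p) (f \<circ> q)"
  using assms unfolding loop_homotopic_def
  by (elim homotopic_with_compose_continuous_map_left) auto

lemma loop_in_compose: "continuous_map X Y f \<Longrightarrow> loop_in X x p \<Longrightarrow> loop_in Y (f x) (f \<circ> p)"
  by (metis loop_homotopic_compose loop_homotopic_refl)

lemma induced_hom_loop_class:
  assumes "continuous_map X Y f" "loop_in X x p"
  shows "induced_hom Y (f x) f (loop_class X x p) = loop_class Y (f x) (f \<circ> p)"
  using assms loop_homotopic_refl loop_homotopic_trans loop_homotopic_compose
  unfolding induced_hom_def loop_class_def by (metis (no_types, lifting) mem_Collect_eq)

theorem induced_hom_hom: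
  assumes f: "continuous_map X Y f"
  shows "induced_hom Y (f x) f \<in> hom (fundamental_group X x) (fundamental_group Y (f x))"
proof (rule homI)
  have carr: "carrier (fundamental_group X x) = loop_class X x ` {p. loop_in X x p}" for X :: "'c topology" and x
    by (simp add: fundamental_group_def)
  fix A assume "A \<in> carrier (fundamental_group X x)"
  then obtain p where p: "A = loop_class X x p" "loop_in X x p" by (auto simp: carr)
  show "induced_hom Y (f x) f A \<in> carrier (fundamental_group Y (f x))"
    using p f by (auto simp: carr induced_hom_loop_class loop_in_compose)
  fix B assume "B \<in> carrier (fundamental_group X x)"
  then obtain q where q: "B = loop_class X x q" "loop_in X x q" by (auto simp: carr)
  have "f \<circ> loop_join p q = loop_join (f \<circ> p) (f \<circ> q)"
    by (auto simp: loop_join_def fun_eq_iff)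
  thus "induced_hom Y (f x) f (A \<otimes>\<^bsub>fundamental_group X x\<^esub> B) =
        induced_hom Y (f x) f A \<otimes>\<^bsub>fundamental_group Y (f x)\<^esub> induced_hom Y (f x) f B"
    using p q f by (simp add: induced_hom_loop_class loop_in_compose loop_in_join fundamental_group_mult)
qed


section \<open>Free generation\<close>

definition list_mult :: "('g, 'm) monoid_scheme \<Rightarrow> 'g list \<Rightarrow> 'g" where
  "list_mult G xs = foldr (mult G) xs \<one>\<^bsub>G\<^esub>"

text \<open>
  In a word, the letter \<open>(i, True)\<close> stands for the generator \<open>b i\<close> and \<open>(i, False)\<close> for its inverse.
\<close>
definition reduced_words :: "'i set \<Rightarrow> ('i \<times> bool) list set" where
  "reduced_words I =
     {w. fst ` set w \<subseteq> I \<and> successively (\<lambda>(i, d) (j, e). \<not> (i = j \<and> d \<noteq> e)) w}"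

definition word_value :: "('g, 'm) monoid_scheme \<Rightarrow> ('i \<Rightarrow> 'g) \<Rightarrow> ('i \<times> bool) list \<Rightarrow> 'g" where
  "word_value G b w = list_mult G (map (\<lambda>(i, e). if e then b i else inv\<^bsub>G\<^esub> b i) w)"

text \<open>
  The family \<open>b\<close>, indexed by \<open>I\<close>, is a basis of the subgroup \<open>K\<close> of \<open>G\<close>: evaluation of reduced
  words is a bijection from the free group on \<open>I\<close> onto \<open>K\<close>. Bijectivity also makes \<open>b\<close> injective
  on \<open>I\<close>.
\<close>
definition freely_generated_by ::
    "('g, 'm) monoid_scheme \<Rightarrow> 'g set \<Rightarrow> 'i set \<Rightarrow> ('i \<Rightarrow> 'g) \<Rightarrow> bool" where
  "freely_generated_by G K I b \<longleftrightarrow>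
     subgroup K G \<and> b ` I \<subseteq> K \<and> bij_betw (word_value G b) (reduced_words I) K"


section \<open>Configuration spaces of the complex plane\<close>

text \<open>
  Points of complex \<open>n\<close>-space are extensional functions on \<open>{1..n}\<close>, the points of the
  product topology over that index set.
\<close>
definition PB :: "nat \<Rightarrow> (nat \<Rightarrow> complex) topology" where
  "PB n = subtopology (product_topology (\<lambda>_. euclidean) {1..n}) {z. inj_on z {1..n}}"

text \<open>
  The orbit of a configuration under the symmetric group. Since \<open>\<pi>\<close> fixes all indices outside
  \<open>{1..n}\<close>, the functions \<open>z \<circ> \<pi>\<close> are again extensional.
\<close>
definition orbit_map :: "nat \<Rightarrow> (nat \<Rightarrow> complex) \<Rightarrow> (nat \<Rightarrow> complex) set" where
  "orbit_map n z = {z \<circ> \<pi> |\<pi>. \<pi> permutes {1..n}}"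

definition quotient_topology :: "'a topology \<Rightarrow> ('a \<Rightarrow> 'b) \<Rightarrow> 'b topology" where
  "quotient_topology X q =
     topology (\<lambda>U. U \<subseteq> q ` topspace X \<and> openin X {x \<in> topspace X. q x \<in> U})"

lemma openin_quotient_topology:
  "openin (quotient_topology X q) U \<longleftrightarrow> U \<subseteq> q ` topspace X \<and> openin X {x \<in> topspace X. q x \<in> U}"
proof -
  have "istopology (\<lambda>U. U \<subseteq> q ` topspace X \<and> openin X {x \<in> topspace X. q x \<in> U})"
    unfolding istopology_def
  proof (intro conjI allI impI)
    fix S T
    assume "S \<subseteq> q ` topspace X \<and> openin X {x \<in> topspace X. q x \<in> S}"
      and "T \<subseteq> q ` topspace X \<and> openin X {x \<in> topspace X. q x \<in> T}"
    moreover have "{x \<in> topspace X. q x \<in> S \<inter> T} =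
        {x \<in> topspace X. q x \<in> S} \<inter> {x \<in> topspace X. q x \<in> T}" by auto
    ultimately show "S \<inter> T \<subseteq> q ` topspace X" "openin X {x \<in> topspace X. q x \<in> S \<inter> T}" by auto
  next
    fix \<K>
    assume *: "\<forall>K\<in>\<K>. K \<subseteq> q ` topspace X \<and> openin X {x \<in> topspace X. q x \<in> K}"
    have "{x \<in> topspace X. q x \<in> \<Union>\<K>} = (\<Union>K\<in>\<K>. {x \<in> topspace X. q x \<in> K})" by auto
    thus "\<Union>\<K> \<subseteq> q ` topspace X" "openin X {x \<in> topspace X. q x \<in> \<Union>\<K>}"
      using * by (auto simp del: Union_iff)
  qed
  thus ?thesis by (simp add: quotient_topology_def topology_inverse')
qed

lemma topspace_quotient_topology: "topspace (quotient_topology X q) = q ` topspace X"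
proof
  show "topspace (quotient_topology X q) \<subseteq> q ` topspace X"
    by (meson openin_quotient_topology openin_topspace)
  have "{x \<in> topspace X. q x \<in> q ` topspace X} = topspace X" by auto
  thus "q ` topspace X \<subseteq> topspace (quotient_topology X q)"
    by (simp add: openin_quotient_topology openin_subset)
qed

lemma quotient_map_quotient_topology: "quotient_map X (quotient_topology X q) q"
  by (auto simp: quotient_map_def topspace_quotient_topology openin_quotient_topology)

definition UB :: "nat \<Rightarrow> (nat \<Rightarrow> complex) set topology" where
  "UB n = quotient_topology (PB n) (orbit_map n)"

lemma topspace_PB: "topspace (PB n) = {z \<in> extensional {1..n}. inj_on z {1..n}}"
  by (auto simp: PB_def PiE_def)

lemma continuous_map_orbit_map: "continuous_map (PB n) (UB n) (orbit_map n)"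
  by (simp add: UB_def quotient_imp_continuous_map quotient_map_quotient_topology)

lemma continuous_map_forget_last: "continuous_map (PB n) (PB (n - 1)) (\<lambda>z. restrict z {1..n - 1})"
proof -
  have "continuous_map (PB n) euclidean (\<lambda>z. restrict z {1..n - 1} k)" if "k \<in> {1..n - 1}" for k
    using that
    by (auto simp: PB_def intro!: continuous_map_from_subtopology continuous_map_product_projection)
  moreover have "inj_on (restrict z {1..n - 1}) {1..n - 1}" if "z \<in> topspace (PB n)" for z
    using that inj_on_subset[of z "{1..n}" "{1..n - 1}"] by (auto simp: topspace_PB)
  ultimately show ?thesis
    unfolding PB_def[of "n - 1"] continuous_map_in_subtopology continuous_map_componentwise
    by auto
qed


section \<open>Braid groups based at collinear points\<close>

text \<open>
  The base point is given by real numbers \<open>x 1 < \<dots> < x n\<close>.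
\<close>
definition base_conf :: "nat \<Rightarrow> (nat \<Rightarrow> real) \<Rightarrow> nat \<Rightarrow> complex" where
  "base_conf n x = (\<lambda>k\<in>{1..n}. complex_of_real (x k))"

definition pure_braid_group ::
    "nat \<Rightarrow> (nat \<Rightarrow> real) \<Rightarrow> (real \<Rightarrow> nat \<Rightarrow> complex) set monoid" where
  "pure_braid_group n x = fundamental_group (PB n) (base_conf n x)"

definition braid_group ::
    "nat \<Rightarrow> (nat \<Rightarrow> real) \<Rightarrow> (real \<Rightarrow> (nat \<Rightarrow> complex) set) set monoid" where
  "braid_group n x = fundamental_group (UB n) (orbit_map n (base_conf n x))"

text \<open>
  The points \<open>x i\<close> and \<open>x (i + 1)\<close> are exchanged by a counterclockwise half turn about their
  midpoint, along the circle having them as antipodal points; the other points do not move.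
\<close>
definition half_twist :: "nat \<Rightarrow> (nat \<Rightarrow> real) \<Rightarrow> nat \<Rightarrow> real \<Rightarrow> nat \<Rightarrow> complex" where
  "half_twist n x i t =
     (let m = complex_of_real ((x i + x (i + 1)) / 2);
          d = complex_of_real ((x (i + 1) - x i) / 2) * cis (pi * t)
      in (base_conf n x)(i := m - d, i + 1 := m + d))"

definition artin_gen :: "nat \<Rightarrow> (nat \<Rightarrow> real) \<Rightarrow> nat \<Rightarrow> (real \<Rightarrow> (nat \<Rightarrow> complex) set) set" where
  "artin_gen n x i =
     loop_class (UB n) (orbit_map n (base_conf n x)) (\<lambda>t. orbit_map n (half_twist n x i t))"

text \<open>
  The inclusion of the pure braid group into the braid group, induced by the covering
  \<^term>\<open>orbit_map n\<close>.
\<close>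
definition pure_incl ::
    "nat \<Rightarrow> (nat \<Rightarrow> real) \<Rightarrow> (real \<Rightarrow> nat \<Rightarrow> complex) set \<Rightarrow> (real \<Rightarrow> (nat \<Rightarrow> complex) set) set" where
  "pure_incl n x = induced_hom (UB n) (orbit_map n (base_conf n x)) (orbit_map n)"

definition braid_word_B ::
    "nat \<Rightarrow> (nat \<Rightarrow> real) \<Rightarrow> nat \<Rightarrow> nat \<Rightarrow> (real \<Rightarrow> (nat \<Rightarrow> complex) set) set" where
  "braid_word_B n x i j =
     list_mult (braid_group n x)
       (map (artin_gen n x) (rev [i+1..<j])
        @ [artin_gen n x i, artin_gen n x i]
        @ map (\<lambda>k. inv\<^bsub>braid_group n x\<^esub> artin_gen n x k) [i+1..<j])"

text \<open>The word above, regarded as an element of the pure braid group.\<close>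
definition pure_gen :: "nat \<Rightarrow> (nat \<Rightarrow> real) \<Rightarrow> nat \<Rightarrow> nat \<Rightarrow> (real \<Rightarrow> nat \<Rightarrow> complex) set" where
  "pure_gen n x i j =
     the_inv_into (carrier (pure_braid_group n x)) (pure_incl n x) (braid_word_B n x i j)"

definition forget_hom ::
    "nat \<Rightarrow> (nat \<Rightarrow> real) \<Rightarrow> (real \<Rightarrow> nat \<Rightarrow> complex) set \<Rightarrow> (real \<Rightarrow> nat \<Rightarrow> complex) set" where
  "forget_hom n x = induced_hom (PB (n - 1)) (base_conf (n - 1) x) (\<lambda>z. restrict z {1..n - 1})"

lemma base_conf_in_PB:
  "strict_mono_on {1..n} x \<Longrightarrow> base_conf n x \<in> topspace (PB n)"
  by (auto simp: topspace_PB base_conf_def inj_on_def dest: strict_mono_on_eqD)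

lemma restrict_base_conf: "restrict (base_conf n x) {1..n - 1} = base_conf (n - 1) x"
  by (auto simp: base_conf_def fun_eq_iff)

lemma half_twist_0: "i \<in> {1..<n} \<Longrightarrow> half_twist n x i 0 = base_conf n x"
  by (auto simp: half_twist_def base_conf_def fun_eq_iff field_simps simp flip: of_real_add of_real_diff)

lemma half_twist_1:
  "i \<in> {1..<n} \<Longrightarrow> half_twist n x i 1 = base_conf n x \<circ> Transposition.transpose i (i + 1)"
  by (auto simp: half_twist_def base_conf_def fun_eq_iff field_simps Transposition.transpose_def
      simp flip: of_real_add of_real_diff)

lemma orbit_map_permute:
  assumes "\<pi> permutes {1..n}"
  shows "orbit_map n (z \<circ> \<pi>) = orbit_map n z"
proof
  show "orbit_map n (z \<circ> \<pi>) \<subseteq> orbit_map n z"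
    using permutes_compose[OF _ assms] by (force simp: orbit_map_def comp_assoc)
  have "z \<circ> \<rho> = z \<circ> \<pi> \<circ> (inv_into UNIV \<pi> \<circ> \<rho>)" for \<rho>
    using permutes_inv_o(1)[OF assms] by (metis comp_assoc comp_id)
  moreover have "(inv_into UNIV \<pi> \<circ> \<rho>) permutes {1..n}" if "\<rho> permutes {1..n}" for \<rho>
    using that assms by (intro permutes_compose permutes_inv)
  ultimately show "orbit_map n z \<subseteq> orbit_map n (z \<circ> \<pi>)"
    unfolding orbit_map_def by blast
qed

lemma half_twist_in_PB:
  assumes x: "strict_mono_on {1..n} x" and i: "i \<in> {1..<n}"
  shows "half_twist n x i t \<in> topspace (PB n)"
proof -
  define m where "m = (x i + x (i + 1)) / 2"
  define r where "r = (x (i + 1) - x i) / 2"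
  define d where "d = complex_of_real r * cis (pi * t)"
  have r: "r > 0"
    using strict_mono_onD[OF x, of i "i + 1"] i by (simp add: r_def)
  have d: "cmod d = r" "d \<noteq> 0"
    using r by (auto simp: d_def norm_mult)
  have ht: "half_twist n x i t = (base_conf n x)(i := m - d, i + 1 := m + d)"
    by (simp add: half_twist_def d_def m_def r_def Let_def)
  have far: "complex_of_real (x k) \<noteq> complex_of_real m + e"
    if "k \<in> {1..n}" "k \<noteq> i" "k \<noteq> i + 1" "cmod e = r" for k e
  proof
    assume "complex_of_real (x k) = complex_of_real m + e"
    hence "e = complex_of_real (x k - m)" by simp
    hence "\<bar>x k - m\<bar> = r" using that(4) by (metis norm_of_real)
    moreover have "x k < x i \<or> x k > x (i + 1)"
      using that i strict_mono_onD[OF x, of k i] strict_mono_onD[OF x, of "i + 1" k]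
      by (cases "k < i") auto
    ultimately show False using r by (auto simp: m_def r_def abs_if field_simps split: if_splits)
  qed
  have 1: "complex_of_real (x k) \<noteq> complex_of_real m + d" "complex_of_real (x k) \<noteq> complex_of_real m - d"
    if "k \<in> {1..n}" "k \<noteq> i" "k \<noteq> i + 1" for k
    using far[OF that, of d] far[OF that, of "- d"] d by auto
  have 2: "complex_of_real m + d \<noteq> complex_of_real m - d"
  proof
    assume "complex_of_real m + d = complex_of_real m - d"
    hence "2 * d = 0" by (simp add: algebra_simps)
    thus False using d by simp
  qed
  have 3: "x k = x l \<longleftrightarrow> k = l" if "k \<in> {1..n}" "l \<in> {1..n}" for k l
    using that x by (auto dest: strict_mono_on_eqD)
  have "inj_on (half_twist n x i t) {1..n}"
  proof (rule inj_onI)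
    fix k l assume kl: "k \<in> {1..n}" "l \<in> {1..n}" and eq: "half_twist n x i t k = half_twist n x i t l"
    show "k = l"
      using kl eq 1[of k] 1[of l] 2 3[of k l] 2[symmetric] 1[of k, symmetric] 1[of l, symmetric]
      unfolding ht by (auto simp: base_conf_def split: if_splits)
  qed
  moreover have "half_twist n x i t \<in> extensional {1..n}"
    using i by (auto simp: ht base_conf_def extensional_def)
  ultimately show ?thesis by (simp add: topspace_PB)
qed

lemma pathin_half_twist:
  assumes x: "strict_mono_on {1..n} x" and i: "i \<in> {1..<n}"
  shows "pathin (PB n) (half_twist n x i)"
proof -
  have "continuous_on {0..1} (\<lambda>t. half_twist n x i t k)" for k
    by (cases "k = i"; cases "k = i + 1")
      (auto simp: half_twist_def Let_def intro!: continuous_intros)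
  thus ?thesis
    using half_twist_in_PB[OF assms]
    unfolding pathin_def PB_def continuous_map_in_subtopology continuous_map_componentwise
    by (auto simp: PiE_def)
qed

lemma artin_gen_in_braid_group:
  assumes x: "strict_mono_on {1..n} x" and i: "i \<in> {1..<n}"
  shows "artin_gen n x i \<in> carrier (braid_group n x)"
proof -
  have "Transposition.transpose i (i + 1) permutes {1..n}"
    using i by (intro permutes_swap_id) auto
  hence "loop_in (UB n) (orbit_map n (base_conf n x)) (orbit_map n \<circ> half_twist n x i)"
    using pathin_half_twist[OF assms] i
    by (auto simp: loop_in_def half_twist_0 half_twist_1[unfolded Suc_eq_plus1] orbit_map_permute
        pathin_def continuous_map_compose[OF _ continuous_map_orbit_map])
  thus ?thesis
    by (auto simp: artin_gen_def braid_group_def fundamental_group_def o_def)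
qed

end

theory Submission
  imports Defs
begin

text \<open>
  The fibre of the projection over the base point is the plane punctured at \<open>x 1, \<dots>, x (n - 1)\<close>.

  A null homotopy of the first \<open>n - 1\<close> strands can be followed by a family of maps of the plane
  that carry the moving points along and are the identity far out. Applied to the last strand,
  it deforms a pure braid in the kernel into the fibre. Applied backwards to a null homotopy in
  the configuration space of a loop in the fibre, it gives a null homotopy in the fibre of the
  loop twisted by a loop of maps; the twist has no effect on the class, because it is trivial
  near infinity. So the kernel is the fundamental group of the fibre.

  This group is free on loops around the punctures. Let \<open>A\<close> be the complement of the closed
  half-lines hanging down from the punctures, and let \<open>B i\<close> be a narrow vertical strip about the
  \<open>i\<close>-th puncture without the half-line rising from it. These sets are simply connected and
  cover the fibre, so a loop is a product of passages from one side of a strip to the other,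
  which generate. They are free generators because the fibre has a covering whose sheets are the
  reduced words, crossing a half-line acting by multiplication with a letter.

  The braid word is identified by lifting it to ordered configurations. There the last strand
  passes above the strands between \<open>i\<close> and \<open>n\<close>, turns once about strand \<open>i\<close> and returns, and a
  straight-line homotopy brings the other strands to rest.
\<close>

text \<open>In the exact sequence of the projection, injectivity on the fibre group hinges on the
  boundary map from the second homotopy group of the base. That map occurs here in concrete form. In
  a null homotopy of a loop of the fibre, the first \<open>n - 1\<close> strands are at the base
  configuration on all four sides of the square, so they form a sphere in the base; the twist is the
  loop of maps obtained by following this sphere. It is harmless because points far out are never
  disturbed. Of the transporting maps only continuity and avoidance of the moving points matter, so
  a push with a piecewise linear cut-off will do.

  \<open>A\<close> and \<open>B i\<close> meet in the two halves of the strip. This disconnectedness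
  is what produces one generator for each strip. Two kinds of reference path, one staying in
  \<open>A\<close> and one entering a strip from its left half, agree over the left half and differ
  by the generator over the right half.

  Coverings occur twice, for the labelled plane and for the quotient space of unordered
  configurations; hence they are treated for abstract topologies.\<close>

abbreviation unit_square :: "(real \<times> real) set" where
  "unit_square \<equiv> {0..1} \<times> {0..1}"

text \<open>The condition on the intermediate loops involves only their values at 0 and 1, so a
  homotopy may be prescribed on the square alone. In squares the first coordinate is the homotopy
  parameter and the second the time of the loop.\<close>

lemma loop_homotopic_iff:
  "loop_homotopic X x p q \<longleftrightarrow>
     (\<exists>h. continuous_map (top_of_set unit_square) X h \<and>
        (\<forall>t\<in>{0..1}. h (0, t) = p t) \<and> (\<forall>t\<in>{0..1}. h (1, t) = q t) \<and>
        (\<forall>s\<in>{0..1}. h (s, 0) = x \<and> h (s, 1) = x))"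
  unfolding loop_homotopic_def
  by (subst homotopic_with) (simp_all add: prod_topology_subtopology_eu)

lemma loop_homotopicE:
  assumes "loop_homotopic X x p q"
  obtains h where "continuous_map (top_of_set unit_square) X h"
    "\<And>t. t \<in> {0..1} \<Longrightarrow> h (0, t) = p t" "\<And>t. t \<in> {0..1} \<Longrightarrow> h (1, t) = q t"
    "\<And>s. s \<in> {0..1} \<Longrightarrow> h (s, 0) = x" "\<And>s. s \<in> {0..1} \<Longrightarrow> h (s, 1) = x"
proof -
  from assms[unfolded loop_homotopic_iff] obtain h where
    "continuous_map (top_of_set unit_square) X h \<and>
        (\<forall>t\<in>{0..1}. h (0, t) = p t) \<and> (\<forall>t\<in>{0..1}. h (1, t) = q t) \<and>
        (\<forall>s\<in>{0..1}. h (s, 0) = x \<and> h (s, 1) = x)" ..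
  thus thesis by (intro that[of h]) simp_all
qed

lemma loop_homotopicI:
  assumes "continuous_map (top_of_set unit_square) X h"
    "\<And>t. t \<in> {0..1} \<Longrightarrow> h (0, t) = p t" "\<And>t. t \<in> {0..1} \<Longrightarrow> h (1, t) = q t"
    "\<And>s. s \<in> {0..1} \<Longrightarrow> h (s, 0) = x" "\<And>s. s \<in> {0..1} \<Longrightarrow> h (s, 1) = x"
  shows "loop_homotopic X x p q"
  unfolding loop_homotopic_iff by (intro exI[of _ h]) (simp add: assms)

lemma pathin_join:
  assumes p: "pathin X p" and q: "pathin X q" and pq: "p 1 = q 0"
  shows "pathin X (loop_join p q)"
proof -
  have "continuous_map (top_of_set {0..1}) X
          (\<lambda>t::real. if t \<le> 1/2 then p (2 * t) else q (2 * t - 1))"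
  proof (rule continuous_map_cases_le)
    show "continuous_map (subtopology (top_of_set {0..1}) {t \<in> topspace (top_of_set {0..1}). t \<le> 1/2})
            X (\<lambda>t::real. p (2 * t))"
      using p unfolding pathin_def
      by (intro continuous_map_compose[of _ "top_of_set {0..1}" "\<lambda>t. 2 * t" X p, unfolded o_def])
        (auto simp: subtopology_subtopology intro!: continuous_intros)
    show "continuous_map (subtopology (top_of_set {0..1}) {t \<in> topspace (top_of_set {0..1}). 1/2 \<le> t})
            X (\<lambda>t::real. q (2 * t - 1))"
      using q unfolding pathin_def
      by (intro continuous_map_compose[of _ "top_of_set {0..1}" "\<lambda>t. 2 * t - 1" X q, unfolded o_def])
        (auto simp: subtopology_subtopology intro!: continuous_intros)
    show "p (2 * t) = q (2 * t - 1)" if "t \<in> topspace (top_of_set {0..1})" "t = 1/2" for t :: real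
      unfolding that(2) by (simp add: pq)
  qed (auto intro!: continuous_intros)
  thus ?thesis by (simp add: loop_join_def pathin_def)
qed

lemma pathin_rev: "pathin X p \<Longrightarrow> pathin X (loop_rev p)"
  unfolding loop_rev_def pathin_def
  by (auto intro!: continuous_map_compose[of _ "top_of_set {0..1}" "\<lambda>t. 1 - t" X p, unfolded o_def] continuous_intros)

section \<open>Covering maps of abstract topological spaces\<close>

text \<open>The sheets are given by sections over \<open>U\<close> with open images. The last clause
  makes distinct sections differ everywhere on \<open>U\<close>. It compares total functions, so
  each sheet must be represented by a single function.\<close>

definition even_cover ::
    "'e topology \<Rightarrow> 'b topology \<Rightarrow> ('e \<Rightarrow> 'b) \<Rightarrow> 'b set \<Rightarrow> ('b \<Rightarrow> 'e) set \<Rightarrow> bool" where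
  "even_cover E B p U S \<longleftrightarrow> openin B U \<and>
     (\<forall>\<sigma>\<in>S. continuous_map (subtopology B U) E \<sigma> \<and> openin E (\<sigma> ` U) \<and> (\<forall>u\<in>U. p (\<sigma> u) = u)) \<and>
     (\<forall>e\<in>topspace E. p e \<in> U \<longrightarrow> (\<exists>\<sigma>\<in>S. \<sigma> (p e) = e)) \<and>
     (\<forall>\<sigma>\<in>S. \<forall>\<tau>\<in>S. \<forall>u\<in>U. \<sigma> u = \<tau> u \<longrightarrow> \<sigma> = \<tau>)"

definition covering_of :: "'e topology \<Rightarrow> 'b topology \<Rightarrow> ('e \<Rightarrow> 'b) \<Rightarrow> bool" where
  "covering_of E B p \<longleftrightarrow>
     continuous_map E B p \<and> (\<forall>b\<in>topspace B. \<exists>U S. b \<in> U \<and> even_cover E B p U S)"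

text \<open>The set where the lifts agree is clopen: near any point both lifts run in fixed sheets,
  and they agree there if and only if the two sheets coincide.\<close>

lemma lift_unique:
  assumes cov: "covering_of E B p" and K: "connected_space K"
    and l: "continuous_map K E l" and l': "continuous_map K E l'"
    and eq: "\<And>k. k \<in> topspace K \<Longrightarrow> p (l k) = p (l' k)"
    and k0: "k0 \<in> topspace K" "l k0 = l' k0" and k: "k \<in> topspace K"
  shows "l k = l' k"
proof -
  let ?T = "{k \<in> topspace K. l k = l' k}"
  have lE: "l j \<in> topspace E" "l' j \<in> topspace E" if "j \<in> topspace K" for j
    using that l l' continuous_map_image_subset_topspace by fastforce+
  have nbhd: "\<exists>N. openin K N \<and> j \<in> N \<and> (\<forall>i\<in>N. (l i = l' i) = (l j = l' j))"
    if j: "j \<in> topspace K" for j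
  proof -
    have "p (l j) \<in> topspace B"
      using cov lE(1)[OF j] continuous_map_image_subset_topspace unfolding covering_of_def by fastforce
    then obtain U S where U: "p (l j) \<in> U" and ev: "even_cover E B p U S"
      using cov unfolding covering_of_def by blast
    obtain \<sigma> where s: "\<sigma> \<in> S" "\<sigma> (p (l j)) = l j"
      using ev lE(1)[OF j] U unfolding even_cover_def by blast
    obtain \<tau> where t: "\<tau> \<in> S" "\<tau> (p (l j)) = l' j"
      using ev lE(2)[OF j] U eq[OF j] unfolding even_cover_def by metis
    let ?N = "{i \<in> topspace K. l i \<in> \<sigma> ` U} \<inter> {i \<in> topspace K. l' i \<in> \<tau> ` U}"
    have "openin K ?N"
      using ev s(1) t(1) l l' unfolding even_cover_def
      by (intro openin_Int openin_continuous_map_preimage) auto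
    moreover have "j \<in> ?N"
      using j s(2) t(2) U by (auto intro!: image_eqI[of _ _ "p (l j)"])
    moreover have "(l i = l' i) = (l j = l' j)" if i: "i \<in> ?N" for i
    proof -
      obtain u v where uv: "u \<in> U" "l i = \<sigma> u" "v \<in> U" "l' i = \<tau> v"
        using i by auto
      have "p (\<sigma> u) = u" "p (\<tau> v) = v"
        using ev s(1) t(1) uv unfolding even_cover_def by auto
      hence "u = v" using eq[of i] i uv by auto
      moreover have dist: "\<sigma> w = \<tau> w \<Longrightarrow> \<sigma> = \<tau>" if "w \<in> U" for w
        using ev s(1) t(1) that unfolding even_cover_def by blast
      ultimately have "l i = l' i \<longleftrightarrow> \<sigma> = \<tau>"
        using dist[OF uv(1)] uv(2,4) by auto
      moreover have "l j = l' j \<longleftrightarrow> \<sigma> = \<tau>"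
        using dist[OF U] s(2) t(2) by auto
      ultimately show ?thesis by simp
    qed
    ultimately show ?thesis by blast
  qed
  have "openin K ?T"
  proof (subst openin_subopen, intro ballI)
    fix j assume j: "j \<in> ?T"
    then obtain N where "openin K N" "j \<in> N" "\<forall>i\<in>N. (l i = l' i) = (l j = l' j)"
      using nbhd[of j] by blast
    thus "\<exists>N. openin K N \<and> j \<in> N \<and> N \<subseteq> ?T"
      using j openin_subset[of K N] by blast
  qed
  moreover have "openin K (topspace K - ?T)"
  proof (subst openin_subopen, intro ballI)
    fix j assume j: "j \<in> topspace K - ?T"
    then obtain N where "openin K N" "j \<in> N" "\<forall>i\<in>N. (l i = l' i) = (l j = l' j)"
      using nbhd[of j] by blast
    thus "\<exists>N. openin K N \<and> j \<in> N \<and> N \<subseteq> topspace K - ?T"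
      using j openin_subset[of K N] by blast
  qed
  ultimately have "?T = {} \<or> ?T = topspace K"
    using K unfolding connected_space_clopen_in closedin_def by auto
  thus ?thesis using k0 k by auto
qed

text \<open>The starting point may be anywhere in \<open>R\<close>, so that a lift over one piece
  can be continued over a neighbouring piece from any common point.\<close>

definition liftable ::
    "'e topology \<Rightarrow> ('e \<Rightarrow> 'b) \<Rightarrow> (real \<times> real \<Rightarrow> 'b) \<Rightarrow> (real \<times> real) set \<Rightarrow> bool" where
  "liftable E p H R \<longleftrightarrow> (\<forall>z\<in>R. \<forall>e\<in>topspace E. p e = H z \<longrightarrow>
     (\<exists>L. continuous_map (top_of_set R) E L \<and> (\<forall>y\<in>R. p (L y) = H y) \<and> L z = e))"

text \<open>A lift over \<open>P\<close> is continued over \<open>Q\<close> from a common point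
  \<open>c\<close>. Connectedness of the overlap and uniqueness of lifts make the two agree there,
  and closedness permits pasting.\<close>

lemma liftable_Un_aux:
  assumes cov: "covering_of E B p" and cl: "closed P" "closed Q"
    and con: "connected (P \<inter> Q)" and ne: "P \<inter> Q \<noteq> {}"
    and lif: "liftable E p H P" "liftable E p H Q"
    and z: "z \<in> P" and e: "e \<in> topspace E" "p e = H z"
  shows "\<exists>L. continuous_map (top_of_set (P \<union> Q)) E L \<and> (\<forall>y\<in>P \<union> Q. p (L y) = H y) \<and> L z = e"
proof -
  obtain L1 where L1: "continuous_map (top_of_set P) E L1" "\<forall>y\<in>P. p (L1 y) = H y" "L1 z = e"
    using lif(1) z e unfolding liftable_def by blast
  obtain c where c: "c \<in> P" "c \<in> Q" using ne by auto
  have "L1 c \<in> topspace E"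
    using L1(1) c(1) continuous_map_image_subset_topspace[OF L1(1)] by auto
  then obtain L2 where L2: "continuous_map (top_of_set Q) E L2" "\<forall>y\<in>Q. p (L2 y) = H y" "L2 c = L1 c"
    using lif(2) c L1(2) unfolding liftable_def by metis
  have agree: "L1 y = L2 y" if y: "y \<in> P" "y \<in> Q" for y
  proof (rule lift_unique[OF cov, of "top_of_set (P \<inter> Q)" L1 L2 c])
    show "connected_space (top_of_set (P \<inter> Q))"
      using con by (simp add: connectedin_def flip: connectedin_iff_connected)
    show "continuous_map (top_of_set (P \<inter> Q)) E L1" "continuous_map (top_of_set (P \<inter> Q)) E L2"
      using L1(1) L2(1) continuous_map_from_subtopology_mono by blast+
  qed (use L1 L2 c y in auto)
  have "continuous_map (top_of_set (P \<union> Q)) E (\<lambda>y. if y \<in> P then L1 y else L2 y)"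
  proof (rule pasting_lemma_closed[of "{True, False}" _ "\<lambda>b. if b then P else Q" _ "\<lambda>b. if b then L1 else L2"])
    show "closedin (top_of_set (P \<union> Q)) (if i then P else Q)" for i
      using cl by (auto intro: closed_subset)
    show "continuous_map (subtopology (top_of_set (P \<union> Q)) (if i then P else Q)) E (if i then L1 else L2)" for i
      using L1(1) L2(1) by (auto simp: subtopology_subtopology Int_absorb1)
  qed (auto simp: agree)
  thus ?thesis
    using L1 L2 z by (intro exI[of _ "\<lambda>y. if y \<in> P then L1 y else L2 y"]) auto
qed

lemma liftable_Un:
  assumes "covering_of E B p" "closed P" "closed Q" "connected (P \<inter> Q)" "P \<inter> Q \<noteq> {}"
    and "liftable E p H P" "liftable E p H Q"
  shows "liftable E p H (P \<union> Q)"
  unfolding liftable_def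
proof (intro ballI impI)
  fix z e assume z: "z \<in> P \<union> Q" and e: "e \<in> topspace E" "p e = H z"
  show "\<exists>L. continuous_map (top_of_set (P \<union> Q)) E L \<and> (\<forall>y\<in>P \<union> Q. p (L y) = H y) \<and> L z = e"
  proof (cases "z \<in> P")
    case True
    thus ?thesis using liftable_Un_aux[OF assms] e by blast
  next
    case False
    hence "z \<in> Q" using z by simp
    thus ?thesis
      using liftable_Un_aux[of E B p Q P H z e] assms e by (simp add: Un_commute Int_commute)
  qed
qed

text \<open>The Bolzano principle is applied once in each direction. For a fixed \<open>x\<close>,
  short rectangles are stacked to a strip of full height around \<open>x\<close>, whose width may
  depend on \<open>x\<close>; then such strips are put side by side.\<close>

lemma liftable_square:
  assumes cov: "covering_of E B p"
    and H: "continuous_map (top_of_set unit_square) B H"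
  shows "liftable E p H unit_square"
proof -
  let ?Q = "\<lambda>x c d. 0 \<le> c \<and> d \<le> 1 \<longrightarrow> (\<exists>\<delta>>0. \<forall>a b. 0 \<le> a \<and> a \<le> x \<and> x \<le> b \<and> b \<le> 1 \<and> b - a < \<delta> \<longrightarrow>
              liftable E p H ({a..b} \<times> {c..d::real}))"
  have strip: "?Q x 0 1" if x: "0 \<le> x" "x \<le> 1" for x :: real
  proof (rule Bolzano[of 0 1 "?Q x"])
    fix a b c :: real assume 1: "?Q x a b" "?Q x b c" "a \<le> b" "b \<le> c"
    show "?Q x a c"
    proof
      assume ac: "0 \<le> a \<and> c \<le> 1"
      obtain d1 where d1: "d1 > 0" "\<forall>a' b'. 0 \<le> a' \<and> a' \<le> x \<and> x \<le> b' \<and> b' \<le> 1 \<and> b' - a' < d1 \<longrightarrow> liftable E p H ({a'..b'} \<times> {a..b})"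
        using 1 ac by fastforce
      obtain d2 where d2: "d2 > 0" "\<forall>a' b'. 0 \<le> a' \<and> a' \<le> x \<and> x \<le> b' \<and> b' \<le> 1 \<and> b' - a' < d2 \<longrightarrow> liftable E p H ({a'..b'} \<times> {b..c})"
        using 1 ac by fastforce
      show "\<exists>\<delta>>0. \<forall>a' b'. 0 \<le> a' \<and> a' \<le> x \<and> x \<le> b' \<and> b' \<le> 1 \<and> b' - a' < \<delta> \<longrightarrow> liftable E p H ({a'..b'} \<times> {a..c})"
      proof (intro exI[of _ "min d1 d2"] conjI allI impI)
        fix a' b' assume ab: "0 \<le> a' \<and> a' \<le> x \<and> x \<le> b' \<and> b' \<le> 1 \<and> b' - a' < min d1 d2"
        have int: "{a'..b'} \<times> {a..b} \<inter> {a'..b'} \<times> {b..c} = {a'..b'} \<times> {b}"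
          using 1 by auto
        have "liftable E p H ({a'..b'} \<times> {a..b} \<union> {a'..b'} \<times> {b..c})"
          using ab d1 d2 by (intro liftable_Un[OF cov]) (auto simp: int closed_Times intro!: connected_Times)
        moreover have "{a'..b'} \<times> {a..b} \<union> {a'..b'} \<times> {b..c} = {a'..b'} \<times> {a..c}"
          using 1 by auto
        ultimately show "liftable E p H ({a'..b'} \<times> {a..c})" by simp
      qed (use d1 d2 in auto)
    qed
  next
    fix y :: real assume y: "0 \<le> y" "y \<le> 1"
    have "H (x, y) \<in> topspace B"
      using continuous_map_image_subset_topspace[OF H] x y by auto
    then obtain U S where U: "H (x, y) \<in> U" and ev: "even_cover E B p U S"
      using cov unfolding covering_of_def by blast
    have "openin (top_of_set unit_square) {z \<in> topspace (top_of_set unit_square). H z \<in> U}"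
      using ev H unfolding even_cover_def by (intro openin_continuous_map_preimage) auto
    moreover have "(x, y) \<in> {z \<in> topspace (top_of_set unit_square). H z \<in> U}"
      using x y U by auto
    ultimately obtain \<epsilon> where "\<epsilon> > 0" and
      ball: "ball (x, y) \<epsilon> \<inter> unit_square \<subseteq> {z \<in> topspace (top_of_set unit_square). H z \<in> U}"
      unfolding openin_contains_ball by blast
    hence \<epsilon>: "\<epsilon> > 0" "\<And>z. z \<in> unit_square \<Longrightarrow> dist z (x, y) < \<epsilon> \<Longrightarrow> H z \<in> U"
      by (auto simp: dist_commute subset_iff)
    show "\<exists>d>0. \<forall>a b. a \<le> y \<and> y \<le> b \<and> b - a < d \<longrightarrow> ?Q x a b"
    \<comment> \<open>Sides shorter than \<epsilon>/2 keep a rectangle about \<open>(x, y)\<close>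
      within the ball of radius \<epsilon>, because the distance is at most the sum of the
      coordinate differences. There a single section composed with \<open>H\<close> is a
      lift.\<close>
    proof (rule exI[of _ "\<epsilon>/2"], intro conjI allI impI)
      fix a b assume ab: "a \<le> y \<and> y \<le> b \<and> b - a < \<epsilon>/2" and ab': "0 \<le> a \<and> b \<le> 1"
      show "\<exists>\<delta>>0. \<forall>a' b'. 0 \<le> a' \<and> a' \<le> x \<and> x \<le> b' \<and> b' \<le> 1 \<and> b' - a' < \<delta> \<longrightarrow> liftable E p H ({a'..b'} \<times> {a..b})"
      proof (intro exI[of _ "\<epsilon>/2"] conjI allI impI)
        fix a' b' assume a'b': "0 \<le> a' \<and> a' \<le> x \<and> x \<le> b' \<and> b' \<le> 1 \<and> b' - a' < \<epsilon>/2"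
        have R: "{a'..b'} \<times> {a..b} \<subseteq> unit_square" using ab' a'b' by auto
        have sub: "H z \<in> U" if z: "z \<in> {a'..b'} \<times> {a..b}" for z
        proof (rule \<epsilon>(2))
          have "dist z (x, y) \<le> \<bar>fst z - x\<bar> + \<bar>snd z - y\<bar>"
            by (metis dist_prod_def dist_real_def fst_conv snd_conv sqrt_sum_squares_le_sum_abs power2_abs abs_abs)
          also have "\<dots> < \<epsilon>" using z ab a'b' by auto
          finally show "dist z (x, y) < \<epsilon>" .
        qed (use z R in auto)
        show "liftable E p H ({a'..b'} \<times> {a..b})"
          unfolding liftable_def
        proof (intro ballI impI)
          fix z e assume z: "z \<in> {a'..b'} \<times> {a..b}" and e: "e \<in> topspace E" "p e = H z"
          obtain \<sigma> where s: "\<sigma> \<in> S" "\<sigma> (p e) = e"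
            using ev e sub[OF z] unfolding even_cover_def by metis
          have "continuous_map (top_of_set ({a'..b'} \<times> {a..b})) (subtopology B U) H"
            using continuous_map_from_subtopology_mono[OF H, of "{a'..b'} \<times> {a..b}"] R sub
            by (auto simp: continuous_map_in_subtopology)
          hence "continuous_map (top_of_set ({a'..b'} \<times> {a..b})) E (\<sigma> \<circ> H)"
            using ev s(1) unfolding even_cover_def by (intro continuous_map_compose) auto
          moreover have "p (\<sigma> (H y)) = H y" if "y \<in> {a'..b'} \<times> {a..b}" for y
            using ev s(1) sub[OF that] unfolding even_cover_def by blast
          ultimately show "\<exists>L. continuous_map (top_of_set ({a'..b'} \<times> {a..b})) E L \<and>
              (\<forall>y\<in>{a'..b'} \<times> {a..b}. p (L y) = H y) \<and> L z = e"
            using s(2) e(2) by (intro exI[of _ "\<sigma> \<circ> H"] conjI ballI) simp_all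
        qed
      qed (simp_all add: \<epsilon>(1))
    qed (simp_all add: \<epsilon>(1))
  qed simp
  let ?P = "\<lambda>a b. 0 \<le> a \<and> b \<le> 1 \<longrightarrow> liftable E p H ({a..b} \<times> {0..1::real})"
  have "?P 0 1"
  proof (rule Bolzano[of 0 1 ?P])
    fix a b c :: real assume 1: "?P a b" "?P b c" "a \<le> b" "b \<le> c"
    show "?P a c"
    proof
      assume ac: "0 \<le> a \<and> c \<le> 1"
      have int: "{a..b} \<times> {0..1} \<inter> {b..c} \<times> {0..1} = {b} \<times> {0..1::real}"
        using 1 by auto
      have "liftable E p H ({a..b} \<times> {0..1} \<union> {b..c} \<times> {0..1})"
        using 1 ac by (intro liftable_Un[OF cov]) (auto simp: int closed_Times intro!: connected_Times)
      moreover have "{a..b} \<times> {0..1} \<union> {b..c} \<times> {0..1} = {a..c} \<times> {0..1::real}"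
        using 1 by auto
      ultimately show "liftable E p H ({a..c} \<times> {0..1})" by simp
    qed
  next
    fix x :: real assume x: "0 \<le> x" "x \<le> 1"
    have "\<exists>\<delta>>0. \<forall>a b. 0 \<le> a \<and> a \<le> x \<and> x \<le> b \<and> b \<le> 1 \<and> b - a < \<delta> \<longrightarrow>
              liftable E p H ({a..b} \<times> {0..1::real})"
      by (rule strip[OF x, THEN mp]) simp
    then obtain \<delta> where \<delta>: "\<delta> > 0" "\<And>a b. 0 \<le> a \<Longrightarrow> a \<le> x \<Longrightarrow> x \<le> b \<Longrightarrow> b \<le> 1 \<Longrightarrow> b - a < \<delta> \<Longrightarrow>
              liftable E p H ({a..b} \<times> {0..1::real})"
      by blast
    show "\<exists>d>0. \<forall>a b. a \<le> x \<and> x \<le> b \<and> b - a < d \<longrightarrow> ?P a b"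
      by (rule exI[of _ \<delta>]) (simp add: \<delta>)
  qed simp
  thus ?thesis by simp
qed

text \<open>Each side of the lifted square is the lift of a known path. The sides at times 0 and 1
  cover constant paths and are therefore constant; the other two start where \<open>L\<close> and
  \<open>L'\<close> start. In particular \<open>L\<close> and \<open>L'\<close> end at the same
  point.\<close>

lemma lift_loop_homotopy:
  assumes cov: "covering_of E B p" and hom: "loop_homotopic B b \<gamma> \<gamma>'"
    and L: "pathin E L" "\<And>t. t \<in> {0..1} \<Longrightarrow> p (L t) = \<gamma> t"
    and L': "pathin E L'" "\<And>t. t \<in> {0..1} \<Longrightarrow> p (L' t) = \<gamma>' t"
    and start: "L 0 = L' 0"
  obtains h where "continuous_map (top_of_set unit_square) E h"
    "\<And>t. t \<in> {0..1} \<Longrightarrow> h (0, t) = L t" "\<And>t. t \<in> {0..1} \<Longrightarrow> h (1, t) = L' t"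
    "\<And>s. s \<in> {0..1} \<Longrightarrow> h (s, 0) = L 0" "\<And>s. s \<in> {0..1} \<Longrightarrow> h (s, 1) = L 1"
proof -
  obtain H where H: "continuous_map (top_of_set unit_square) B H"
      "\<And>t. t \<in> {0..1} \<Longrightarrow> H (0, t) = \<gamma> t" "\<And>t. t \<in> {0..1} \<Longrightarrow> H (1, t) = \<gamma>' t"
      "\<And>s. s \<in> {0..1} \<Longrightarrow> H (s, 0) = b" "\<And>s. s \<in> {0..1} \<Longrightarrow> H (s, 1) = b"
    using hom by (rule loop_homotopicE) blast
  have LE: "L 0 \<in> topspace E"
    using L(1) continuous_map_image_subset_topspace unfolding pathin_def by fastforce
  obtain h where h: "continuous_map (top_of_set unit_square) E h"
     "\<And>y. y \<in> {0..1} \<times> {0..1} \<Longrightarrow> p (h y) = H y" "h (0, 0) = L 0"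
  proof -
    have "p (L 0) = H (0, 0)" using L(2)[of 0] H(2)[of 0] by simp
    moreover have "(0, 0) \<in> unit_square" by simp
    ultimately have "\<exists>h. continuous_map (top_of_set unit_square) E h \<and>
        (\<forall>y\<in>unit_square. p (h y) = H y) \<and> h (0, 0) = L 0"
      using liftable_square[OF cov H(1)] LE unfolding liftable_def by blast
    thus ?thesis using that by blast
  qed
  have con: "connected_space (top_of_set {0..1::real})"
    using connected_Icc[of 0 "1::real"] by (simp add: connectedin_def flip: connectedin_iff_connected)
  have slice: "continuous_map (top_of_set {0..1}) E (\<lambda>t. h (f t))"
    if "continuous_on {0..1} f" "f ` {0..1} \<subseteq> {0..1} \<times> {0..1}" for f :: "real \<Rightarrow> real \<times> real"
    using continuous_map_compose[OF _ h(1), of "top_of_set {0..1}" f] that by (auto simp: o_def)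
  have eqI: "h (f t) = l t"
    if "continuous_on {0..1} f" "f ` {0..1} \<subseteq> {0..1} \<times> {0..1}" "pathin E l"
      "\<And>t. t \<in> {0..1} \<Longrightarrow> p (l t) = H (f t)" "h (f 0) = l 0" "t \<in> {0..1}"
    for f :: "real \<Rightarrow> real \<times> real" and l t
    by (rule lift_unique[OF cov con slice[OF that(1,2)], of l 0])
      (use that h(2) in \<open>auto simp: pathin_def image_subset_iff\<close>)
  have const: "pathin E (\<lambda>_. e)" if "e \<in> topspace E" for e
    using that by (simp add: pathin_def)
  have L1: "L 1 \<in> topspace E"
    using L(1) continuous_map_image_subset_topspace unfolding pathin_def by fastforce
  have ci: "continuous_on {0..1} (\<lambda>t. (c, t))" "continuous_on {0..1} (\<lambda>t. (t, c))" for c :: real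
    by (intro continuous_intros)+
  have im: "(\<lambda>t. (c, t)) ` {0..1} \<subseteq> unit_square" "(\<lambda>t. (t, c)) ` {0..1} \<subseteq> unit_square"
    if "c \<in> {0..1}" for c :: real
    using that by auto
  have z: "0 \<in> {0..1::real}" "1 \<in> {0..1::real}" by simp_all
  have a: "h (0, t) = L t" if "t \<in> {0..1}" for t
    by (rule eqI[OF ci(1) im(1)[OF z(1)] L(1) _ _ that]) (simp_all only: L(2) H(2) h(3))
  have b: "h (s, 0) = L 0" if "s \<in> {0..1}" for s
    by (rule eqI[OF ci(2) im(2)[OF z(1)] const[OF LE] _ _ that])
      (simp_all only: L(2)[OF z(1)] H(2)[OF z(1), symmetric] H(4)[OF z(1)] H(4) h(3))
  have c: "h (s, 1) = L 1" if "s \<in> {0..1}" for s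
    by (rule eqI[OF ci(2) im(2)[OF z(2)] const[OF L1] _ _ that])
      (simp_all only: L(2)[OF z(2)] H(2)[OF z(2), symmetric] H(5)[OF z(1)] H(5) a[OF z(2)])
  have d: "h (1, t) = L' t" if "t \<in> {0..1}" for t
    by (rule eqI[OF ci(1) im(1)[OF z(2)] L'(1) _ _ that]) (simp_all only: L'(2) H(3) b[OF z(2)] start)
  show thesis by (rule that[OF h(1) a d b c])
qed

lemma path_lift:
  assumes cov: "covering_of E B p" and g: "pathin B \<gamma>" and e: "e \<in> topspace E" "p e = \<gamma> 0"
  obtains L where "pathin E L" "\<And>t. t \<in> {0..1} \<Longrightarrow> p (L t) = \<gamma> t" "L 0 = e"
proof -
  have "continuous_map (top_of_set unit_square) (top_of_set {0..1}) (snd :: real \<times> real \<Rightarrow> real)"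
    by (auto intro!: continuous_intros)
  hence "continuous_map (top_of_set unit_square) B (\<gamma> \<circ> snd)"
    using g unfolding pathin_def by (rule continuous_map_compose)
  from liftable_square[OF cov this, unfolded liftable_def, rule_format, of "(0, 0)" e]
  obtain h where h: "continuous_map (top_of_set unit_square) E h"
      "\<forall>y\<in>unit_square. p (h y) = \<gamma> (snd y)" "h (0, 0) = e"
    using e by (auto simp: o_def)
  have "pathin E (\<lambda>t. h (0, t))"
    unfolding pathin_def
    by (rule continuous_map_compose[OF _ h(1), of "top_of_set {0..1}" "\<lambda>t. (0, t)", unfolded o_def])
      (auto intro!: continuous_intros)
  thus thesis using h(2,3) by (intro that[of "\<lambda>t. h (0, t)"]) simp_all
qed

section \<open>Reduced words\<close>

definition letter :: "('g, 'm) monoid_scheme \<Rightarrow> ('i \<Rightarrow> 'g) \<Rightarrow> 'i \<times> bool \<Rightarrow> 'g" where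
  "letter G b l = (if snd l then b (fst l) else inv\<^bsub>G\<^esub> b (fst l))"

lemma word_value_simps [simp]:
  "word_value G b [] = \<one>\<^bsub>G\<^esub>"
  "word_value G b (l # w) = letter G b l \<otimes>\<^bsub>G\<^esub> word_value G b w"
  by (auto simp: word_value_def list_mult_def letter_def split: prod.split)

text \<open>The left regular action of a generator of the free group or its inverse, with reduced
  words as normal forms of the group elements.\<close>

fun act :: "'i \<times> bool \<Rightarrow> ('i \<times> bool) list \<Rightarrow> ('i \<times> bool) list" where
  "act l [] = [l]"
| "act l (m # w) = (if fst m = fst l \<and> snd m \<noteq> snd l then w else l # m # w)"

lemma reduced_words_Nil [simp]: "[] \<in> reduced_words I"
  by (simp add: reduced_words_def)

lemma reduced_words_Cons:
  "l # w \<in> reduced_words I \<longleftrightarrow> fst l \<in> I \<and> w \<in> reduced_words I \<and>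
     (w \<noteq> [] \<longrightarrow> \<not> (fst l = fst (hd w) \<and> snd l \<noteq> snd (hd w)))"
  by (cases w) (auto simp: reduced_words_def split: prod.splits)

lemma rev_reduced_words: "w \<in> reduced_words I \<Longrightarrow> rev w \<in> reduced_words I"
  unfolding reduced_words_def
  by (auto elim!: successively_mono)

lemma act_reduced: "w \<in> reduced_words I \<Longrightarrow> fst l \<in> I \<Longrightarrow> act l w \<in> reduced_words I"
  by (cases w) (auto simp: reduced_words_Cons)

lemma act_Cons_reduced: "l # w \<in> reduced_words I \<Longrightarrow> act l w = l # w"
  by (cases w) (auto simp: reduced_words_Cons)

lemma act_inverse: "w \<in> reduced_words I \<Longrightarrow> act (i, \<not> e) (act (i, e) w) = w"
proof (cases w)
  case (Cons m v)
  assume w: "w \<in> reduced_words I"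
  show ?thesis
  proof (cases "fst m = i \<and> snd m \<noteq> e")
    case True
    hence m: "m = (i, \<not> e)" by (cases m) auto
    have "act (i, \<not> e) v = (i, \<not> e) # v"
      using w act_Cons_reduced[of "(i, \<not> e)" v I] by (simp add: Cons m)
    thus ?thesis by (simp add: Cons m)
  qed (auto simp: Cons)
qed simp

text \<open>No cancellation occurs while the letters of a reduced word are put in front one after
  the other. The word comes out reversed because the letters act in the order in which loops are
  traversed, the first loop first.\<close>

lemma foldl_act_reduced:
  fixes w :: "('i \<times> bool) list"
  assumes "w \<in> reduced_words I"
  shows "foldl (\<lambda>v l. act l v) [] w = rev w"
proof -
  have "foldr act w [] = w" if "w \<in> reduced_words I" for w :: "('i \<times> bool) list"
    using that
  proof (induction w)
    case (Cons l w)
    moreover have "w \<in> reduced_words I" using Cons.prems by (simp add: reduced_words_Cons)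
    ultimately show ?case using act_Cons_reduced[OF Cons.prems] by simp
  qed simp
  from this[OF rev_reduced_words[OF assms]] show ?thesis by (simp add: foldr_conv_foldl)
qed

context group
begin

lemma letter_closed: "b ` I \<subseteq> carrier G \<Longrightarrow> fst l \<in> I \<Longrightarrow> letter G b l \<in> carrier G"
  by (auto simp: letter_def)

lemma word_value_closed: "b ` I \<subseteq> carrier G \<Longrightarrow> fst ` set w \<subseteq> I \<Longrightarrow> word_value G b w \<in> carrier G"
  by (induction w) (auto intro!: m_closed letter_closed[of b I])

lemma word_value_act:
  assumes "b ` I \<subseteq> carrier G" "fst ` set w \<subseteq> I" "fst l \<in> I"
  shows "word_value G b (act l w) = letter G b l \<otimes> word_value G b w"
proof (cases w)
  case (Cons m v)
  have c: "word_value G b v \<in> carrier G" "b (fst l) \<in> carrier G"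
    using assms Cons by (auto intro: word_value_closed)
  show ?thesis
    using c by (auto simp: Cons letter_def m_assoc[symmetric])
qed simp

text \<open>Products and inverses are formed one letter at a time by \<open>word_value_act\<close>,
  which avoids computing the reduced form of a concatenation.\<close>

lemma subgroup_word_values:
  assumes b: "b ` I \<subseteq> carrier G"
  shows "subgroup (word_value G b ` reduced_words I) G"
proof (rule subgroupI)
  let ?H = "word_value G b ` reduced_words I"
  have red: "fst ` set w \<subseteq> I" if "w \<in> reduced_words I" for w
    using that by (simp add: reduced_words_def)
  show H: "?H \<subseteq> carrier G"
    using word_value_closed[OF b] red by auto
  show "?H \<noteq> {}" using reduced_words_Nil[of I] by blast
  have one: "\<one> \<in> ?H" by (intro image_eqI[of _ _ "[]"]) auto
  have letter: "letter G b l \<otimes> h \<in> ?H" if "fst l \<in> I" "h \<in> ?H" for l h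
  proof -
    obtain w where w: "w \<in> reduced_words I" "h = word_value G b w" using \<open>h \<in> ?H\<close> by auto
    thus ?thesis
      using word_value_act[OF b red[OF w(1)] that(1)] act_reduced[OF w(1) that(1)] by force
  qed
  have mult: "word_value G b w \<otimes> h \<in> ?H" if "fst ` set w \<subseteq> I" "h \<in> ?H" for w h
    using that
  proof (induction w)
    case Nil
    thus ?case using H by auto
  next
    case (Cons l w)
    have "h \<in> carrier G" using Cons.prems(2) H by blast
    hence "word_value G b (l # w) \<otimes> h = letter G b l \<otimes> (word_value G b w \<otimes> h)"
      using Cons.prems(1) by (auto intro!: m_assoc letter_closed[OF b] word_value_closed[OF b])
    thus ?case using letter[of l] Cons by auto
  qed
  show "x \<otimes> y \<in> ?H" if "x \<in> ?H" "y \<in> ?H" for x y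
    using that mult red by auto
  have "inv (word_value G b w) \<otimes> h \<in> ?H" if "fst ` set w \<subseteq> I" "h \<in> ?H" for w h
    using that
  proof (induction w arbitrary: h)
    case Nil
    thus ?case using H by auto
  next
    case (Cons l w)
    have "inv (letter G b l) = letter G b (fst l, \<not> snd l)"
      using Cons.prems b by (auto simp: letter_def)
    moreover have "h \<in> carrier G" using Cons.prems(2) H by blast
    moreover have "word_value G b w \<in> carrier G" "letter G b l \<in> carrier G"
      using Cons.prems(1) by (auto intro!: letter_closed[OF b] word_value_closed[OF b])
    ultimately have "inv (word_value G b (l # w)) \<otimes> h
        = inv (word_value G b w) \<otimes> (letter G b (fst l, \<not> snd l) \<otimes> h)"
      by (metis inv_closed inv_mult_group m_assoc word_value_simps(2))
    thus ?case using Cons letter[of "(fst l, \<not> snd l)" h] by auto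
  qed
  note inv = this
  show "inv x \<in> ?H" if x: "x \<in> ?H" for x
  proof -
    obtain w where w: "x = word_value G b w" "w \<in> reduced_words I" using x by blast
    have "inv x \<in> carrier G" using x H by blast
    thus ?thesis using inv[OF red[OF w(2)] one] by (simp add: w(1))
  qed
qed

lemma generators_in_word_values:
  assumes "b ` I \<subseteq> carrier G" "i \<in> I"
  shows "b i \<in> word_value G b ` reduced_words I"
  using assms by (intro image_eqI[of _ _ "[(i, True)]"]) (auto simp: letter_def reduced_words_Cons)

end

lemma freely_generated_by_hom:
  assumes G: "group G" and G': "group G'" and h: "h \<in> hom G G'" "inj_on h (carrier G)"
    and free: "freely_generated_by G (carrier G) I b" and b': "\<And>i. i \<in> I \<Longrightarrow> b' i = h (b i)"
  shows "freely_generated_by G' (h ` carrier G) I b'"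
proof -
  interpret group_hom G G' h
    using G G' h by (simp add: group_hom_def group_hom_axioms_def)
  have b: "b ` I \<subseteq> carrier G" and bij: "bij_betw (word_value G b) (reduced_words I) (carrier G)"
    using free by (auto simp: freely_generated_by_def)
  have wv: "word_value G' b' w = h (word_value G b w)" if "fst ` set w \<subseteq> I" for w
    using that
  proof (induction w)
    case (Cons l w)
    have "letter G' b' l = h (letter G b l)"
      using Cons.prems b by (auto simp: letter_def b')
    thus ?case
      using Cons G.letter_closed[OF b] G.word_value_closed[OF b] by auto
  qed simp
  have "bij_betw (h \<circ> word_value G b) (reduced_words I) (h ` carrier G)"
    using bij_betw_trans[OF bij inj_on_imp_bij_betw[OF h(2)]] .
  hence "bij_betw (word_value G' b') (reduced_words I) (h ` carrier G)"
    by (rule bij_betw_cong[THEN iffD1, rotated]) (auto simp: wv reduced_words_def)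
  moreover have "subgroup (h ` carrier G) G'"
    by (rule img_is_subgroup)
  ultimately show ?thesis
    using b b' by (auto simp: freely_generated_by_def)
qed

section \<open>Differences of paths in the fundamental group of a subset of a normed space\<close>

definition pth :: "'a::real_normed_vector set \<Rightarrow> (real \<Rightarrow> 'a) \<Rightarrow> 'a \<Rightarrow> 'a \<Rightarrow> bool" where
  "pth S p u v \<longleftrightarrow> path p \<and> path_image p \<subseteq> S \<and> pathstart p = u \<and> pathfinish p = v"

lemma pth_join: "pth S p u v \<Longrightarrow> pth S q v w \<Longrightarrow> pth S (p +++ q) u w"
  by (auto simp: pth_def path_image_join)

lemma pth_reverse: "pth S p u v \<Longrightarrow> pth S (reversepath p) v u"
  by (auto simp: pth_def)

lemma pth_mono: "pth S p u v \<Longrightarrow> S \<subseteq> T \<Longrightarrow> pth T p u v"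
  by (auto simp: pth_def)

lemma pth_linepath: "closed_segment u v \<subseteq> S \<Longrightarrow> pth S (linepath u v) u v"
  by (auto simp: pth_def)

lemma pth_homotopic: "homotopic_paths S p q \<Longrightarrow> pth S p u v \<Longrightarrow> pth S q u v"
  unfolding pth_def
  using homotopic_paths_imp_path homotopic_paths_imp_pathfinish homotopic_paths_imp_pathstart
    homotopic_paths_imp_subset by metis

lemma loop_in_iff_pth: "loop_in (top_of_set S) b p \<longleftrightarrow> pth S p b b"
  by (auto simp: loop_in_def pathin_def pth_def path_def path_image_def pathstart_def pathfinish_def)

lemma loop_join_eq: "loop_join p q = p +++ q"
  by (simp add: loop_join_def joinpaths_def)

lemma loop_homotopic_iff_paths:
  "pth S p b b \<Longrightarrow> loop_homotopic (top_of_set S) b p q \<longleftrightarrow> homotopic_paths S p q"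
  by (simp add: loop_homotopic_def homotopic_paths_def pth_def pathstart_def pathfinish_def)

locale pointed_subset =
  fixes S :: "'a::real_normed_vector set" and b :: 'a
  assumes base: "b \<in> S"
begin

abbreviation "\<G> \<equiv> fundamental_group (top_of_set S) b"

abbreviation cls :: "(real \<Rightarrow> 'a) \<Rightarrow> (real \<Rightarrow> 'a) set" where
  "cls \<equiv> loop_class (top_of_set S) b"

sublocale group "fundamental_group (top_of_set S) b"
  using base by (intro group_fundamental_group) simp

lemma cls_closed: "pth S p b b \<Longrightarrow> cls p \<in> carrier \<G>"
  by (simp add: fundamental_group_def loop_in_iff_pth)

lemma carrierE:
  assumes "g \<in> carrier \<G>"
  obtains p where "g = cls p" "pth S p b b"
  using assms by (auto simp: fundamental_group_def loop_in_iff_pth)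

lemma cls_eq_iff: "pth S p b b \<Longrightarrow> cls p = cls q \<longleftrightarrow> homotopic_paths S p q"
  by (simp add: loop_class_eq_iff loop_in_iff_pth loop_homotopic_iff_paths)

lemma cls_mult: "pth S p b b \<Longrightarrow> pth S q b b \<Longrightarrow> cls p \<otimes>\<^bsub>\<G>\<^esub> cls q = cls (p +++ q)"
  by (simp add: fundamental_group_mult loop_in_iff_pth loop_join_eq)

lemma pth_const: "pth S (linepath b b) b b"
  using base by (simp add: pth_def)

lemma cls_one: "\<one>\<^bsub>\<G>\<^esub> = cls (linepath b b)"
proof -
  have "linepath b b = (\<lambda>_. b)" by (auto simp: linepath_def fun_eq_iff algebra_simps simp flip: scaleR_add_left)
  thus ?thesis by (simp add: fundamental_group_def)
qed

text \<open>This compares two paths from the base point to a common end. \<open>diff_mult\<close> is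
  the cocycle rule, and by \<open>diff_extend\<close> prolonging both paths changes nothing;
  together they let the pieces of a subdivided loop telescope.\<close>

definition diff :: "(real \<Rightarrow> 'a) \<Rightarrow> (real \<Rightarrow> 'a) \<Rightarrow> (real \<Rightarrow> 'a) set" where
  "diff p q = cls (p +++ reversepath q)"

lemma pth_diff: "pth S p b z \<Longrightarrow> pth S q b z \<Longrightarrow> pth S (p +++ reversepath q) b b"
  by (blast intro: pth_join pth_reverse)

lemma diff_closed: "pth S p b z \<Longrightarrow> pth S q b z \<Longrightarrow> diff p q \<in> carrier \<G>"
  unfolding diff_def by (blast intro: cls_closed pth_diff)

lemma diff_cong:
  assumes "pth S p b z" "pth S q b z" "homotopic_paths S p p'" "homotopic_paths S q q'"
  shows "diff p q = diff p' q'"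
proof -
  have "homotopic_paths S (p +++ reversepath q) (p' +++ reversepath q')"
    using assms by (intro homotopic_paths_join) (auto simp: homotopic_paths_reversepath pth_def)
  thus ?thesis using pth_diff[OF assms(1,2)] by (simp add: diff_def cls_eq_iff)
qed

lemma diff_self: "pth S p b z \<Longrightarrow> diff p p = \<one>\<^bsub>\<G>\<^esub>"
  unfolding diff_def cls_one
  using homotopic_paths_rinv[of p S] pth_diff[of p z p] by (subst cls_eq_iff) (auto simp: pth_def)

lemma diff_homotopic: "pth S p b z \<Longrightarrow> homotopic_paths S p q \<Longrightarrow> diff p q = \<one>\<^bsub>\<G>\<^esub>"
  using diff_cong[of p z p p q] diff_self by (metis homotopic_paths_refl pth_def)

lemma cancel_middle:
  assumes p: "pth S p u z" and s: "pth S s z w" and q: "pth S q z v"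
  shows "homotopic_paths S ((p +++ s) +++ (reversepath s +++ q)) (p +++ q)"
proof -
  note * = pth_reverse[OF s]
  have "homotopic_paths S ((p +++ s) +++ (reversepath s +++ q)) (p +++ (s +++ (reversepath s +++ q)))"
    using p s q by (intro homotopic_paths_sym[OF homotopic_paths_assoc])
      (auto simp: pth_def path_image_join)
  also have "homotopic_paths S \<dots> (p +++ ((s +++ reversepath s) +++ q))"
    using p s q by (intro homotopic_paths_join homotopic_paths_assoc) (auto simp: pth_def path_image_join)
  also have "homotopic_paths S \<dots> (p +++ (linepath z z +++ q))"
    using p s q homotopic_paths_rinv[of s S]
    by (intro homotopic_paths_join) (auto simp: pth_def path_image_join)
  also have "homotopic_paths S \<dots> (p +++ q)"
    using p q by (intro homotopic_paths_join homotopic_paths_lid') (auto simp: pth_def)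
  finally show ?thesis .
qed

lemma diff_mult:
  assumes p: "pth S p b z" and q: "pth S q b z" and r: "pth S r b z"
  shows "diff p q \<otimes>\<^bsub>\<G>\<^esub> diff q r = diff p r"
proof -
  have "homotopic_paths S ((p +++ reversepath q) +++ (reversepath (reversepath q) +++ reversepath r))
          (p +++ reversepath r)"
    by (rule cancel_middle[OF p pth_reverse[OF q] pth_reverse[OF r]])
  moreover have "pth S ((p +++ reversepath q) +++ (q +++ reversepath r)) b b"
    using p q r by (intro pth_join[OF pth_diff pth_diff])
  ultimately show ?thesis
    using p q r by (simp add: diff_def cls_mult pth_diff cls_eq_iff)
qed

lemma diff_inv:
  assumes "pth S p b z" "pth S q b z"
  shows "inv\<^bsub>\<G>\<^esub> diff p q = diff q p"
  using assms by (intro inv_equality) (auto simp: diff_mult diff_self diff_closed)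

lemma diff_extend:
  assumes p: "pth S p b z" and q: "pth S q b z" and s: "pth S s z w"
  shows "diff (p +++ s) (q +++ s) = diff p q"
proof -
  have "homotopic_paths S ((p +++ s) +++ (reversepath s +++ reversepath q)) (p +++ reversepath q)"
    by (rule cancel_middle[OF p s pth_reverse[OF q]])
  moreover have "reversepath (q +++ s) = reversepath s +++ reversepath q"
    using q s by (intro reversepath_joinpaths) (auto simp: pth_def)
  ultimately show ?thesis
    using cls_eq_iff[OF pth_diff[OF pth_join[OF p s] pth_join[OF q s]]] by (simp add: diff_def)
qed

lemma pth_assoc:
  "pth S p u v \<Longrightarrow> pth S q v w \<Longrightarrow> pth S r w z \<Longrightarrow> homotopic_paths S (p +++ (q +++ r)) ((p +++ q) +++ r)"
  by (intro homotopic_paths_assoc) (auto simp: pth_def)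

lemma pth_join_cong:
  "pth S p u v \<Longrightarrow> pth S q v w \<Longrightarrow> homotopic_paths S p p' \<Longrightarrow> homotopic_paths S q q'
     \<Longrightarrow> homotopic_paths S (p +++ q) (p' +++ q')"
  by (intro homotopic_paths_join) (auto simp: pth_def)

lemma pth_refl: "pth S p u v \<Longrightarrow> homotopic_paths S p p"
  by (simp add: pth_def)

end

lemma simply_connected_unique_path:
  fixes U :: "'a::real_normed_vector set"
  shows "simply_connected U \<Longrightarrow> U \<subseteq> S \<Longrightarrow> pth U p u v \<Longrightarrow> pth U q u v \<Longrightarrow> homotopic_paths S p q"
  by (rule homotopic_paths_subset[of U]) (simp_all add: simply_connected_eq_homotopic_paths pth_def)

lemma path_connected_pth:
  "path_connected U \<Longrightarrow> u \<in> U \<Longrightarrow> v \<in> U \<Longrightarrow> \<exists>p. pth U p u v"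
  by (auto simp: path_connected_def pth_def)


section \<open>The plane with finitely many real punctures\<close>

text \<open>\<open>e\<close> is the half-width of the vertical strips, which are disjoint because
  punctures are at least \<open>2 * e\<close> apart. The last assumption puts the base point into
  the set \<open>A\<close> below.\<close>

locale punctured_plane =
  fixes I :: "'i set" and x :: "'i \<Rightarrow> real" and e :: real and b :: complex
  assumes fin: "finite I" and e: "e > 0"
    and sep: "\<And>i j. i \<in> I \<Longrightarrow> j \<in> I \<Longrightarrow> i \<noteq> j \<Longrightarrow> 2 * e \<le> \<bar>x i - x j\<bar>"
    and b: "\<And>i. i \<in> I \<Longrightarrow> Re b \<noteq> x i"
begin

definition S :: "complex set" where "S = {z. \<forall>i\<in>I. z \<noteq> of_real (x i)}"

definition "A = {z. \<forall>i\<in>I. Re z = x i \<longrightarrow> Im z > 0}"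

definition "B i = {z. \<bar>Re z - x i\<bar> < e \<and> (Re z = x i \<longrightarrow> Im z < 0)}"
definition "L i = {z. \<bar>Re z - x i\<bar> < e \<and> Re z < x i}"
definition "R i = {z. \<bar>Re z - x i\<bar> < e \<and> Re z > x i}"

lemma strip_disjoint: "i \<in> I \<Longrightarrow> j \<in> I \<Longrightarrow> \<bar>Re z - x i\<bar> < e \<Longrightarrow> \<bar>Re z - x j\<bar> < e \<Longrightarrow> i = j"
  using sep[of i j] by fastforce

lemma b_in_A: "b \<in> A" using b by (auto simp: A_def)

lemma A_subset: "A \<subseteq> S" by (auto simp: A_def S_def)

lemma B_subset: "i \<in> I \<Longrightarrow> B i \<subseteq> S"
proof
  fix z assume i: "i \<in> I" and z: "z \<in> B i"
  have "z \<noteq> of_real (x j)" if "j \<in> I" for j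
    using z strip_disjoint[OF i that, of z] e by (auto simp: B_def)
  thus "z \<in> S" by (simp add: S_def)
qed

text \<open>Off its central line a strip lies in \<open>A\<close>, because no other puncture has its
  vertical line in that strip. On the central line \<open>A\<close> lies above the puncture and
  \<open>B i\<close> below it.\<close>

lemma halves: "i \<in> I \<Longrightarrow> A \<inter> B i = L i \<union> R i"
proof -
  assume i: "i \<in> I"
  have *: "z \<in> A" if z: "\<bar>Re z - x i\<bar> < e" "Re z \<noteq> x i" for z
    using z strip_disjoint[OF i _ z(1)] e by (fastforce simp: A_def)
  have "z \<in> A \<inter> B i \<longleftrightarrow> z \<in> L i \<union> R i" for z
  proof (cases "Re z = x i")
    case True
    thus ?thesis using i by (auto simp: A_def B_def L_def R_def)
  next
    case False
    thus ?thesis using * unfolding B_def L_def R_def by auto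
  qed
  thus ?thesis by blast
qed

lemma S_cover: "S = A \<union> (\<Union>i\<in>I. B i)"
proof
  show "A \<union> (\<Union>i\<in>I. B i) \<subseteq> S" using A_subset B_subset by auto
  show "S \<subseteq> A \<union> (\<Union>i\<in>I. B i)"
  proof
    fix z assume z: "z \<in> S"
    show "z \<in> A \<union> (\<Union>i\<in>I. B i)"
    proof (cases "z \<in> A")
      case False
      then obtain i where i: "i \<in> I" "Re z = x i" "Im z \<le> 0" by (force simp: A_def)
      moreover have "Im z \<noteq> 0" using z i by (auto simp: S_def complex_eq_iff)
      ultimately have "z \<in> B i" using e by (simp add: B_def)
      thus ?thesis using i(1) by blast
    qed simp
  qed
qed

lemma open_A: "open A"
proof -
  have "A = (\<Inter>i\<in>I. {z. Re z < x i} \<union> {z. Re z > x i} \<union> {z. Im z > 0})"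
    by (auto simp: A_def neq_iff)
  thus ?thesis
    using fin by (auto intro!: open_INT open_Un open_halfspace_Re_lt open_halfspace_Re_gt open_halfspace_Im_gt)
qed

lemma open_L: "open (L i)" and open_R: "open (R i)"
proof -
  have "L i = {z. Re z > x i - e} \<inter> {z. Re z < x i}" "R i = {z. Re z < x i + e} \<inter> {z. Re z > x i}"
    by (auto simp: L_def R_def abs_if split: if_splits)
  thus "open (L i)" "open (R i)"
    by (auto intro!: open_Int open_halfspace_Re_lt open_halfspace_Re_gt)
qed

lemma open_B: "open (B i)"
proof -
  have "B i = ({z. Re z > x i - e} \<inter> {z. Re z < x i + e}) \<inter>
     ({z. Re z < x i} \<union> {z. Re z > x i} \<union> {z. Im z < 0})"
    by (auto simp: B_def neq_iff abs_if split: if_splits)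
  thus ?thesis
    by (auto intro!: open_Int open_Un open_halfspace_Re_lt open_halfspace_Re_gt open_halfspace_Im_lt)
qed

lemma convex_L: "convex (L i)" and convex_R: "convex (R i)"
proof -
  have "L i = {z. Re z > x i - e} \<inter> {z. Re z < x i}" "R i = {z. Re z < x i + e} \<inter> {z. Re z > x i}"
    by (auto simp: L_def R_def abs_if split: if_splits)
  thus "convex (L i)" "convex (R i)"
    by (auto intro!: convex_Int convex_halfspace_Re_lt convex_halfspace_Re_gt)
qed

text \<open>Moving upwards never leaves \<open>A\<close>. The shift by
  \<open>1 + \<bar>Im z\<bar>\<close> brings every point into the upper half-plane, a convex subset
  of \<open>A\<close>, which is then contracted to \<i>.\<close>

lemma simply_connected_A: "simply_connected A"
proof (rule contractible_imp_simply_connected)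
  define u where "u z = z + \<i> * of_real (1 + \<bar>Im z\<bar>)" for z
  have u: "continuous_on A u" unfolding u_def by (intro continuous_intros)
  have "homotopic_with_canon (\<lambda>z. True) A A id u"
  proof (rule homotopic_with_linear)
    fix z assume z: "z \<in> A"
    show "closed_segment (id z) (u z) \<subseteq> A"
    proof
      fix w assume "w \<in> closed_segment (id z) (u z)"
      then obtain s where s: "0 \<le> s" "w = (1 - s) *\<^sub>R z + s *\<^sub>R u z"
        by (auto simp: closed_segment_def)
      hence "Re w = Re z" "Im w = Im z + s * (1 + \<bar>Im z\<bar>)"
        by (auto simp: u_def algebra_simps)
      moreover have "s * (1 + \<bar>Im z\<bar>) \<ge> 0" using s by simp
      ultimately show "w \<in> A" using z by (fastforce simp: A_def)
    qed
  qed (use u in \<open>auto simp: id_def\<close>)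
  moreover have "homotopic_with_canon (\<lambda>z. True) A A u (\<lambda>_. \<i>)"
  proof (rule homotopic_with_linear)
    fix z assume z: "z \<in> A"
    have "Im (u z) > 0" by (auto simp: u_def)
    hence "closed_segment (u z) \<i> \<subseteq> {w. Im w > 0}"
      by (intro closed_segment_subset convex_halfspace_Im_gt) auto
    thus "closed_segment (u z) \<i> \<subseteq> A" by (auto simp: A_def)
  qed (use u in auto)
  ultimately show "contractible A"
    unfolding contractible_def by (meson homotopic_with_trans)
qed

text \<open>The star centre is one unit below the puncture. Apart from the centre, a segment from it
  meets the central line only if its other end lies on that line, and then both ends are below the
  puncture.\<close>

lemma starlike_B: "starlike (B i)"
  unfolding starlike_def
proof (intro bexI[of _ "Complex (x i) (- 1)"] ballI subsetI)
  fix z w assume z: "z \<in> B i" and "w \<in> closed_segment (Complex (x i) (- 1)) z"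
  then obtain s where s: "0 \<le> s" "s \<le> 1" "w = (1 - s) *\<^sub>R Complex (x i) (- 1) + s *\<^sub>R z"
    by (auto simp: closed_segment_def)
  have re: "Re w - x i = s * (Re z - x i)" and im: "Im w = s * (Im z + 1) - 1"
    by (auto simp: s(3) algebra_simps)
  have "\<bar>Re w - x i\<bar> = s * \<bar>Re z - x i\<bar>"
    using s(1) by (simp add: re abs_mult)
  also have "\<dots> \<le> \<bar>Re z - x i\<bar>"
    using s mult_right_mono[of s 1 "\<bar>Re z - x i\<bar>"] by simp
  finally have "\<bar>Re w - x i\<bar> < e" using z by (simp add: B_def)
  moreover have "Im w < 0" if "Re w = x i"
  proof (cases "s = 0")
    case False
    hence "Re z = x i" using re that by simp
    hence "s * Im z < 0" using z s False by (auto simp: B_def mult_pos_neg)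
    thus ?thesis using s by (simp add: im algebra_simps)
  qed (simp add: im)
  ultimately show "w \<in> B i" by (simp add: B_def)
qed (use e in \<open>auto simp: B_def\<close>)

lemma simply_connected_B: "simply_connected (B i)"
  by (rule starlike_imp_simply_connected[OF starlike_B])

sublocale pointed_subset S b
  by unfold_locales (use b_in_A A_subset in auto)

section \<open>Reference paths, and generation by loops around the punctures\<close>

lemma A_unique: "pth A p u v \<Longrightarrow> pth A q u v \<Longrightarrow> homotopic_paths S p q"
  by (rule simply_connected_unique_path[OF simply_connected_A A_subset])

lemma B_unique: "i \<in> I \<Longrightarrow> pth (B i) p u v \<Longrightarrow> pth (B i) q u v \<Longrightarrow> homotopic_paths S p q"
  by (rule simply_connected_unique_path[OF simply_connected_B B_subset])

lemma L_subset: "i \<in> I \<Longrightarrow> L i \<subseteq> A \<inter> B i" and R_subset: "i \<in> I \<Longrightarrow> R i \<subseteq> A \<inter> B i"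
  using halves by auto

text \<open>The reference paths to points of a strip; the preference for the left half breaks the
  symmetry between the two components of \<open>A \<inter> B i\<close>. Like the staying paths, they
  are closed under homotopy in \<open>S\<close>.\<close>

definition entering :: "'i \<Rightarrow> (real \<Rightarrow> complex) \<Rightarrow> complex \<Rightarrow> bool" where
  "entering i p z \<longleftrightarrow> (\<exists>\<alpha> \<beta> y. y \<in> L i \<and> pth A \<alpha> b y \<and> pth (B i) \<beta> y z \<and> homotopic_paths S (\<alpha> +++ \<beta>) p)"

definition staying :: "(real \<Rightarrow> complex) \<Rightarrow> complex \<Rightarrow> bool" where
  "staying p z \<longleftrightarrow> (\<exists>\<alpha>. pth A \<alpha> b z \<and> homotopic_paths S \<alpha> p)"

definition good :: "(real \<Rightarrow> complex) \<Rightarrow> complex \<Rightarrow> bool" where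
  "good p z \<longleftrightarrow> staying p z \<or> (\<exists>i\<in>I. entering i p z)"

lemma staying_pth: "staying p z \<Longrightarrow> pth S p b z"
  unfolding staying_def using A_subset by (meson pth_homotopic pth_mono)

lemma entering_pth: "i \<in> I \<Longrightarrow> entering i p z \<Longrightarrow> pth S p b z"
  unfolding entering_def using A_subset B_subset[of i] by (meson pth_homotopic pth_join pth_mono)

lemma good_pth: "good p z \<Longrightarrow> pth S p b z"
  unfolding good_def using staying_pth entering_pth by blast

lemma entering_in_B: "entering i p z \<Longrightarrow> z \<in> B i"
  unfolding entering_def pth_def using pathfinish_in_path_image by blast

lemma staying_in_A: "staying p z \<Longrightarrow> z \<in> A"
  unfolding staying_def pth_def using pathfinish_in_path_image by blast

lemma staying_exists: "z \<in> A \<Longrightarrow> \<exists>p. staying p z"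
proof -
  assume "z \<in> A"
  then obtain p where "pth A p b z"
    using path_connected_pth[OF simply_connected_imp_path_connected[OF simply_connected_A] b_in_A] by blast
  moreover from this have "homotopic_paths S p p"
    using A_subset pth_def by (metis homotopic_paths_refl subset_trans)
  ultimately show ?thesis unfolding staying_def by blast
qed

lemma entering_exists:
  assumes i: "i \<in> I" and z: "z \<in> B i"
  shows "\<exists>p. entering i p z"
proof -
  let ?y = "of_real (x i - e / 2)"
  have y: "?y \<in> L i" using e by (auto simp: L_def)
  obtain \<alpha> where a: "pth A \<alpha> b ?y"
    using path_connected_pth[OF simply_connected_imp_path_connected[OF simply_connected_A] b_in_A, of ?y]
      L_subset[OF i] y by blast
  obtain \<beta> where be: "pth (B i) \<beta> ?y z"
    using path_connected_pth[OF simply_connected_imp_path_connected[OF simply_connected_B], of ?y i z]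
      L_subset[OF i] y z by blast
  have "pth S (\<alpha> +++ \<beta>) b z"
    using a be A_subset B_subset[OF i] by (meson pth_join pth_mono)
  thus ?thesis unfolding entering_def using y a be pth_refl by blast
qed

lemma staying_unique: "staying p z \<Longrightarrow> staying q z \<Longrightarrow> homotopic_paths S p q"
  unfolding staying_def by (meson A_unique homotopic_paths_sym homotopic_paths_trans)

text \<open>The left half is convex, so the two entry points are joined by a segment that lies in
  \<open>A\<close> and in \<open>B i\<close>. It can be attached to the part of the path in the
  strip or to the part in \<open>A\<close>.\<close>

lemma entering_unique:
  assumes i: "i \<in> I" and p: "entering i p z" and q: "entering i q z"
  shows "homotopic_paths S p q"
proof -
  obtain \<alpha> \<beta> y where p: "y \<in> L i" "pth A \<alpha> b y" "pth (B i) \<beta> y z" "homotopic_paths S (\<alpha> +++ \<beta>) p"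
    using p unfolding entering_def by blast
  obtain \<alpha>' \<beta>' y' where q: "y' \<in> L i" "pth A \<alpha>' b y'" "pth (B i) \<beta>' y' z" "homotopic_paths S (\<alpha>' +++ \<beta>') q"
    using q unfolding entering_def by blast
  let ?l = "linepath y y'"
  have "closed_segment y y' \<subseteq> L i"
    using closed_segment_subset[OF p(1) q(1) convex_L] .
  hence l: "pth A ?l y y'" "pth (B i) ?l y y'" "pth S ?l y y'"
    using L_subset[OF i] A_subset by (auto intro!: pth_linepath)
  note S = pth_mono[OF p(2) A_subset] pth_mono[OF p(3) B_subset[OF i]]
    pth_mono[OF q(2) A_subset] pth_mono[OF q(3) B_subset[OF i]]
  have "homotopic_paths S (\<alpha> +++ \<beta>) (\<alpha> +++ (?l +++ \<beta>'))"
    using S(1) S(2) pth_refl[OF S(1)] B_unique[OF i p(3) pth_join[OF l(2) q(3)]] by (rule pth_join_cong)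
  also have "homotopic_paths S \<dots> ((\<alpha> +++ ?l) +++ \<beta>')"
    using S(1) l(3) S(4) by (rule pth_assoc)
  also have "homotopic_paths S \<dots> (\<alpha>' +++ \<beta>')"
    using pth_join[OF S(1) l(3)] S(4) A_unique[OF pth_join[OF p(2) l(1)] q(2)] pth_refl[OF S(4)]
    by (rule pth_join_cong)
  finally show ?thesis
    using p(4) q(4) by (meson homotopic_paths_sym homotopic_paths_trans)
qed

text \<open>A point of the left half can serve as its own entry point, so a staying path to it is
  also an entering path.\<close>

lemma entering_staying_left:
  assumes i: "i \<in> I" and z: "z \<in> L i" and p: "entering i p z" and q: "staying q z"
  shows "homotopic_paths S p q"
proof -
  obtain \<alpha> where a: "pth A \<alpha> b z" "homotopic_paths S \<alpha> q"
    using q unfolding staying_def by blast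
  have l: "pth (B i) (linepath z z) z z"
    using L_subset[OF i] z by (auto intro!: pth_linepath)
  note aS = pth_mono[OF a(1) A_subset]
  have *: "homotopic_paths S (\<alpha> +++ linepath z z) \<alpha>"
    using homotopic_paths_rid'[of \<alpha> S z] aS by (simp add: pth_def)
  hence "entering i q z"
    unfolding entering_def using z a l homotopic_paths_trans by blast
  thus ?thesis using entering_unique[OF i p] by blast
qed

lemma entering_extend:
  assumes i: "i \<in> I" and p: "entering i p z" and s: "pth (B i) s z w"
  shows "entering i (p +++ s) w"
proof -
  obtain \<alpha> \<beta> y where a: "y \<in> L i" "pth A \<alpha> b y" "pth (B i) \<beta> y z" "homotopic_paths S (\<alpha> +++ \<beta>) p"
    using p unfolding entering_def by blast
  note S = pth_mono[OF a(2) A_subset] pth_mono[OF a(3) B_subset[OF i]] pth_mono[OF s B_subset[OF i]]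
  have "homotopic_paths S (\<alpha> +++ (\<beta> +++ s)) ((\<alpha> +++ \<beta>) +++ s)"
    using S by (rule pth_assoc)
  also have "homotopic_paths S \<dots> (p +++ s)"
    using pth_join[OF S(1,2)] S(3) a(4) pth_refl[OF S(3)] by (rule pth_join_cong)
  finally show ?thesis
    unfolding entering_def using a pth_join[OF a(3) s] by blast
qed

lemma staying_extend:
  assumes p: "staying p z" and s: "pth A s z w"
  shows "staying (p +++ s) w"
proof -
  obtain \<alpha> where a: "pth A \<alpha> b z" "homotopic_paths S \<alpha> p"
    using p unfolding staying_def by blast
  have "homotopic_paths S (\<alpha> +++ s) (p +++ s)"
    using pth_mono[OF a(1) A_subset] pth_mono[OF s A_subset] a(2) pth_refl[OF pth_mono[OF s A_subset]]
    by (rule pth_join_cong)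
  thus ?thesis unfolding staying_def using pth_join[OF a(1) s] by blast
qed

text \<open>The loop goes from left to right through the strip, below the puncture, and returns
  through \<open>A\<close>: one counterclockwise turn. The turning point \<open>v\<close> and the
  loop up to homotopy are left open, so that a concrete loop can be recognized easily.\<close>

definition encircling :: "'i \<Rightarrow> (real \<Rightarrow> complex) \<Rightarrow> bool" where
  "encircling i c \<longleftrightarrow> (\<exists>p q v. v \<in> R i \<and> entering i p v \<and> staying q v \<and> homotopic_paths S (p +++ reversepath q) c)"

text \<open>The right half is convex, so by \<open>diff_extend\<close> the comparison at the turning
  point of \<open>c\<close> carries over to every point of \<open>R i\<close> along a
  segment.\<close>

lemma encircling_diff:
  assumes i: "i \<in> I" and c: "encircling i c" and z: "z \<in> R i" and p: "entering i p z" and q: "staying q z"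
  shows "diff p q = cls c"
proof -
  obtain p' q' v where v: "v \<in> R i" "entering i p' v" "staying q' v"
    "homotopic_paths S (p' +++ reversepath q') c"
    using c unfolding encircling_def by blast
  let ?l = "linepath v z"
  have "closed_segment v z \<subseteq> R i"
    using closed_segment_subset[OF v(1) z convex_R] .
  hence l: "pth A ?l v z" "pth (B i) ?l v z" "pth S ?l v z"
    using R_subset[OF i] A_subset by (auto intro!: pth_linepath)
  note P = entering_pth[OF i v(2)] staying_pth[OF v(3)]
  have "cls c = diff p' q'"
    using v(4) cls_eq_iff[OF pth_diff[OF P], of c] by (simp add: diff_def)
  also have "\<dots> = diff (p' +++ ?l) (q' +++ ?l)"
    by (rule diff_extend[symmetric, OF P l(3)])
  also have "\<dots> = diff p q"
    using pth_join[OF P(1) l(3)] pth_join[OF P(2) l(3)]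
      entering_unique[OF i entering_extend[OF i v(2) l(2)] p]
      staying_unique[OF staying_extend[OF v(3) l(1)] q] by (rule diff_cong)
  finally show ?thesis ..
qed

lemma encircling_pth: "i \<in> I \<Longrightarrow> encircling i c \<Longrightarrow> pth S c b b"
  unfolding encircling_def using entering_pth staying_pth by (meson pth_diff pth_homotopic)

context
  fixes c :: "'i \<Rightarrow> real \<Rightarrow> complex"
  assumes c: "\<And>i. i \<in> I \<Longrightarrow> encircling i (c i)"
begin

definition "H = word_value \<G> (\<lambda>i. cls (c i)) ` reduced_words I"

lemma subgroup_H: "subgroup H \<G>"
  unfolding H_def using c by (intro subgroup_word_values) (auto intro!: cls_closed encircling_pth)

text \<open>Reference paths of the same kind are homotopic, and paths of different kinds differ only
  over the right half of a strip, where they differ by its generator. Different strips do not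
  interfere, being disjoint.\<close>

lemma gauge_change:
  assumes "good p z" "good q z"
  shows "diff p q \<in> H"
proof -
  have one: "diff p q \<in> H" if "pth S p b z" "homotopic_paths S p q" for p q
    using diff_homotopic[OF that] subgroup.one_closed[OF subgroup_H] by simp
  have mixed: "diff p q \<in> H" if i: "i \<in> I" and p: "entering i p z" and q: "staying q z" for i p q
  proof -
    have "z \<in> A" "z \<in> B i"
      using p q entering_in_B staying_in_A by blast+
    then consider "z \<in> L i" | "z \<in> R i" using halves[OF i] by blast
    thus ?thesis
    proof cases
      case 1
      thus ?thesis using one[OF entering_pth[OF i p]] entering_staying_left[OF i _ p q] by blast
    next
      case 2
      have "cls (c i) \<in> H"
        unfolding H_def using i
        by (intro generators_in_word_values) (auto intro!: cls_closed encircling_pth[OF _ c])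
      thus ?thesis using encircling_diff[OF i c[OF i] 2 p q] by simp
    qed
  qed
  show ?thesis
    using assms unfolding good_def
  proof (elim disjE bexE)
    assume "staying p z" "staying q z"
    thus ?thesis using one staying_unique staying_pth by blast
  next
    fix i assume "staying p z" "i \<in> I" "entering i q z"
    thus ?thesis
      using mixed[of i q p] diff_inv[of q z p] subgroup.m_inv_closed[OF subgroup_H]
        entering_pth staying_pth by metis
  next
    fix i assume "i \<in> I" "entering i p z" "staying q z"
    thus ?thesis using mixed by blast
  next
    fix i j assume ij: "i \<in> I" "entering i p z" "j \<in> I" "entering j q z"
    hence "z \<in> B i" "z \<in> B j"
      using entering_in_B by blast+
    hence "i = j" using ij strip_disjoint[of i j z] by (auto simp: B_def)
    thus ?thesis using ij one entering_unique entering_pth by blast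
  qed
qed

lemma good_exists: "z \<in> S \<Longrightarrow> \<exists>p. good p z"
  using S_cover staying_exists entering_exists unfolding good_def by blast

text \<open>A loop is cut into pieces that lie in \<open>A\<close> or in one strip, and is compared
  with reference paths at the division points. The differences telescope, and each piece contributes
  only changes of reference paths.\<close>

lemma generated:
  assumes g: "pth S g b b"
  shows "cls g \<in> H"
proof -
  \<comment> \<open>Quantification over all reference paths at both ends makes the property additive
    in the interval, as the Bolzano principle requires.\<close>
  let ?P = "\<lambda>u v. 0 \<le> u \<and> v \<le> 1 \<longrightarrow> (\<forall>p q. good p (g u) \<longrightarrow> good q (g v) \<longrightarrow> diff (p +++ subpath u v g) q \<in> H)"
  have gS: "path g" "path_image g \<subseteq> S" using g by (auto simp: pth_def)
  have sub: "pth S (subpath u v g) (g u) (g v)" if "0 \<le> u" "u \<le> v" "v \<le> 1" for u v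
  proof -
    have "path_image (subpath u v g) \<subseteq> path_image g"
      using that by (intro path_image_subpath_subset) auto
    thus ?thesis
      using that gS path_subpath[OF gS(1), of u v] by (simp add: pth_def pathstart_subpath pathfinish_subpath)
  qed
  have gt: "g t \<in> S" if "0 \<le> t" "t \<le> 1" for t
    using that gS(2) by (auto simp: path_image_def)
  have "?P 0 1"
  proof (rule Bolzano[of 0 1 ?P])
    fix u v w :: real assume uv: "?P u v" "?P v w" "u \<le> v" "v \<le> w"
    show "?P u w"
    proof (intro impI allI)
      fix p q assume uw: "0 \<le> u \<and> w \<le> 1" and p: "good p (g u)" and q: "good q (g w)"
      obtain r where r: "good r (g v)" using good_exists gt uv uw by (metis order_trans)
      have s: "pth S (subpath u v g) (g u) (g v)" "pth S (subpath v w g) (g v) (g w)"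
        "pth S (subpath u w g) (g u) (g w)"
        using sub uv uw by auto
      note P = good_pth[OF p] good_pth[OF q] good_pth[OF r]
      have h: "homotopic_paths S ((p +++ subpath u v g) +++ subpath v w g) (p +++ subpath u w g)"
      proof -
        have "homotopic_paths S ((p +++ subpath u v g) +++ subpath v w g) (p +++ (subpath u v g +++ subpath v w g))"
          using pth_assoc[OF P(1) s(1,2)] homotopic_paths_sym by blast
        also have "homotopic_paths S \<dots> (p +++ subpath u w g)"
          using P(1) pth_join[OF s(1,2)] pth_refl[OF P(1)] homotopic_join_subpaths[OF gS, of u v w] uv uw
          by (intro pth_join_cong) auto
        finally show ?thesis .
      qed
      have "diff (p +++ subpath u v g) r \<in> H" "diff (r +++ subpath v w g) q \<in> H"
        using uv uw p q r by auto
      hence "diff (p +++ subpath u v g) r \<otimes>\<^bsub>\<G>\<^esub> diff (r +++ subpath v w g) q \<in> H"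
        using subgroup.m_closed[OF subgroup_H] by blast
      also have "diff (p +++ subpath u v g) r = diff ((p +++ subpath u v g) +++ subpath v w g) (r +++ subpath v w g)"
        by (rule diff_extend[symmetric, OF pth_join[OF P(1) s(1)] P(3) s(2)])
      also have "\<dots> = diff (p +++ subpath u w g) (r +++ subpath v w g)"
        using pth_join[OF pth_join[OF P(1) s(1)] s(2)] pth_join[OF P(3) s(2)] h
          pth_refl[OF pth_join[OF P(3) s(2)]] by (rule diff_cong)
      also have "\<dots> \<otimes>\<^bsub>\<G>\<^esub> diff (r +++ subpath v w g) q = diff (p +++ subpath u w g) q"
        by (rule diff_mult[OF pth_join[OF P(1) s(3)] pth_join[OF P(3) s(2)] P(2)])
      finally show "diff (p +++ subpath u w g) q \<in> H" .
    qed
  next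
    fix t :: real assume t: "0 \<le> t" "t \<le> 1"
    \<comment> \<open>If every path in \<open>U\<close> prolongs some reference path to a reference
      path, then over a short interval only the changes of reference paths at the two ends
      contribute.\<close>
    have local: "\<exists>d>0. \<forall>u v. u \<le> t \<and> t \<le> v \<and> v - u < d \<longrightarrow> ?P u v"
      if U: "open U" "g t \<in> U"
        and ext: "\<And>z w s. pth U s z w \<Longrightarrow> \<exists>p. good p z \<and> good (p +++ s) w" for U
    proof -
      have "continuous_on {0..1} g" using gS(1) by (simp add: path_def)
      from this[unfolded continuous_on_open_invariant, rule_format, OF U(1)]
      obtain W where W: "open W" "W \<inter> {0..1} = g -` U \<inter> {0..1}" by blast
      have "t \<in> W" using W(2) U(2) t by auto
      then obtain d where d: "d > 0" "\<And>s. dist s t < d \<Longrightarrow> s \<in> W"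
        using W(1) unfolding open_dist by blast
      have "?P u v" if uv: "u \<le> t \<and> t \<le> v \<and> v - u < d" for u v
      proof (intro impI allI)
        fix p q assume uv': "0 \<le> u \<and> v \<le> 1" and p: "good p (g u)" and q: "good q (g v)"
        have s: "pth S (subpath u v g) (g u) (g v)"
          using sub uv uv' by auto
        have "g s \<in> U" if "s \<in> {u..v}" for s
        proof -
          have "s \<in> W" using d(2)[of s] that uv by (auto simp: dist_real_def)
          thus ?thesis using W(2) that uv' by auto
        qed
        hence "pth U (subpath u v g) (g u) (g v)"
          using s uv by (auto simp: pth_def path_image_subpath)
        then obtain r where r: "good r (g u)" "good (r +++ subpath u v g) (g v)"
          using ext by blast
        have "diff p r \<in> H" by (rule gauge_change[OF p r(1)])
        moreover have "diff (r +++ subpath u v g) q \<in> H" by (rule gauge_change[OF r(2) q])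
        ultimately have "diff p r \<otimes>\<^bsub>\<G>\<^esub> diff (r +++ subpath u v g) q \<in> H"
          using subgroup.m_closed[OF subgroup_H] by blast
        also have "diff p r = diff (p +++ subpath u v g) (r +++ subpath u v g)"
          by (rule diff_extend[symmetric, OF good_pth[OF p] good_pth[OF r(1)] s])
        also have "\<dots> \<otimes>\<^bsub>\<G>\<^esub> diff (r +++ subpath u v g) q = diff (p +++ subpath u v g) q"
          by (rule diff_mult[OF pth_join[OF good_pth[OF p] s] good_pth[OF r(2)] good_pth[OF q]])
        finally show "diff (p +++ subpath u v g) q \<in> H" .
      qed
      thus ?thesis using d(1) by blast
    qed
    consider "g t \<in> A" | i where "i \<in> I" "g t \<in> B i" using gt[OF t] S_cover by blast
    thus "\<exists>d>0. \<forall>u v. u \<le> t \<and> t \<le> v \<and> v - u < d \<longrightarrow> ?P u v"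
    proof cases
      case 1
      show ?thesis
      proof (rule local[OF open_A 1])
        fix z w s assume s: "pth A s z w"
        hence "z \<in> A" using pathstart_in_path_image[of s] by (auto simp: pth_def)
        thus "\<exists>p. good p z \<and> good (p +++ s) w"
          using staying_exists staying_extend[OF _ s] unfolding good_def by blast
      qed
    next
      case 2
      show ?thesis
      proof (rule local[OF open_B 2(2)])
        fix z w s assume s: "pth (B i) s z w"
        hence "z \<in> B i" using pathstart_in_path_image[of s] by (auto simp: pth_def)
        thus "\<exists>p. good p z \<and> good (p +++ s) w"
          using entering_exists entering_extend[OF _ _ s] 2(1) unfolding good_def by blast
      qed
    qed
  qed simp
  moreover have "good (linepath b b) b"
    unfolding good_def staying_def using b_in_A pth_const
    by (intro disjI1 exI[of _ "linepath b b"]) (auto simp: pth_def)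
  moreover have "g 0 = b" "g 1 = b" using g by (auto simp: pth_def pathstart_def pathfinish_def)
  ultimately have "diff (linepath b b +++ g) (linepath b b) \<in> H" by simp
  also have "diff (linepath b b +++ g) (linepath b b) = cls g"
  proof -
    have 1: "homotopic_paths S (linepath b b +++ g) g"
      using g by (intro homotopic_paths_lid') (auto simp: pth_def)
    have "homotopic_paths S ((linepath b b +++ g) +++ linepath b b) (g +++ linepath b b)"
      using pth_join[OF pth_const g] pth_const 1 pth_refl[OF pth_const] by (rule pth_join_cong)
    also have "homotopic_paths S \<dots> g"
      using g by (intro homotopic_paths_rid') (auto simp: pth_def)
    finally show ?thesis
      using cls_eq_iff[OF pth_join[OF pth_join[OF pth_const g] pth_const]] by (simp add: diff_def)
  qed
  finally show ?thesis .
qed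

end

end

context punctured_plane
begin

subsection \<open>The covering space with the reduced words as sheets\<close>

text \<open>
  Crossing the half-line below a puncture from left to right acts on the sheets. On the
  half-line itself a point carries the label of the sheet on its left.
\<close>
definition sheet :: "'i \<Rightarrow> ('i \<times> bool) list \<Rightarrow> complex \<Rightarrow> complex \<times> ('i \<times> bool) list" where
  "sheet i g z = (z, if Re z > x i then act (i, True) g else g)"

text \<open>The final topology for the charts \<open>\<lambda>z. (z, g)\<close> on \<open>A\<close>
  and \<open>sheet i g\<close> on \<open>B i\<close>. Copies of \<open>A\<close> are glued along the
  strips as the Cayley tree of the free group prescribes.\<close>

definition cover :: "(complex \<times> ('i \<times> bool) list) topology" where
  "cover = topology (\<lambda>W. W \<subseteq> S \<times> reduced_words I \<and>
     (\<forall>g\<in>reduced_words I. open {z \<in> A. (z, g) \<in> W}) \<and>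
     (\<forall>i\<in>I. \<forall>g\<in>reduced_words I. open {z \<in> B i. sheet i g z \<in> W}))"

lemma openin_cover:
  "openin cover W \<longleftrightarrow> W \<subseteq> S \<times> reduced_words I \<and>
     (\<forall>g\<in>reduced_words I. open {z \<in> A. (z, g) \<in> W}) \<and>
     (\<forall>i\<in>I. \<forall>g\<in>reduced_words I. open {z \<in> B i. sheet i g z \<in> W})"
proof -
  have int: "{z \<in> U. f z \<in> V \<inter> W} = {z \<in> U. f z \<in> V} \<inter> {z \<in> U. f z \<in> W}"
    and un: "{z \<in> U. f z \<in> \<Union>\<K>} = (\<Union>V\<in>\<K>. {z \<in> U. f z \<in> V})"
    for f :: "complex \<Rightarrow> complex \<times> ('i \<times> bool) list" and U V W \<K> by auto
  have "istopology (\<lambda>W. W \<subseteq> S \<times> reduced_words I \<and>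
     (\<forall>g\<in>reduced_words I. open {z \<in> A. (z, g) \<in> W}) \<and>
     (\<forall>i\<in>I. \<forall>g\<in>reduced_words I. open {z \<in> B i. sheet i g z \<in> W}))"
    unfolding istopology_def int un by (blast intro: open_Int open_UN)
  thus ?thesis by (simp add: cover_def topology_inverse')
qed

lemma act_eq_iff:
  assumes "g \<in> reduced_words I" "h \<in> reduced_words I"
  shows "act l g = act l h \<longleftrightarrow> g = h"
proof -
  obtain i d where l: "l = (i, d)" by (cases l)
  show ?thesis
    using act_inverse[OF assms(1), of i d] act_inverse[OF assms(2), of i d] unfolding l by metis
qed

lemma sheet_in: "i \<in> I \<Longrightarrow> g \<in> reduced_words I \<Longrightarrow> z \<in> S \<Longrightarrow> sheet i g z \<in> S \<times> reduced_words I"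
  by (auto simp: sheet_def act_reduced)

lemma topspace_cover: "topspace cover = S \<times> reduced_words I"
proof
  show "topspace cover \<subseteq> S \<times> reduced_words I"
    using openin_topspace[of cover] unfolding openin_cover by blast
  have "{z \<in> A. (z, g) \<in> S \<times> reduced_words I} = A" if "g \<in> reduced_words I" for g
    using that A_subset by auto
  moreover have "{z \<in> B i. sheet i g z \<in> S \<times> reduced_words I} = B i" if "i \<in> I" "g \<in> reduced_words I" for i g
    using sheet_in[OF that] B_subset[OF that(1)] by auto
  ultimately have "openin cover (S \<times> reduced_words I)"
    unfolding openin_cover using open_A open_B by auto
  thus "S \<times> reduced_words I \<subseteq> topspace cover" by (rule openin_subset)
qed

lemma continuous_chart_A:
  assumes g: "g \<in> reduced_words I"
  shows "continuous_map (top_of_set A) cover (\<lambda>z. (z, g))"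
  unfolding continuous_map_def topspace_cover
proof (intro conjI allI impI)
  fix W assume "openin cover W"
  hence "open {z \<in> A. (z, g) \<in> W}" using g unfolding openin_cover by blast
  thus "openin (top_of_set A) {z \<in> topspace (top_of_set A). (z, g) \<in> W}"
    by (intro open_subset) auto
qed (use g A_subset in auto)

lemma continuous_chart_B:
  assumes i: "i \<in> I" and g: "g \<in> reduced_words I"
  shows "continuous_map (top_of_set (B i)) cover (sheet i g)"
  unfolding continuous_map_def topspace_cover
proof (intro conjI allI impI)
  fix W assume "openin cover W"
  hence "open {z \<in> B i. sheet i g z \<in> W}" using i g unfolding openin_cover by blast
  thus "openin (top_of_set (B i)) {z \<in> topspace (top_of_set (B i)). sheet i g z \<in> W}"
    by (intro open_subset) auto
qed (use sheet_in[OF i g] B_subset[OF i] in auto)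

text \<open>A chart over \<open>A\<close> meets a chart over a strip in a union of halves of that
  strip, and these are open.\<close>

lemma open_chart_A:
  assumes g: "g \<in> reduced_words I"
  shows "openin cover ((\<lambda>z. (z, g)) ` A)"
  unfolding openin_cover
proof (intro conjI ballI)
  fix h
  have "{z \<in> A. (z, h) \<in> (\<lambda>z. (z, g)) ` A} = (if h = g then A else {})" by auto
  thus "open {z \<in> A. (z, h) \<in> (\<lambda>z. (z, g)) ` A}" using open_A by simp
  fix i assume i: "i \<in> I"
  have "{z \<in> B i. sheet i h z \<in> (\<lambda>z. (z, g)) ` A} = {z \<in> A \<inter> B i. snd (sheet i h z) = g}"
    by (auto simp: sheet_def)
  also have "\<dots> = (if h = g then L i else {}) \<union> (if act (i, True) h = g then R i else {})"
    unfolding halves[OF i] by (auto simp: sheet_def L_def R_def)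
  finally show "open {z \<in> B i. sheet i h z \<in> (\<lambda>z. (z, g)) ` A}"
    using open_L open_R by auto
qed (use g A_subset in auto)

lemma open_chart_B:
  assumes i: "i \<in> I" and g: "g \<in> reduced_words I"
  shows "openin cover (sheet i g ` B i)"
  unfolding openin_cover
proof (intro conjI ballI)
  fix h
  have "{z \<in> A. (z, h) \<in> sheet i g ` B i} = {z \<in> A \<inter> B i. snd (sheet i g z) = h}"
    by (auto simp: sheet_def)
  also have "\<dots> = (if h = g then L i else {}) \<union> (if act (i, True) g = h then R i else {})"
    unfolding halves[OF i] by (auto simp: sheet_def L_def R_def)
  finally show "open {z \<in> A. (z, h) \<in> sheet i g ` B i}"
    using open_L open_R by auto
  fix j assume j: "j \<in> I" and h: "h \<in> reduced_words I"
  have "{z \<in> B j. sheet j h z \<in> sheet i g ` B i} = (if i = j \<and> g = h then B i else {})"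
  proof (cases "i = j")
    case True
    have "sheet i g z = sheet i h z \<longleftrightarrow> g = h" for z
      using act_eq_iff[OF g h] by (auto simp: sheet_def)
    moreover have "sheet i h z \<in> sheet i g ` B i \<longleftrightarrow> sheet i g z = sheet i h z" if "z \<in> B i" for z
      using that by (auto simp: sheet_def)
    ultimately show ?thesis using True by auto
  next
    case False
    have "z \<notin> B i" if "z \<in> B j" for z
      using that False strip_disjoint[OF i j] by (auto simp: B_def)
    hence "sheet j h z \<notin> sheet i g ` B i" if "z \<in> B j" for z
      using that by (auto simp: sheet_def)
    thus ?thesis using False by auto
  qed
  thus "open {z \<in> B j. sheet j h z \<in> sheet i g ` B i}" using open_B by simp
next
  show "sheet i g ` B i \<subseteq> S \<times> reduced_words I"
    using sheet_in[OF i g] B_subset[OF i] by (intro image_subsetI) blast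
qed

lemma covering_cover: "covering_of cover (top_of_set S) fst"
  unfolding covering_of_def
proof (intro conjI ballI)
  show "continuous_map cover (top_of_set S) fst"
    unfolding continuous_map_def topspace_cover
  proof (intro conjI allI impI)
    fix U assume "openin (top_of_set S) U"
    then obtain T where T: "open T" "U = S \<inter> T" by (auto simp: openin_open)
    have "{z \<in> A. (z, g) \<in> {e \<in> S \<times> reduced_words I. fst e \<in> U}} = A \<inter> T"
      if "g \<in> reduced_words I" for g
      using that T A_subset by auto
    moreover have "{z \<in> B i. sheet i g z \<in> {e \<in> S \<times> reduced_words I. fst e \<in> U}} = B i \<inter> T"
      if "g \<in> reduced_words I" "i \<in> I" for i g
    proof -
      have "sheet i g z \<in> {e \<in> S \<times> reduced_words I. fst e \<in> U} \<longleftrightarrow> z \<in> T" if "z \<in> B i" for z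
        using sheet_in[OF \<open>i \<in> I\<close> \<open>g \<in> reduced_words I\<close>, of z] T B_subset[OF \<open>i \<in> I\<close>] that
        by (auto simp: sheet_def)
      thus ?thesis unfolding Int_def by (intro Collect_cong conj_cong refl)
    qed
    ultimately show "openin cover {e \<in> S \<times> reduced_words I. fst e \<in> U}"
      unfolding openin_cover using open_A open_B T(1) by auto
  qed auto
next
  fix z assume "z \<in> topspace (top_of_set S)"
  then consider "z \<in> A" | i where "i \<in> I" "z \<in> B i" using S_cover by auto
  thus "\<exists>U \<Sigma>. z \<in> U \<and> even_cover cover (top_of_set S) fst U \<Sigma>"
  proof cases
    case 1
    have "even_cover cover (top_of_set S) fst A ((\<lambda>g z. (z, g)) ` reduced_words I)"
      unfolding even_cover_def
      using continuous_chart_A open_chart_A open_A A_subset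
      by (auto simp: topspace_cover subtopology_subtopology Int_absorb1 intro: open_subset)
    thus ?thesis using 1 by blast
  next
    case 2
    \<comment> \<open>To the right of the puncture \<open>sheet i h\<close> carries the label
      \<open>act (i, True) h\<close>, so \<open>h\<close> is found there by letting the inverse
      letter act on \<open>g\<close>.\<close>
    have "\<exists>h\<in>reduced_words I. sheet i h w = (w, g)" if "g \<in> reduced_words I" for g w
    proof (cases "Re w > x i")
      case True
      thus ?thesis
        using act_reduced[OF that, of "(i, False)"] act_inverse[OF that, of i False] 2(1)
        by (intro bexI[of _ "act (i, False) g"]) (auto simp: sheet_def)
    next
      case False
      thus ?thesis using that by (intro bexI[of _ g]) (auto simp: sheet_def)
    qed
    note surj = this
    have "even_cover cover (top_of_set S) fst (B i) (sheet i ` reduced_words I)"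
      unfolding even_cover_def
    proof (intro conjI ballI impI)
      show "openin (top_of_set S) (B i)"
        using open_B B_subset[OF 2(1)] by (rule open_subset[rotated])
      fix \<sigma> assume "\<sigma> \<in> sheet i ` reduced_words I"
      then obtain g where g: "g \<in> reduced_words I" "\<sigma> = sheet i g" by blast
      show "continuous_map (subtopology (top_of_set S) (B i)) cover \<sigma>"
        using continuous_chart_B[OF 2(1) g(1)] B_subset[OF 2(1)]
        by (simp add: g(2) subtopology_subtopology Int_absorb1)
      show "openin cover (\<sigma> ` B i)"
        using open_chart_B[OF 2(1) g(1)] by (simp add: g(2))
      show "fst (\<sigma> u) = u" for u by (simp add: g(2) sheet_def)
      fix \<tau> u assume "\<tau> \<in> sheet i ` reduced_words I" and eq: "\<sigma> u = \<tau> u"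
      then obtain h where h: "h \<in> reduced_words I" "\<tau> = sheet i h" by blast
      have "g = h"
        using eq act_eq_iff[OF g(1) h(1)] by (simp add: g(2) h(2) sheet_def split: if_splits)
      thus "\<sigma> = \<tau>" by (simp add: g(2) h(2))
    next
      fix e assume "e \<in> topspace cover"
      then obtain w g where "e = (w, g)" "g \<in> reduced_words I" by (auto simp: topspace_cover)
      thus "\<exists>\<sigma>\<in>sheet i ` reduced_words I. \<sigma> (fst e) = e" using surj[of g w] by simp
    qed
    thus ?thesis using 2 by blast
  qed
qed

text \<open>The monodromy of the covering as a relation between labels, so that it can be read off
  from any explicit lift.\<close>

definition lifts_to :: "(real \<Rightarrow> complex) \<Rightarrow> ('i \<times> bool) list \<Rightarrow> ('i \<times> bool) list \<Rightarrow> bool" where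
  "lifts_to p g h \<longleftrightarrow> (\<exists>Q. pathin cover Q \<and> (\<forall>t\<in>{0..1}. fst (Q t) = p t) \<and>
     Q 0 = (pathstart p, g) \<and> Q 1 = (pathfinish p, h))"

lemma lifts_to_join:
  assumes "lifts_to p g h" "lifts_to q h k" "pathfinish p = pathstart q"
  shows "lifts_to (p +++ q) g k"
proof -
  obtain P Q where P: "pathin cover P" "\<forall>t\<in>{0..1}. fst (P t) = p t" "P 0 = (pathstart p, g)" "P 1 = (pathfinish p, h)"
    and Q: "pathin cover Q" "\<forall>t\<in>{0..1}. fst (Q t) = q t" "Q 0 = (pathstart q, h)" "Q 1 = (pathfinish q, k)"
    using assms unfolding lifts_to_def by blast
  have "pathin cover (loop_join P Q)"
    using P Q assms(3) by (intro pathin_join) auto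
  moreover have "fst (loop_join P Q t) = (p +++ q) t" if "t \<in> {0..1}" for t
    using that P(2) Q(2) by (auto simp: loop_join_def joinpaths_def)
  ultimately show ?thesis
    unfolding lifts_to_def using P Q
    by (intro exI[of _ "loop_join P Q"]) (auto simp: loop_join_def pathstart_join pathfinish_join)
qed

lemma lifts_to_reverse:
  assumes "lifts_to p g h"
  shows "lifts_to (reversepath p) h g"
proof -
  obtain P where P: "pathin cover P" "\<forall>t\<in>{0..1}. fst (P t) = p t" "P 0 = (pathstart p, g)" "P 1 = (pathfinish p, h)"
    using assms unfolding lifts_to_def by blast
  thus ?thesis
    unfolding lifts_to_def using pathin_rev[OF P(1)]
    by (intro exI[of _ "loop_rev P"]) (auto simp: loop_rev_def reversepath_def pathstart_def pathfinish_def)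
qed

lemma lifts_to_in_A:
  assumes p: "pth A p u v" and g: "g \<in> reduced_words I"
  shows "lifts_to p g g"
proof -
  have "continuous_map (top_of_set {0..1}) (top_of_set A) p"
    using p by (auto simp: pth_def path_def path_image_def)
  hence "pathin cover (\<lambda>t. (p t, g))"
    unfolding pathin_def using continuous_map_compose[OF _ continuous_chart_A[OF g], unfolded o_def] by blast
  thus ?thesis
    unfolding lifts_to_def
    by (intro exI[of _ "\<lambda>t. (p t, g)"]) (auto simp: pathstart_def pathfinish_def)
qed

text \<open>The chart over the strip gives the lift. Only the halves containing the ends count,
  however often the path crosses the half-line in between.\<close>

lemma lifts_to_crossing:
  assumes i: "i \<in> I" and p: "pth (B i) p u v" and uv: "u \<in> L i" "v \<in> R i" and g: "g \<in> reduced_words I"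
  shows "lifts_to p g (act (i, True) g)"
proof -
  have "continuous_map (top_of_set {0..1}) (top_of_set (B i)) p"
    using p by (auto simp: pth_def path_def path_image_def)
  hence "pathin cover (\<lambda>t. sheet i g (p t))"
    unfolding pathin_def using continuous_map_compose[OF _ continuous_chart_B[OF i g], unfolded o_def] by blast
  moreover have "p 0 = u" "p 1 = v" using p by (auto simp: pth_def pathstart_def pathfinish_def)
  ultimately show ?thesis
    unfolding lifts_to_def using uv
    by (intro exI[of _ "\<lambda>t. sheet i g (p t)"]) (auto simp: sheet_def pathstart_def pathfinish_def L_def R_def)
qed

lemma lifts_to_unique:
  assumes p: "pth S p b b" and pq: "homotopic_paths S p q" and l: "lifts_to p g h" "lifts_to q g k"
  shows "h = k"
proof -
  obtain P Q where P: "pathin cover P" "\<And>t. t \<in> {0..1} \<Longrightarrow> fst (P t) = p t" "P 0 = (pathstart p, g)" "P 1 = (pathfinish p, h)"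
    and Q: "pathin cover Q" "\<And>t. t \<in> {0..1} \<Longrightarrow> fst (Q t) = q t" "Q 0 = (pathstart q, g)" "Q 1 = (pathfinish q, k)"
    using l unfolding lifts_to_def by blast
  have "P 0 = Q 0" using P(3) Q(3) pq homotopic_paths_imp_pathstart by metis
  moreover have "loop_homotopic (top_of_set S) b p q" using pq by (simp add: loop_homotopic_iff_paths[OF p])
  ultimately obtain f where "f (1::real, 1::real) = Q 1" "f (1, 1) = P 1"
    using lift_loop_homotopy[OF covering_cover _ P(1,2) Q(1,2)] by (metis atLeastAtMost_iff order_refl zero_le_one)
  thus ?thesis using P(4) Q(4) by simp
qed

lemma lifts_to_homotopic:
  assumes p: "pth S p b b" and pq: "homotopic_paths S p q" and l: "lifts_to p g h"
  shows "lifts_to q g h"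
proof -
  have q: "pth S q b b" using pth_homotopic[OF pq p] .
  hence "pathin (top_of_set S) q" "q 0 = b" "q 1 = b" by (auto simp: loop_in_def simp flip: loop_in_iff_pth)
  moreover have "(b, g) \<in> topspace cover"
  proof -
    obtain P where P: "pathin cover P" "P 0 = (pathstart p, g)" using l unfolding lifts_to_def by blast
    hence "P 0 \<in> topspace cover"
      unfolding pathin_def using continuous_map_image_subset_topspace by fastforce
    thus ?thesis using P(2) p by (simp add: pth_def)
  qed
  ultimately obtain Q where Q: "pathin cover Q" "\<And>t. t \<in> {0..1} \<Longrightarrow> fst (Q t) = q t" "Q 0 = (b, g)"
    using path_lift[OF covering_cover, of q "(b, g)"] by auto
  hence "lifts_to q g (snd (Q 1))"
    unfolding lifts_to_def using q Q(2)[of 1]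
    by (intro exI[of _ Q]) (auto simp: pth_def pathstart_def pathfinish_def prod_eq_iff)
  thus ?thesis using lifts_to_unique[OF p pq l] by simp
qed

text \<open>Of the three pieces of the loop, two lie in \<open>A\<close> and keep the label; only
  the passage through the strip changes it.\<close>

lemma lifts_to_encircling:
  assumes i: "i \<in> I" and c: "encircling i c" and g: "g \<in> reduced_words I"
  shows "lifts_to c g (act (i, True) g)"
proof -
  obtain p q v where v: "v \<in> R i" "entering i p v" "staying q v" "homotopic_paths S (p +++ reversepath q) c"
    using c unfolding encircling_def by blast
  obtain \<alpha> \<beta> y where a: "y \<in> L i" "pth A \<alpha> b y" "pth (B i) \<beta> y v" "homotopic_paths S (\<alpha> +++ \<beta>) p"
    using v(2) unfolding entering_def by blast
  obtain \<alpha>' where a': "pth A \<alpha>' b v" "homotopic_paths S \<alpha>' q"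
    using v(3) unfolding staying_def by blast
  have P: "pth S (\<alpha> +++ \<beta>) b v"
    using pth_join[OF pth_mono[OF a(2) A_subset] pth_mono[OF a(3) B_subset[OF i]]] .
  have Q: "pth S (reversepath \<alpha>') v b" using pth_reverse[OF pth_mono[OF a'(1) A_subset]] .
  have "homotopic_paths S ((\<alpha> +++ \<beta>) +++ reversepath \<alpha>') (p +++ reversepath q)"
    using P Q a(4) a'(2) by (intro pth_join_cong) (auto simp: homotopic_paths_reversepath)
  hence h: "homotopic_paths S ((\<alpha> +++ \<beta>) +++ reversepath \<alpha>') c"
    using v(4) by (rule homotopic_paths_trans)
  have "lifts_to (\<alpha> +++ \<beta>) g (act (i, True) g)"
    using lifts_to_join[OF lifts_to_in_A[OF a(2) g] lifts_to_crossing[OF i a(3) a(1) v(1) g]] a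
    by (simp add: pth_def)
  moreover have "lifts_to (reversepath \<alpha>') (act (i, True) g) (act (i, True) g)"
    using lifts_to_in_A[OF pth_reverse[OF a'(1)]] act_reduced[OF g] i by simp
  ultimately have "lifts_to ((\<alpha> +++ \<beta>) +++ reversepath \<alpha>') g (act (i, True) g)"
    by (rule lifts_to_join) (use P Q in \<open>simp add: pth_def\<close>)
  thus ?thesis using lifts_to_homotopic[OF pth_join[OF P Q] h] by blast
qed

lemma cls_inv: "pth S p b b \<Longrightarrow> inv\<^bsub>\<G>\<^esub> cls p = cls (reversepath p)"
proof -
  assume p: "pth S p b b"
  have "homotopic_paths S (reversepath p +++ p) (linepath b b)"
    using homotopic_paths_linv[of p S] p by (simp add: pth_def)
  thus ?thesis
    using p pth_reverse[OF p] by (intro inv_equality)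
      (auto simp: cls_mult cls_one cls_eq_iff cls_closed pth_join)
qed

text \<open>The value of a word is the class of a loop whose lifts let the letters act in order.
  Lifted from the sheet of the empty word, the loop of a reduced word ends in the sheet labelled by
  the reversed word, so the word is determined by its value.\<close>

theorem free_fundamental_group:
  assumes c: "\<And>i. i \<in> I \<Longrightarrow> encircling i (c i)"
  shows "freely_generated_by \<G> (carrier \<G>) I (\<lambda>i. cls (c i))"
proof -
  let ?v = "word_value \<G> (\<lambda>i. cls (c i))"
  have word: "\<exists>p. pth S p b b \<and> ?v w = cls p \<and>
      (\<forall>g\<in>reduced_words I. lifts_to p g (foldl (\<lambda>v l. act l v) g w))" if "fst ` set w \<subseteq> I" for w
    using that
  proof (induction w)
    case Nil
    have "pth A (linepath b b) b b" using b_in_A by (simp add: pth_def)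
    from lifts_to_in_A[OF this] show ?case
      by (intro exI[of _ "linepath b b"] conjI ballI pth_const)
        (simp_all only: word_value_simps cls_one foldl.simps)
  next
    case (Cons l w)
    then obtain p where p: "pth S p b b" "?v w = cls p"
      "\<And>g. g \<in> reduced_words I \<Longrightarrow> lifts_to p g (foldl (\<lambda>v l. act l v) g w)" by auto
    obtain i d where l: "l = (i, d)" by (cases l)
    have i: "i \<in> I" using Cons.prems l by simp
    note ci = encircling_pth[OF i c[OF i]] lifts_to_encircling[OF i c[OF i]]
    have "\<exists>q. pth S q b b \<and> letter \<G> (\<lambda>i. cls (c i)) l = cls q \<and>
        (\<forall>g\<in>reduced_words I. lifts_to q g (act l g))"
    proof (cases d)
      case True
      thus ?thesis using ci l by (intro exI[of _ "c i"]) (auto simp: letter_def)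
    next
      case False
      \<comment> \<open>The generator takes the sheet \<open>act l g\<close> to
        \<open>act (i, True) (act l g)\<close>, which is \<open>g\<close> since \<open>l\<close> is
        the inverse letter. The reversed loop goes from \<open>g\<close> to
        \<open>act l g\<close>.\<close>
      have "lifts_to (reversepath (c i)) g (act l g)" if g: "g \<in> reduced_words I" for g
        using lifts_to_reverse[OF ci(2)[OF act_reduced[OF g, of l]]] act_inverse[OF g, of i False] False l i
        by simp
      thus ?thesis
        using pth_reverse[OF ci(1)] False l cls_inv[OF ci(1)]
        by (intro exI[of _ "reversepath (c i)"]) (auto simp: letter_def)
    qed
    then obtain q where q: "pth S q b b" "letter \<G> (\<lambda>i. cls (c i)) l = cls q"
        "\<And>g. g \<in> reduced_words I \<Longrightarrow> lifts_to q g (act l g)" by auto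
    have "lifts_to (q +++ p) g (foldl (\<lambda>v l. act l v) g (l # w))" if g: "g \<in> reduced_words I" for g
      using lifts_to_join[OF q(3)[OF g] p(3)] act_reduced[OF g, of l] i l p q by (simp add: pth_def)
    moreover have "?v (l # w) = cls (q +++ p)" using p q by (simp add: cls_mult)
    ultimately show ?case using pth_join[OF q(1) p(1)] by blast
  qed
  have "inj_on ?v (reduced_words I)"
  proof (rule inj_onI)
    fix w w' assume w: "w \<in> reduced_words I" "w' \<in> reduced_words I" and eq: "?v w = ?v w'"
    obtain p where p: "pth S p b b" "?v w = cls p" "lifts_to p [] (foldl (\<lambda>v l. act l v) [] w)"
      using word[of w] w by (auto simp: reduced_words_def)
    obtain q where q: "pth S q b b" "?v w' = cls q" "lifts_to q [] (foldl (\<lambda>v l. act l v) [] w')"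
      using word[of w'] w by (auto simp: reduced_words_def)
    have "homotopic_paths S p q" using eq p q by (simp add: cls_eq_iff)
    hence "rev w = rev w'"
      using lifts_to_unique[OF p(1) _ p(3) q(3)] foldl_act_reduced[OF w(1)] foldl_act_reduced[OF w(2)] by simp
    thus "w = w'" by simp
  qed
  moreover have cc: "(\<lambda>i. cls (c i)) ` I \<subseteq> carrier \<G>"
    using encircling_pth[OF _ c] by (auto intro: cls_closed)
  moreover have "?v ` reduced_words I = carrier \<G>"
  proof
    show "?v ` reduced_words I \<subseteq> carrier \<G>"
      using subgroup.subset[OF subgroup_word_values[OF cc]] .
    show "carrier \<G> \<subseteq> ?v ` reduced_words I"
    proof
      fix g assume "g \<in> carrier \<G>"
      then obtain p where p: "g = cls p" "pth S p b b" by (rule carrierE)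
      show "g \<in> ?v ` reduced_words I"
        using generated[of c p] c p(2) H_def[of c] unfolding p(1) by simp
    qed
  qed
  ultimately show ?thesis
    using subgroup_self by (simp add: freely_generated_by_def bij_betw_def)
qed

end

section \<open>Transport of the plane along a motion of finitely many points\<close>

lemma finite_uniform_bound:
  fixes Q :: "'p \<Rightarrow> real \<Rightarrow> bool"
  assumes "finite P" and "\<And>p. p \<in> P \<Longrightarrow> \<exists>d>0. Q p d"
    and mono: "\<And>p d d'. Q p d \<Longrightarrow> 0 < d' \<Longrightarrow> d' \<le> d \<Longrightarrow> Q p d'"
  shows "\<exists>d>0. \<forall>p\<in>P. Q p d"
  using assms(1,2)
proof (induction P)
  case empty
  show ?case by (intro exI[of _ 1]) simp
next
  case (insert p P)
  obtain d where d: "d > 0" "\<forall>p\<in>P. Q p d" using insert by auto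
  obtain d' where d': "d' > 0" "Q p d'" using insert by auto
  show ?case
    using d d' mono by (intro exI[of _ "min d d'"]) (auto intro: mono[of _ d] mono[of _ d'])
qed

text \<open>
  Since the push is shorter than the radius \<open>\<delta>\<close> of the disc outside which it is cut off, it maps
  each of the disjoint discs into itself, and only the centre goes to the moved centre.
\<close>
lemma push_avoids:
  fixes u v :: "'k \<Rightarrow> complex"
  assumes M: "finite M" and \<delta>: "\<delta> > 0"
    and sep: "\<And>k l. k \<in> M \<Longrightarrow> l \<in> M \<Longrightarrow> k \<noteq> l \<Longrightarrow> 2 * \<delta> \<le> cmod (u k - u l)"
    and v: "\<And>k. k \<in> M \<Longrightarrow> cmod (v k) < \<delta>"
    and w: "\<And>k. k \<in> M \<Longrightarrow> w \<noteq> u k" and k: "k \<in> M"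
  shows "w + (\<Sum>j\<in>M. of_real (max 0 (1 - cmod (w - u j) / \<delta>)) * v j) \<noteq> u k + v k"
proof
  assume eq: "w + (\<Sum>j\<in>M. of_real (max 0 (1 - cmod (w - u j) / \<delta>)) * v j) = u k + v k"
  have far: "max 0 (1 - cmod (w - u j) / \<delta>) = 0" if "\<delta> \<le> cmod (w - u j)" for j
    using that \<delta> by (simp add: field_simps)
  show False
  proof (cases "\<exists>j\<in>M. cmod (w - u j) < \<delta>")
    case False
    hence "(\<Sum>j\<in>M. of_real (max 0 (1 - cmod (w - u j) / \<delta>)) * v j) = 0"
      using far by (intro sum.neutral) auto
    hence "w - u k = v k" using eq by simp
    thus False using v[OF k] False k by auto
  next
    case True
    then obtain j where j: "j \<in> M" "cmod (w - u j) < \<delta>" by blast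
    have "\<delta> \<le> cmod (w - u l)" if "l \<in> M" "l \<noteq> j" for l
      using sep[OF that(1) j(1) that(2)] j(2) norm_triangle_ineq[of "u l - w" "w - u j"]
      by (simp add: norm_minus_commute)
    hence "(\<Sum>l\<in>M. of_real (max 0 (1 - cmod (w - u l) / \<delta>)) * v l) =
        (\<Sum>l\<in>{j}. of_real (max 0 (1 - cmod (w - u l) / \<delta>)) * v l)"
      using far j(1) M by (intro sum.mono_neutral_right) auto
    also have "\<dots> = of_real (1 - cmod (w - u j) / \<delta>) * v j"
      using j(2) \<delta> by (simp add: max_def field_simps)
    finally have eq': "w + of_real (1 - cmod (w - u j) / \<delta>) * v j = u k + v k"
      using eq by simp
    have c: "0 < 1 - cmod (w - u j) / \<delta>" using j(2) \<delta> by (simp add: field_simps)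
    have "k = j"
    proof (rule ccontr)
      assume "k \<noteq> j"
      \<comment> \<open>The push leaves \<open>w\<close> within \<delta> of \<open>u j\<close>, and
        the moved centre is less than \<delta> away from \<open>u k\<close>, so the two centres
        would be less than \<open>2 * \<delta>\<close> apart.\<close>
      have "u k - u j = (w - u j) + of_real (1 - cmod (w - u j) / \<delta>) * v j - v k"
        using eq' by (simp add: algebra_simps)
      also have "cmod \<dots> \<le> cmod (w - u j) + cmod (of_real (1 - cmod (w - u j) / \<delta>) * v j) + cmod (v k)"
        by (meson add_right_mono norm_triangle_ineq norm_triangle_ineq4 order_trans)
      also have "cmod (of_real (1 - cmod (w - u j) / \<delta>) * v j) = (1 - cmod (w - u j) / \<delta>) * cmod (v j)"
        using c by (simp add: norm_mult del: of_real_diff)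
      also have "\<dots> \<le> (1 - cmod (w - u j) / \<delta>) * \<delta>"
        using c v[OF j(1)] by (intro mult_left_mono) auto
      also have "\<dots> = \<delta> - cmod (w - u j)" using \<delta> by (simp add: field_simps)
      finally have "cmod (u k - u j) \<le> \<delta> + cmod (v k)" by simp
      thus False using sep[OF k j(1) \<open>k \<noteq> j\<close>] v[OF k] by simp
    qed
    \<comment> \<open>Both norms contain the factor \<open>cmod (w - u j)\<close>, which is not
      zero; cancelling it would give \<open>cmod (v j) = \<delta>\<close>.\<close>
    hence "w - u j = of_real (cmod (w - u j) / \<delta>) * v j"
      using eq' by (simp add: algebra_simps)
    hence "cmod (w - u j) = cmod (of_real (cmod (w - u j) / \<delta>) * v j)" by simp
    also have "\<dots> = cmod (w - u j) / \<delta> * cmod (v j)"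
      using \<delta> by (simp add: norm_mult norm_divide)
    finally have "cmod (w - u j) * \<delta> = cmod (w - u j) * cmod (v j)"
      using \<delta> by (simp add: field_simps)
    moreover have "cmod (w - u j) \<noteq> 0" using w[OF j(1)] by simp
    ultimately show False using v[OF j(1)] by simp
  qed
qed

text \<open>Injectivity is not demanded: to keep a strand off the moving points it is enough that
  the complement of the points is mapped into the complement of their new positions. The last two
  clauses keep loops closed and leave room far out that is never disturbed.\<close>

definition transport ::
    "(real \<Rightarrow> 'a::metric_space \<Rightarrow> 'k \<Rightarrow> complex) \<Rightarrow> 'a set \<Rightarrow> 'k set \<Rightarrow> real \<Rightarrow> real \<Rightarrow> real \<Rightarrow>
       (real \<Rightarrow> 'a \<Rightarrow> complex \<Rightarrow> complex) \<Rightarrow> bool" where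
  "transport H K M R a b \<phi> \<longleftrightarrow>
     continuous_on ({a..b} \<times> K \<times> UNIV) (\<lambda>z. \<phi> (fst z) (fst (snd z)) (snd (snd z))) \<and>
     (\<forall>y\<in>K. \<forall>w. \<phi> a y w = w) \<and>
     (\<forall>s\<in>{a..b}. \<forall>y\<in>K. \<forall>w. (\<forall>j\<in>M. w \<noteq> H a y j) \<longrightarrow> (\<forall>k\<in>M. \<phi> s y w \<noteq> H s y k)) \<and>
     (\<forall>s\<in>{a..b}. \<forall>y\<in>K. \<forall>w. (\<forall>r\<in>{0..1}. \<forall>k\<in>M. H r y k = H 0 y k) \<longrightarrow> \<phi> s y w = w) \<and>
     (\<forall>s\<in>{a..b}. \<forall>y\<in>K. \<forall>w. R \<le> cmod w \<longrightarrow> \<phi> s y w = w)"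

lemma transport_fixes:
  "transport H K M R a b \<phi> \<Longrightarrow> s \<in> {a..b} \<Longrightarrow> y \<in> K \<Longrightarrow> \<forall>r\<in>{0..1}. \<forall>k\<in>M. H r y k = H 0 y k \<Longrightarrow> \<phi> s y w = w"
  unfolding transport_def by blast

lemma transport_trans:
  assumes 1: "transport H K M R a b \<phi>" and 2: "transport H K M R b c \<psi>" and abc: "a \<le> b" "b \<le> c"
  shows "transport H K M R a c (\<lambda>s y w. if s \<le> b then \<phi> s y w else \<psi> s y (\<phi> b y w))"
  unfolding transport_def
proof (intro conjI ballI allI impI)
  have c1: "continuous_on ({a..b} \<times> K \<times> UNIV) (\<lambda>z. \<phi> (fst z) (fst (snd z)) (snd (snd z)))"
    and c2: "continuous_on ({b..c} \<times> K \<times> UNIV) (\<lambda>z. \<psi> (fst z) (fst (snd z)) (snd (snd z)))"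
    using 1 2 by (auto simp: transport_def)
  have "continuous_on ({b..c} \<times> K \<times> (UNIV :: complex set)) (\<lambda>z. (b, snd z))"
    by (intro continuous_intros)
  from continuous_on_compose2[OF c1 this]
  have c0: "continuous_on ({b..c} \<times> K \<times> UNIV) (\<lambda>z. \<phi> b (fst (snd z)) (snd (snd z)))"
    using abc by (simp add: image_subset_iff)
  have "continuous_on ({b..c} \<times> K \<times> UNIV) (\<lambda>z. (fst z, fst (snd z), \<phi> b (fst (snd z)) (snd (snd z))))"
    by (intro continuous_intros c0)
  from continuous_on_compose2[OF c2 this]
  have c3: "continuous_on ({b..c} \<times> K \<times> UNIV) (\<lambda>z. \<psi> (fst z) (fst (snd z)) (\<phi> b (fst (snd z)) (snd (snd z))))"
    by (simp add: image_subset_iff)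
  show "continuous_on ({a..c} \<times> K \<times> UNIV) (\<lambda>z. if fst z \<le> b then \<phi> (fst z) (fst (snd z)) (snd (snd z))
      else \<psi> (fst z) (fst (snd z)) (\<phi> b (fst (snd z)) (snd (snd z))))"
  proof (rule continuous_on_cases_le)
    show "continuous_on {t \<in> {a..c} \<times> K \<times> UNIV. fst t \<le> b} (\<lambda>z. \<phi> (fst z) (fst (snd z)) (snd (snd z)))"
      by (rule continuous_on_subset[OF c1]) auto
    show "continuous_on {t \<in> {a..c} \<times> K \<times> UNIV. b \<le> fst t}
        (\<lambda>z. \<psi> (fst z) (fst (snd z)) (\<phi> b (fst (snd z)) (snd (snd z))))"
      by (rule continuous_on_subset[OF c3]) auto
  qed (use 2 in \<open>auto simp: transport_def intro!: continuous_intros\<close>)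
  fix s y w assume s: "s \<in> {a..c}" and y: "y \<in> K"
  {
    fix k assume w: "\<forall>j\<in>M. w \<noteq> H a y j" and k: "k \<in> M"
    show "(if s \<le> b then \<phi> s y w else \<psi> s y (\<phi> b y w)) \<noteq> H s y k"
    proof (cases "s \<le> b")
      case True
      thus ?thesis using 1 s y w k by (simp add: transport_def)
    next
      case False
      have "\<forall>j\<in>M. \<phi> b y w \<noteq> H b y j" using 1 y w abc by (simp add: transport_def)
      thus ?thesis using 2 False s y k by (simp add: transport_def)
    qed
  next
    assume c: "\<forall>r\<in>{0..1}. \<forall>k\<in>M. H r y k = H 0 y k"
    show "(if s \<le> b then \<phi> s y w else \<psi> s y (\<phi> b y w)) = w"
      using transport_fixes[OF 1 _ y c, of s] transport_fixes[OF 1 _ y c, of b]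
        transport_fixes[OF 2 _ y c, of s] s abc
      by simp
  next
    assume "R \<le> cmod w"
    thus "(if s \<le> b then \<phi> s y w else \<psi> s y (\<phi> b y w)) = w"
      using 1 2 s y abc by (simp add: transport_def)
  }
qed (use 1 abc in \<open>simp add: transport_def\<close>)

text \<open>By compactness the points always keep a distance of at least
  \<open>2 * \<delta>\<close>, and for parameters less than \<eta> apart their positions differ by
  less than \<delta>. On such a short time interval \<open>push_avoids\<close> applies, and the
  Bolzano principle composes the short transports.\<close>

lemma transport_exists:
  fixes H :: "real \<Rightarrow> 'a::metric_space \<Rightarrow> 'k \<Rightarrow> complex"
  assumes K: "compact K" and M: "finite M"
    and cont: "\<And>k. k \<in> M \<Longrightarrow> continuous_on ({0..1} \<times> K) (\<lambda>z. H (fst z) (snd z) k)"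
    and inj: "\<And>s y. s \<in> {0..1} \<Longrightarrow> y \<in> K \<Longrightarrow> inj_on (H s y) M"
  obtains R \<phi> where "transport H K M R 0 1 \<phi>"
proof -
  let ?C = "{0..1::real} \<times> K"
  have C: "compact ?C" using K by (intro compact_Times) auto
  have "\<exists>d>0. \<forall>p\<in>{(k, l). k \<in> M \<and> l \<in> M \<and> k \<noteq> l}. \<forall>z\<in>?C.
      2 * d \<le> cmod (H (fst z) (snd z) (fst p) - H (fst z) (snd z) (snd p))"
  proof (rule finite_uniform_bound)
    show "finite {(k, l). k \<in> M \<and> l \<in> M \<and> k \<noteq> l}"
      by (rule finite_subset[of _ "M \<times> M"]) (use M in auto)
  next
    fix p assume "p \<in> {(k, l). k \<in> M \<and> l \<in> M \<and> k \<noteq> l}"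
    then obtain k l where p: "p = (k, l)" "k \<in> M" "l \<in> M" "k \<noteq> l" by blast
    let ?f = "\<lambda>z. cmod (H (fst z) (snd z) k - H (fst z) (snd z) l)"
    have f: "continuous_on ?C ?f" using cont[OF p(2)] cont[OF p(3)] by (intro continuous_intros)
    have pos: "?f z > 0" if "z \<in> ?C" for z
      using inj[of "fst z" "snd z"] that p by (auto simp: inj_on_def)
    show "\<exists>d>0. \<forall>z\<in>?C. 2 * d \<le> cmod (H (fst z) (snd z) (fst p) - H (fst z) (snd z) (snd p))"
    proof (cases "?C = {}")
      case True
      thus ?thesis by (intro exI[of _ 1]) simp
    next
      case False
      then obtain z0 where z0: "z0 \<in> ?C" "\<forall>z\<in>?C. ?f z0 \<le> ?f z"
        using continuous_attains_inf[OF C False f] by blast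
      thus ?thesis using pos[OF z0(1)] by (intro exI[of _ "?f z0 / 2"]) (simp add: p(1))
    qed
  qed force
  then obtain \<delta> where \<delta>: "\<delta> > 0" "\<And>k l z. k \<in> M \<Longrightarrow> l \<in> M \<Longrightarrow> k \<noteq> l \<Longrightarrow> z \<in> ?C \<Longrightarrow>
      2 * \<delta> \<le> cmod (H (fst z) (snd z) k - H (fst z) (snd z) l)"
    by fastforce
  have "\<exists>d>0. \<forall>k\<in>M. \<forall>z\<in>?C. \<forall>z'\<in>?C. dist z z' < d \<longrightarrow> cmod (H (fst z) (snd z) k - H (fst z') (snd z') k) < \<delta>"
  proof (rule finite_uniform_bound[OF M])
    fix k assume k: "k \<in> M"
    have "uniformly_continuous_on ?C (\<lambda>z. H (fst z) (snd z) k)"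
      by (rule compact_uniformly_continuous[OF cont[OF k] C])
    then obtain d where "d > 0" "\<forall>z\<in>?C. \<forall>z'\<in>?C. dist z' z < d \<longrightarrow> dist (H (fst z') (snd z') k) (H (fst z) (snd z) k) < \<delta>"
      using \<delta>(1) unfolding uniformly_continuous_on_def by metis
    thus "\<exists>d>0. \<forall>z\<in>?C. \<forall>z'\<in>?C. dist z z' < d \<longrightarrow> cmod (H (fst z) (snd z) k - H (fst z') (snd z') k) < \<delta>"
      unfolding dist_norm by blast
  qed fastforce
  then obtain \<eta> where \<eta>: "\<eta> > 0" "\<And>k z z'. k \<in> M \<Longrightarrow> z \<in> ?C \<Longrightarrow> z' \<in> ?C \<Longrightarrow> dist z z' < \<eta> \<Longrightarrow>
      cmod (H (fst z) (snd z) k - H (fst z') (snd z') k) < \<delta>"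
    by blast
  \<comment> \<open>\<open>finite_uniform_bound\<close> yields small numbers, so the common upper
    bound for the points is written as \<open>1 / d\<close>.\<close>
  have "\<exists>d>0. \<forall>k\<in>M. \<forall>z\<in>?C. cmod (H (fst z) (snd z) k) \<le> 1 / d"
  proof (rule finite_uniform_bound[OF M])
    fix k assume k: "k \<in> M"
    have "bounded ((\<lambda>z. H (fst z) (snd z) k) ` ?C)"
      using compact_imp_bounded[OF compact_continuous_image[OF cont[OF k] C]] .
    then obtain B where "B > 0" "\<forall>z\<in>?C. cmod (H (fst z) (snd z) k) \<le> B"
      unfolding bounded_pos by auto
    thus "\<exists>d>0. \<forall>z\<in>?C. cmod (H (fst z) (snd z) k) \<le> 1 / d"
      by (intro exI[of _ "1 / B"]) simp
  next
    fix k and d d' :: real assume "\<forall>z\<in>?C. cmod (H (fst z) (snd z) k) \<le> 1 / d" "0 < d'" "d' \<le> d"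
    moreover from this have "1 / d \<le> 1 / d'" by (intro divide_left_mono) auto
    ultimately show "\<forall>z\<in>?C. cmod (H (fst z) (snd z) k) \<le> 1 / d'" by force
  qed
  then obtain N where N: "\<And>k z. k \<in> M \<Longrightarrow> z \<in> ?C \<Longrightarrow> cmod (H (fst z) (snd z) k) \<le> N" by blast
  \<comment> \<open>A point of norm at least \<open>R\<close> lies outside every disc of radius
    \<delta> about a moving point, where the pushes vanish.\<close>
  define R where "R = N + \<delta>"
  let ?P = "\<lambda>a b. 0 \<le> a \<and> b \<le> 1 \<longrightarrow> (\<exists>\<phi>. transport H K M R a b \<phi>)"
  have "?P 0 1"
  proof (rule Bolzano[of 0 1 ?P])
    fix a b c :: real assume "?P a b" "?P b c" "a \<le> b" "b \<le> c"
    thus "?P a c" using transport_trans[of H K M R a b _ c] by (metis order_trans)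
  next
    fix t :: real
    have "?P a b" if "b - a < \<eta>" for a b
    proof
      assume ab: "0 \<le> a \<and> b \<le> 1"
      define \<phi> where "\<phi> s y w = w + (\<Sum>j\<in>M. of_real (max 0 (1 - cmod (w - H a y j) / \<delta>)) * (H s y j - H a y j))"
        for s y w
      have small: "cmod (H s y k - H a y k) < \<delta>" if "k \<in> M" "s \<in> {a..b}" "y \<in> K" for k s y
        using \<eta>(2)[OF that(1), of "(s, y)" "(a, y)"] that(2,3) ab \<open>b - a < \<eta>\<close>
        by (auto simp: dist_prod_def dist_real_def)
      have "transport H K M R a b \<phi>"
        unfolding transport_def
      proof (intro conjI ballI allI impI)
        have "continuous_on ({a..b} \<times> K \<times> (UNIV :: complex set)) (\<lambda>z. H (fst z) (fst (snd z)) j)"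
          "continuous_on ({a..b} \<times> K \<times> (UNIV :: complex set)) (\<lambda>z. H a (fst (snd z)) j)" if j: "j \<in> M" for j
        proof -
          have "continuous_on ({a..b} \<times> K \<times> (UNIV :: complex set)) (\<lambda>z. (fst z, fst (snd z)))"
            "continuous_on ({a..b} \<times> K \<times> (UNIV :: complex set)) (\<lambda>z. (a, fst (snd z)))"
            by (intro continuous_intros)+
          from this[THEN continuous_on_compose2[OF cont[OF j]]]
          show "continuous_on ({a..b} \<times> K \<times> (UNIV :: complex set)) (\<lambda>z. H (fst z) (fst (snd z)) j)"
            "continuous_on ({a..b} \<times> K \<times> (UNIV :: complex set)) (\<lambda>z. H a (fst (snd z)) j)"
            using ab by (simp_all add: image_subset_iff)
        qed
        thus "continuous_on ({a..b} \<times> K \<times> UNIV) (\<lambda>z. \<phi> (fst z) (fst (snd z)) (snd (snd z)))"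
          unfolding \<phi>_def using \<delta>(1) by (intro continuous_intros) auto
      next
        fix s y w k assume s: "s \<in> {a..b}" and y: "y \<in> K" and w: "\<forall>j\<in>M. w \<noteq> H a y j" and k: "k \<in> M"
        have "\<phi> s y w \<noteq> H a y k + (H s y k - H a y k)"
          unfolding \<phi>_def
          using \<delta>(2)[of _ _ "(a, y)"] s y ab w
          by (intro push_avoids[OF M \<delta>(1) _ small[OF _ s y] _ k]) auto
        thus "\<phi> s y w \<noteq> H s y k" by simp
      next
        fix s y w assume s: "s \<in> {a..b}" and y: "y \<in> K" and w: "R \<le> cmod w"
        have "max 0 (1 - cmod (w - H a y j) / \<delta>) = 0" if j: "j \<in> M" for j
        proof -
          have "cmod (H a y j) \<le> N" using N[OF j, of "(a, y)"] s y ab by simp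
          hence "\<delta> \<le> cmod (w - H a y j)"
            using w norm_triangle_ineq2[of w "H a y j"] by (simp add: R_def)
          thus ?thesis using \<delta>(1) by simp
        qed
        thus "\<phi> s y w = w" by (simp add: \<phi>_def)
      next
        fix s y w assume s: "s \<in> {a..b}" and c: "\<forall>r\<in>{0..1}. \<forall>k\<in>M. H r y k = H 0 y k"
        have "H s y k = H a y k" if "k \<in> M" for k
          using c[rule_format, of s k] c[rule_format, of a k] s ab that by simp
        thus "\<phi> s y w = w" by (simp add: \<phi>_def)
      qed (simp add: \<phi>_def)
      thus "\<exists>\<phi>. transport H K M R a b \<phi>" by blast
    qed
    thus "\<exists>d>0. \<forall>a b. a \<le> t \<and> t \<le> b \<and> b - a < d \<longrightarrow> ?P a b"
      using \<eta>(1) by blast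
  qed simp
  thus thesis using that by auto
qed

section \<open>The fibre of the projection forgetting the last point\<close>

lemma continuous_map_PB_iff:
  fixes T :: "'a::topological_space set"
  shows "continuous_map (top_of_set T) (PB n) f \<longleftrightarrow>
     (\<forall>k\<in>{1..n}. continuous_on T (\<lambda>z. f z k)) \<and> (\<forall>z\<in>T. f z \<in> extensional {1..n} \<and> inj_on (f z) {1..n})"
  unfolding PB_def continuous_map_in_subtopology continuous_map_componentwise
  by (auto simp: image_subset_iff)

definition fibre :: "nat \<Rightarrow> (nat \<Rightarrow> real) \<Rightarrow> complex set" where
  "fibre n x = {z. \<forall>k\<in>{1..n - 1}. z \<noteq> of_real (x k)}"

definition fibre_incl :: "nat \<Rightarrow> (nat \<Rightarrow> real) \<Rightarrow> complex \<Rightarrow> nat \<Rightarrow> complex" where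
  "fibre_incl n x z = (\<lambda>k\<in>{1..n}. if k = n then z else of_real (x k))"

context
  fixes n :: nat and x :: "nat \<Rightarrow> real"
  assumes n: "n \<ge> 2" and x: "strict_mono_on {1..n} x"
begin

lemma points_less: "i \<in> {1..n} \<Longrightarrow> j \<in> {1..n} \<Longrightarrow> i < j \<Longrightarrow> x i < x j"
  using x by (rule strict_mono_onD)

lemma points_eq_iff: "i \<in> {1..n} \<Longrightarrow> j \<in> {1..n} \<Longrightarrow> x i = x j \<longleftrightarrow> i = j"
  using x by (auto dest: strict_mono_on_eqD)

lemma inj_on_extend:
  fixes w :: "nat \<Rightarrow> complex"
  assumes "inj_on w {1..n - 1}" "\<And>k. k \<in> {1..n - 1} \<Longrightarrow> z \<noteq> w k"
  shows "inj_on (\<lambda>k\<in>{1..n}. if k = n then z else w k) {1..n}"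
proof (rule inj_onI)
  fix k l assume kl: "k \<in> {1..n}" "l \<in> {1..n}"
    and eq: "(\<lambda>k\<in>{1..n}. if k = n then z else w k) k = (\<lambda>k\<in>{1..n}. if k = n then z else w k) l"
  have mem: "j = n \<or> j \<in> {1..n - 1}" if "j \<in> {1..n}" for j using that by auto
  show "k = l"
    using eq kl mem[OF kl(1)] mem[OF kl(2)] assms(2) inj_onD[OF assms(1)] by (auto split: if_splits)
qed

lemma continuous_fibre_incl: "continuous_map (top_of_set (fibre n x)) (PB n) (fibre_incl n x)"
  unfolding continuous_map_PB_iff
proof (intro conjI ballI)
  fix k assume "k \<in> {1..n}"
  thus "continuous_on (fibre n x) (\<lambda>z. fibre_incl n x z k)"
    by (cases "k = n") (auto simp: fibre_incl_def)
next
  fix z assume z: "z \<in> fibre n x"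
  show "fibre_incl n x z \<in> extensional {1..n}" by (simp add: fibre_incl_def)
  have "inj_on (\<lambda>k. complex_of_real (x k)) {1..n - 1}"
    using points_eq_iff by (auto simp: inj_on_def)
  thus "inj_on (fibre_incl n x z) {1..n}"
    unfolding fibre_incl_def using z by (intro inj_on_extend) (auto simp: fibre_def)
qed

lemma fibre_incl_base: "fibre_incl n x (of_real (x n)) = base_conf n x"
  by (auto simp: fibre_incl_def base_conf_def fun_eq_iff)

lemma base_in_fibre: "of_real (x n) \<in> fibre n x"
  using points_eq_iff n by (auto simp: fibre_def)

text \<open>For each time \<open>t\<close>, the null homotopy \<open>h\<close> moves the first
  \<open>n - 1\<close> points of \<open>p t\<close> to the base configuration, and the transport
  takes the last point along. At \<open>t = 0\<close> and \<open>t = 1\<close> these points are at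
  rest, so the last point stays where it is and the result is a loop.\<close>

lemma deform_into_fibre:
  assumes p: "loop_in (PB n) (base_conf n x) p"
    and hom: "loop_homotopic (PB (n - 1)) (base_conf (n - 1) x) (\<lambda>t. restrict (p t) {1..n - 1}) (\<lambda>_. base_conf (n - 1) x)"
  shows "\<exists>q. pth (fibre n x) q (of_real (x n)) (of_real (x n)) \<and>
           loop_homotopic (PB n) (base_conf n x) p (fibre_incl n x \<circ> q)"
proof -
  obtain h where h: "continuous_map (top_of_set unit_square) (PB (n - 1)) h"
    "\<And>t. t \<in> {0..1} \<Longrightarrow> h (0, t) = restrict (p t) {1..n - 1}"
    "\<And>t. t \<in> {0..1} \<Longrightarrow> h (1, t) = base_conf (n - 1) x"
    "\<And>s. s \<in> {0..1} \<Longrightarrow> h (s, 0) = base_conf (n - 1) x" "\<And>s. s \<in> {0..1} \<Longrightarrow> h (s, 1) = base_conf (n - 1) x"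
    using hom by (rule loop_homotopicE) blast
  have hc: "continuous_on unit_square (\<lambda>z. h z k)" if "k \<in> {1..n - 1}" for k
    using h(1) that unfolding continuous_map_PB_iff by blast
  have hi: "inj_on (h z) {1..n - 1}" if "z \<in> unit_square" for z
    using h(1) that unfolding continuous_map_PB_iff by blast
  have pc: "continuous_on {0..1} (\<lambda>t. p t k)" if "k \<in> {1..n}" for k
    using p that unfolding loop_in_def pathin_def continuous_map_PB_iff by blast
  have pe: "p t \<in> extensional {1..n}" "inj_on (p t) {1..n}" if "t \<in> {0..1}" for t
    using p that unfolding loop_in_def pathin_def continuous_map_PB_iff by blast+
  have p01: "p 0 = base_conf n x" "p 1 = base_conf n x" using p by (auto simp: loop_in_def)
  let ?H = "\<lambda>s t k. h (s, t) k"
  obtain R \<phi> where tr: "transport ?H {0..1} {1..n - 1} R 0 1 \<phi>"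
    by (rule transport_exists[of "{0..1}" "{1..n - 1}" ?H]) (use hc hi in auto)
  have \<phi>c: "continuous_on ({0..1} \<times> {0..1} \<times> UNIV) (\<lambda>z. \<phi> (fst z) (fst (snd z)) (snd (snd z)))"
    and \<phi>0: "\<And>t w. t \<in> {0..1} \<Longrightarrow> \<phi> 0 t w = w"
    and \<phi>a: "\<And>s t w k. s \<in> {0..1} \<Longrightarrow> t \<in> {0..1} \<Longrightarrow> (\<And>j. j \<in> {1..n - 1} \<Longrightarrow> w \<noteq> h (0, t) j) \<Longrightarrow>
         k \<in> {1..n - 1} \<Longrightarrow> \<phi> s t w \<noteq> h (s, t) k"
    using tr unfolding transport_def by blast+
  have \<phi>f: "\<phi> s t w = w" if "s \<in> {0..1}" "t \<in> {0, 1}" for s t w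
    by (rule transport_fixes[OF tr that(1)]) (use that h(4,5) in auto)
  define q where "q s t = \<phi> s t (p t n)" for s t
  have nn: "n \<in> {1..n}" using n by simp
  have "continuous_on unit_square (\<lambda>z. (fst z, snd z, p (snd z) n))"
    by (intro continuous_intros continuous_on_compose2[OF pc[OF nn]]) auto
  from continuous_on_compose2[OF \<phi>c this]
  have qc: "continuous_on unit_square (\<lambda>z. q (fst z) (snd z))"
    by (simp add: image_subset_iff q_def)
  have qa: "q s t \<noteq> h (s, t) k" if st: "s \<in> {0..1}" "t \<in> {0..1}" and k: "k \<in> {1..n - 1}" for s t k
    unfolding q_def
  proof (rule \<phi>a[OF st _ k])
    fix j assume j: "j \<in> {1..n - 1}"
    have "p t n \<noteq> p t j"
    proof
      assume "p t n = p t j"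
      hence "n = j" using inj_onD[OF pe(2)[OF st(2)], of n j] j n by auto
      thus False using j n by auto
    qed
    thus "p t n \<noteq> h (0, t) j" using j by (simp add: h(2)[OF st(2)])
  qed
  have q1: "q 1 t \<in> fibre n x" if "t \<in> {0..1}" for t
    using qa[OF _ that, of 1] by (auto simp: fibre_def h(3)[OF that] base_conf_def)
  have "continuous_on {0..1} (\<lambda>t. (1::real, t::real))" by (intro continuous_intros)
  from continuous_on_compose2[OF qc this] have "continuous_on {0..1} (q 1)"
    by (simp add: image_subset_iff)
  moreover have "q 1 0 = of_real (x n)" "q 1 1 = of_real (x n)"
    using \<phi>f nn by (simp_all add: q_def p01 base_conf_def)
  ultimately have pth: "pth (fibre n x) (q 1) (of_real (x n)) (of_real (x n))"
    using q1 by (auto simp: pth_def path_def path_image_def pathstart_def pathfinish_def)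
  let ?G = "\<lambda>z. \<lambda>k\<in>{1..n}. if k = n then q (fst z) (snd z) else h z k"
  have "loop_homotopic (PB n) (base_conf n x) p (fibre_incl n x \<circ> q 1)"
  proof (rule loop_homotopicI)
    show "continuous_map (top_of_set unit_square) (PB n) ?G"
      unfolding continuous_map_PB_iff
    proof (intro conjI ballI)
      fix k assume "k \<in> {1..n}"
      thus "continuous_on unit_square (\<lambda>z. ?G z k)"
        using qc hc[of k] by (cases "k = n") auto
    next
      fix z :: "real \<times> real" assume z: "z \<in> unit_square"
      show "inj_on (?G z) {1..n}"
        using hi[OF z] qa[of "fst z" "snd z"] z by (intro inj_on_extend) auto
    qed simp
    fix t :: real assume t: "t \<in> {0..1}"
    show "?G (0, t) = p t"
    proof
      fix k
      show "?G (0, t) k = p t k"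
        using pe(1)[OF t] by (auto simp: h(2)[OF t] q_def \<phi>0[OF t] extensional_def)
    qed
    show "?G (1, t) = (fibre_incl n x \<circ> q 1) t"
      by (auto simp: fibre_incl_def h(3)[OF t] base_conf_def fun_eq_iff)
    show "?G (t, 0) = base_conf n x" "?G (t, 1) = base_conf n x"
      using \<phi>f[OF t] by (auto simp: h(4)[OF t] h(5)[OF t] q_def p01 base_conf_def fun_eq_iff)
  qed
  thus ?thesis using pth by blast
qed

text \<open>
  The base point can be moved to infinity, where all maps of the family are the identity.
\<close>
lemma twisted_loop_homotopic:
  fixes \<theta> :: "real \<Rightarrow> complex \<Rightarrow> complex"
  assumes g: "pth (fibre n x) g (of_real (x n)) (of_real (x n))"
    and c: "continuous_on ({0..1} \<times> UNIV) (\<lambda>z. \<theta> (fst z) (snd z))"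
    and a: "\<And>t w. t \<in> {0..1} \<Longrightarrow> w \<in> fibre n x \<Longrightarrow> \<theta> t w \<in> fibre n x"
    and ends: "\<And>w. \<theta> 0 w = w" "\<And>w. \<theta> 1 w = w"
    and far: "\<And>t w. t \<in> {0..1} \<Longrightarrow> R \<le> cmod w \<Longrightarrow> \<theta> t w = w"
  shows "homotopic_paths (fibre n x) (\<lambda>t. \<theta> t (g t)) g"
proof -
  let ?S = "fibre n x" and ?b = "complex_of_real (x n)"
  interpret pointed_subset ?S ?b by unfold_locales (rule base_in_fibre)
  \<comment> \<open>The point \<open>e\<close> lies on the real axis to the right of the base point,
    hence beyond all punctures, and far enough out that its norm is at least
    \<open>R\<close>.\<close>
  define d where "d = \<bar>x n\<bar> + \<bar>R\<bar>"
  define e where "e = ?b + of_real d"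
  have e: "R \<le> cmod e"
  proof -
    have "cmod (of_real d) - cmod ?b \<le> cmod e"
      using norm_diff_ineq[of "of_real d" ?b] by (simp add: e_def add.commute)
    moreover have "cmod (of_real d) = d" by (simp only: norm_of_real) (simp add: d_def)
    ultimately show ?thesis by (simp add: d_def)
  qed
  have "closed_segment ?b e \<subseteq> ?S"
  proof
    fix z assume "z \<in> closed_segment ?b e"
    then obtain s where s: "0 \<le> s" "z = (1 - s) *\<^sub>R ?b + s *\<^sub>R e" by (auto simp: closed_segment_def)
    hence "Re z = x n + s * d" by (simp add: e_def algebra_simps)
    moreover have "s * d \<ge> 0" using s by (simp add: d_def)
    ultimately have "Re z > x k" if "k \<in> {1..n - 1}" for k
      using that points_less[of k n] n by force
    thus "z \<in> ?S" by (force simp: fibre_def)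
  qed
  hence l: "pth ?S (linepath ?b e) ?b e" by (rule pth_linepath)
  have ee: "pth ?S (linepath e e) e e" using l by (auto simp: pth_def)
  let ?r = "linepath ?b e +++ (linepath e e +++ reversepath (linepath ?b e))"
  have r: "pth ?S ?r ?b ?b" using pth_join[OF l pth_join[OF ee pth_reverse[OF l]]] .
  have "homotopic_paths ?S ?r (linepath ?b e +++ reversepath (linepath ?b e))"
    using l pth_join[OF ee pth_reverse[OF l]] pth_refl[OF l]
      homotopic_paths_lid'[of "reversepath (linepath ?b e)" ?S e] pth_reverse[OF l]
    by (intro pth_join_cong) (auto simp: pth_def)
  also have "homotopic_paths ?S \<dots> (linepath ?b ?b)"
    using homotopic_paths_rinv[of "linepath ?b e" ?S] l by (auto simp: pth_def)
  finally have "homotopic_paths ?S (g +++ ?r) (g +++ linepath ?b ?b)"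
    using pth_join_cong[OF g r pth_refl[OF g]] by blast
  also have "homotopic_paths ?S \<dots> g"
    using g homotopic_paths_rid'[of g ?S ?b] by (auto simp: pth_def)
  finally have gr: "homotopic_paths ?S (g +++ ?r) g" .
  then obtain k where k: "continuous_on unit_square k" "k \<in> unit_square \<rightarrow> ?S"
    "\<And>t. t \<in> {0..1} \<Longrightarrow> k (0, t) = g t" "\<And>t. t \<in> {0..1} \<Longrightarrow> k (1, t) = (g +++ ?r) t"
    "\<And>s. s \<in> {0..1} \<Longrightarrow> k (s, 0) = ?b" "\<And>s. s \<in> {0..1} \<Longrightarrow> k (s, 1) = ?b"
    using homotopic_paths_sym[OF gr] g unfolding homotopic_paths
    by (force simp: pth_def pathstart_def pathfinish_def)
  \<comment> \<open>The path \<open>g +++ ?r\<close> waits at \<open>e\<close> for \<open>t\<close>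
    between 3/4 and 7/8, and just then \<open>u\<close> rises from 0 to 1. While \<open>k\<close>
    deforms \<open>g\<close> into \<open>g +++ ?r\<close>, the time of the maps \<theta> is changed
    from \<open>t\<close> to \<open>u t\<close>; in the end the whole twist takes place at
    \<open>e\<close>, where every map is the identity.\<close>
  define u where "u t = min 1 (max 0 (8 * t - 6))" for t :: real
  have u: "u 0 = 0" "u 1 = 1" "\<And>t. u t \<in> {0..1}" "continuous_on {0..1} u"
    by (auto simp: u_def intro!: continuous_intros)
  define m where "m z = (1 - fst z) * snd z + fst z * u (snd z)" for z
  have m: "m z \<in> {0..1}" if "z \<in> unit_square" for z
  proof -
    have "(1 - fst z) *\<^sub>R snd z + fst z *\<^sub>R u (snd z) \<in> {0..1}"
      using that u(3)[of "snd z"] by (intro convexD) auto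
    thus ?thesis by (simp add: m_def)
  qed
  have "homotopic_paths ?S (\<lambda>t. \<theta> t (g t)) (g +++ ?r)"
    unfolding homotopic_paths
  proof (intro exI[of _ "\<lambda>z. \<theta> (m z) (k z)"] conjI ballI)
    have "continuous_on unit_square (\<lambda>z. (m z, k z))"
      unfolding m_def by (intro continuous_intros k(1) continuous_on_compose2[OF u(4)]) auto
    from continuous_on_compose2[OF c this]
    show "continuous_on unit_square (\<lambda>z. \<theta> (m z) (k z))"
      using m by (simp add: image_subset_iff)
    show "(\<lambda>z. \<theta> (m z) (k z)) \<in> unit_square \<rightarrow> ?S"
      using a m k(2) by blast
    fix t :: real assume t: "t \<in> {0..1}"
    show "\<theta> (m (0, t)) (k (0, t)) = \<theta> t (g t)"
      using t by (simp add: m_def k(3))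
    show "\<theta> (m (1, t)) (k (1, t)) = (g +++ ?r) t"
    proof -
      consider "t \<le> 3/4" | "3/4 < t" "t \<le> 7/8" | "7/8 < t" by linarith
      thus ?thesis
      proof cases
        case 1
        thus ?thesis using t ends by (simp add: m_def k(4) u_def)
      next
        case 2
        hence "(g +++ ?r) t = e" by (simp add: joinpaths_def linepath_refl)
        thus ?thesis using t far[OF u(3) e] by (simp add: m_def k(4))
      next
        case 3
        thus ?thesis using t ends by (simp add: m_def k(4) u_def)
      qed
    qed
    show "pathstart ((\<lambda>z. \<theta> (m z) (k z)) \<circ> Pair t) = pathstart (\<lambda>t. \<theta> t (g t))"
      using t g ends by (simp add: m_def k(5) pathstart_def pth_def u)
    show "pathfinish ((\<lambda>z. \<theta> (m z) (k z)) \<circ> Pair t) = pathfinish (\<lambda>t. \<theta> t (g t))"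
      using t g ends by (simp add: m_def k(6) pathfinish_def pth_def u)
  qed
  thus ?thesis using gr by (rule homotopic_paths_trans)
qed

text \<open>To the last strand at \<open>(s, t)\<close> the transport along the homotopy run back
  from \<open>s\<close> to 0 is applied. It takes the other points to the base configuration, so the
  last strand moves in the fibre. For \<open>s = 1\<close> this changes \<open>g\<close> by a loop
  of maps of the fibre into itself, which \<open>twisted_loop_homotopic\<close> removes.\<close>

lemma null_homotopic_in_fibre:
  assumes g: "pth (fibre n x) g (of_real (x n)) (of_real (x n))"
    and hom: "loop_homotopic (PB n) (base_conf n x) (\<lambda>_. base_conf n x) (fibre_incl n x \<circ> g)"
  shows "homotopic_paths (fibre n x) (\<lambda>_. of_real (x n)) g"
proof -
  let ?S = "fibre n x" and ?b = "complex_of_real (x n)"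
  obtain h where h: "continuous_map (top_of_set unit_square) (PB n) h"
    "\<And>t. t \<in> {0..1} \<Longrightarrow> h (0, t) = base_conf n x"
    "\<And>t. t \<in> {0..1} \<Longrightarrow> h (1, t) = fibre_incl n x (g t)"
    "\<And>s. s \<in> {0..1} \<Longrightarrow> h (s, 0) = base_conf n x" "\<And>s. s \<in> {0..1} \<Longrightarrow> h (s, 1) = base_conf n x"
    using hom unfolding o_def by (rule loop_homotopicE) blast
  have hc: "continuous_on unit_square (\<lambda>z. h z k)" if "k \<in> {1..n}" for k
    using h(1) that unfolding continuous_map_PB_iff by blast
  have hi: "inj_on (h z) {1..n}" if "z \<in> unit_square" for z
    using h(1) that unfolding continuous_map_PB_iff by blast
  \<comment> \<open>Here \<open>r\<close> is the time of the transport, and the parameter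
    \<open>y\<close> is the point of the square at which running back begins.\<close>
  define H where "H r y k = h ((1 - r) * fst y, snd y) k" for r :: real and y :: "real \<times> real" and k
  have sq: "((1 - r) * fst y, snd y) \<in> unit_square" if "r \<in> {0..1}" "y \<in> unit_square" for r y
    using that by (auto simp: mem_Times_iff mult_le_one)
  obtain R \<phi> where tr: "transport H unit_square {1..n - 1} R 0 1 \<phi>"
  proof (rule transport_exists[of unit_square "{1..n - 1}" H])
    fix k assume k: "k \<in> {1..n - 1}"
    have "continuous_on ({0..1} \<times> unit_square) (\<lambda>z. ((1 - fst z) * fst (snd z), snd (snd z)))"
      by (intro continuous_intros)
    from continuous_on_compose2[OF hc this, of k]
    show "continuous_on ({0..1} \<times> unit_square) (\<lambda>z. H (fst z) (snd z) k)"
      using k sq by (auto simp: H_def image_subset_iff)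
  next
    fix r :: real and y assume "r \<in> {0..1}" "y \<in> unit_square"
    from inj_on_subset[OF hi[OF sq[OF this]], of "{1..n - 1}"]
    show "inj_on (H r y) {1..n - 1}" by (auto simp: H_def inj_on_def)
  qed (auto intro: compact_Times)
  have \<phi>c: "continuous_on ({0..1} \<times> unit_square \<times> UNIV) (\<lambda>z. \<phi> (fst z) (fst (snd z)) (snd (snd z)))"
    and \<phi>a: "\<And>r y w k. r \<in> {0..1} \<Longrightarrow> y \<in> unit_square \<Longrightarrow> (\<And>j. j \<in> {1..n - 1} \<Longrightarrow> w \<noteq> H 0 y j) \<Longrightarrow>
         k \<in> {1..n - 1} \<Longrightarrow> \<phi> r y w \<noteq> H r y k"
    and \<phi>r: "\<And>r y w. r \<in> {0..1} \<Longrightarrow> y \<in> unit_square \<Longrightarrow> R \<le> cmod w \<Longrightarrow> \<phi> r y w = w"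
    using tr unfolding transport_def by blast+
  have H1: "H 1 (s, t) k = of_real (x k)" if "t \<in> {0..1}" "k \<in> {1..n - 1}" for s t k
    using that by (simp add: H_def h(2) base_conf_def) linarith
  \<comment> \<open>On these three sides the points are at rest throughout the run back. On the
    fourth side, \<open>s = 1\<close>, they begin and end at the base configuration but may move in
    between, which is the origin of the twist.\<close>
  have \<phi>f: "\<phi> 1 (s, t) w = w" if st: "s \<in> {0..1}" "t \<in> {0..1}" and or: "t = 0 \<or> t = 1 \<or> s = 0" for s t w
  proof (rule transport_fixes[OF tr])
    show "\<forall>r\<in>{0..1}. \<forall>k\<in>{1..n - 1}. H r (s, t) k = H 0 (s, t) k"
    proof (intro ballI)
      fix r :: real and k assume r: "r \<in> {0..1}"
      have m: "(1 - r) * s \<in> {0..1}" using sq[OF r, of "(s, t)"] st by simp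
      show "H r (s, t) k = H 0 (s, t) k"
        using or st h(4)[OF m] h(5)[OF m] h(4)[OF st(1)] h(5)[OF st(1)] by (auto simp: H_def)
    qed
  qed (use st in auto)
  have into: "\<phi> 1 y w \<in> ?S" if y: "y \<in> unit_square" and w: "\<And>j. j \<in> {1..n - 1} \<Longrightarrow> w \<noteq> h y j" for y w
  proof -
    have "\<phi> 1 y w \<noteq> of_real (x k)" if k: "k \<in> {1..n - 1}" for k
    proof -
      have "\<phi> 1 y w \<noteq> H 1 y k"
        using w by (intro \<phi>a[OF _ y _ k]) (auto simp: H_def)
      thus ?thesis using H1[of "snd y" k "fst y"] y k by auto
    qed
    thus ?thesis by (simp add: fibre_def)
  qed
  let ?\<theta> = "\<lambda>t. \<phi> 1 (1, t)"
  have nn: "n \<in> {1..n}" using n by simp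
  have "homotopic_paths ?S (\<lambda>_. ?b) (\<lambda>t. ?\<theta> t (g t))"
    unfolding homotopic_paths
  proof (intro exI[of _ "\<lambda>y. \<phi> 1 y (h y n)"] conjI ballI)
    have "continuous_on unit_square (\<lambda>y. (1::real, y, h y n))"
      by (intro continuous_intros hc[OF nn])
    from continuous_on_compose2[OF \<phi>c this]
    show "continuous_on unit_square (\<lambda>y. \<phi> 1 y (h y n))" by (simp add: image_subset_iff)
    show "(\<lambda>y. \<phi> 1 y (h y n)) \<in> unit_square \<rightarrow> ?S"
    proof
      fix y :: "real \<times> real" assume y: "y \<in> unit_square"
      show "\<phi> 1 y (h y n) \<in> ?S"
        using inj_onD[OF hi[OF y], of n] n by (intro into[OF y]) force
    qed
    fix t :: real assume t: "t \<in> {0..1}"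
    show "\<phi> 1 (0, t) (h (0, t) n) = ?b"
      using \<phi>f[of 0 t] t nn by (simp add: h(2) base_conf_def)
    show "\<phi> 1 (1, t) (h (1, t) n) = ?\<theta> t (g t)"
      using nn by (simp add: h(3)[OF t] fibre_incl_def)
    show "pathstart ((\<lambda>y. \<phi> 1 y (h y n)) \<circ> Pair t) = pathstart (\<lambda>_. ?b)"
      using \<phi>f[of t 0] t nn by (simp add: h(4) base_conf_def pathstart_def)
    show "pathfinish ((\<lambda>y. \<phi> 1 y (h y n)) \<circ> Pair t) = pathfinish (\<lambda>_. ?b)"
      using \<phi>f[of t 1] t nn by (simp add: h(5) base_conf_def pathfinish_def)
  qed
  also have "homotopic_paths ?S \<dots> g"
  proof (rule twisted_loop_homotopic[OF g, of _ R])
    have "continuous_on ({0..1} \<times> UNIV) (\<lambda>z :: real \<times> complex. (1::real, (1::real, fst z), snd z))"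
      by (intro continuous_intros)
    from continuous_on_compose2[OF \<phi>c this]
    show "continuous_on ({0..1} \<times> UNIV) (\<lambda>z. ?\<theta> (fst z) (snd z))"
      by (simp add: image_subset_iff)
    fix t :: real and w assume t: "t \<in> {0..1}"
    show "?\<theta> t w \<in> ?S" if w: "w \<in> ?S"
      using t w by (intro into) (auto simp: h(3) fibre_def fibre_incl_def)
    show "?\<theta> t w = w" if "R \<le> cmod w" using \<phi>r t that by simp
  next
    show "?\<theta> 0 w = w" "?\<theta> 1 w = w" for w by (rule \<phi>f; simp)+
  qed
  finally show ?thesis .
qed

section \<open>The fundamental group of the fibre as the kernel\<close>

abbreviation "\<F> \<equiv> fundamental_group (top_of_set (fibre n x)) (complex_of_real (x n))"
abbreviation "\<J> \<equiv> induced_hom (PB n) (base_conf n x) (fibre_incl n x)"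

lemma group_pure_braid_group: "group (pure_braid_group n x)"
  unfolding pure_braid_group_def by (rule group_fundamental_group[OF base_conf_in_PB[OF x]])

lemma fibre_hom: "\<J> \<in> hom \<F> (pure_braid_group n x)"
  using induced_hom_hom[OF continuous_fibre_incl, of "of_real (x n)"]
  by (simp add: fibre_incl_base pure_braid_group_def)

lemma fibre_hom_class:
  "pth (fibre n x) g (of_real (x n)) (of_real (x n)) \<Longrightarrow>
     \<J> (loop_class (top_of_set (fibre n x)) (of_real (x n)) g) =
     loop_class (PB n) (base_conf n x) (fibre_incl n x \<circ> g)"
  using induced_hom_loop_class[OF continuous_fibre_incl, of "of_real (x n)" g]
  by (simp add: fibre_incl_base loop_in_iff_pth)

lemma loop_in_fibre_incl:
  "pth (fibre n x) g (of_real (x n)) (of_real (x n)) \<Longrightarrow> loop_in (PB n) (base_conf n x) (fibre_incl n x \<circ> g)"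
  using loop_in_compose[OF continuous_fibre_incl, of "of_real (x n)" g]
  by (simp add: fibre_incl_base loop_in_iff_pth)

lemma fibre_hom_inj: "inj_on \<J> (carrier \<F>)"
proof -
  interpret F: pointed_subset "fibre n x" "complex_of_real (x n)"
    by unfold_locales (rule base_in_fibre)
  interpret group_hom \<F> "pure_braid_group n x" \<J>
    using fibre_hom F.group_axioms group_pure_braid_group by (simp add: group_hom_def group_hom_axioms_def)
  show ?thesis
  proof (rule trivial_ker_imp_inj)
    have "A = \<one>\<^bsub>\<F>\<^esub>" if A: "A \<in> carrier \<F>" "\<J> A = \<one>\<^bsub>pure_braid_group n x\<^esub>" for A
    proof -
      obtain g where g: "A = F.cls g" "pth (fibre n x) g (of_real (x n)) (of_real (x n))"
        using A(1) by (rule F.carrierE)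
      have "loop_class (PB n) (base_conf n x) (\<lambda>_. base_conf n x) = loop_class (PB n) (base_conf n x) (fibre_incl n x \<circ> g)"
        using A(2) fibre_hom_class[OF g(2)] by (simp add: g(1) pure_braid_group_def fundamental_group_def)
      hence "homotopic_paths (fibre n x) (\<lambda>_. of_real (x n)) g"
        using null_homotopic_in_fibre[OF g(2)] loop_class_eq_iff loop_in_const[OF base_conf_in_PB[OF x]] by metis
      thus ?thesis
        using F.cls_eq_iff[OF F.pth_const, of g] by (simp add: g(1) F.cls_one linepath_refl)
    qed
    thus "kernel \<F> (pure_braid_group n x) \<J> = {\<one>\<^bsub>\<F>\<^esub>}" by (auto simp: kernel_def)
  qed
qed

lemma fibre_hom_image:
  "\<J> ` carrier \<F> = kernel (pure_braid_group n x) (pure_braid_group (n - 1) x) (forget_hom n x)"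
proof -
  interpret F: pointed_subset "fibre n x" "complex_of_real (x n)"
    by unfold_locales (rule base_in_fibre)
  let ?f = "\<lambda>z. restrict z {1..n - 1} :: nat \<Rightarrow> complex"
  have forget: "forget_hom n x (loop_class (PB n) (base_conf n x) p) = loop_class (PB (n - 1)) (base_conf (n - 1) x) (?f \<circ> p)"
    if "loop_in (PB n) (base_conf n x) p" for p
    using induced_hom_loop_class[OF continuous_map_forget_last that]
    unfolding forget_hom_def restrict_base_conf .
  have one: "\<one>\<^bsub>pure_braid_group (n - 1) x\<^esub> = loop_class (PB (n - 1)) (base_conf (n - 1) x) (\<lambda>_. base_conf (n - 1) x)"
    by (simp add: pure_braid_group_def fundamental_group_def)
  show ?thesis
  proof (intro equalityI subsetI)
    fix A assume "A \<in> \<J> ` carrier \<F>"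
    then obtain g where g: "A = \<J> (F.cls g)" "pth (fibre n x) g (of_real (x n)) (of_real (x n))"
      by (blast elim: F.carrierE)
    have "?f \<circ> (fibre_incl n x \<circ> g) = (\<lambda>_. base_conf (n - 1) x)"
      by (auto simp: fun_eq_iff fibre_incl_def base_conf_def)
    hence "forget_hom n x A = \<one>\<^bsub>pure_braid_group (n - 1) x\<^esub>"
      unfolding g(1) fibre_hom_class[OF g(2)] forget[OF loop_in_fibre_incl[OF g(2)]] one by simp
    moreover have "A \<in> carrier (pure_braid_group n x)"
      unfolding g(1) using hom_in_carrier[OF fibre_hom F.cls_closed[OF g(2)]] .
    ultimately show "A \<in> kernel (pure_braid_group n x) (pure_braid_group (n - 1) x) (forget_hom n x)"
      by (simp add: kernel_def)
  next
    fix A assume "A \<in> kernel (pure_braid_group n x) (pure_braid_group (n - 1) x) (forget_hom n x)"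
    then obtain p where p: "A = loop_class (PB n) (base_conf n x) p" "loop_in (PB n) (base_conf n x) p"
      "forget_hom n x A = \<one>\<^bsub>pure_braid_group (n - 1) x\<^esub>"
      by (auto simp: kernel_def pure_braid_group_def fundamental_group_def)
    have "loop_in (PB (n - 1)) (base_conf (n - 1) x) (?f \<circ> p)"
      using loop_in_compose[OF continuous_map_forget_last p(2)] unfolding restrict_base_conf .
    hence "loop_homotopic (PB (n - 1)) (base_conf (n - 1) x) (?f \<circ> p) (\<lambda>_. base_conf (n - 1) x)"
      using p(3) unfolding p(1) forget[OF p(2)] one by (simp add: loop_class_eq_iff)
    then obtain q where q: "pth (fibre n x) q (of_real (x n)) (of_real (x n))"
        "loop_homotopic (PB n) (base_conf n x) p (fibre_incl n x \<circ> q)"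
      using deform_into_fibre[OF p(2)] unfolding o_def by blast
    have "A = \<J> (F.cls q)"
      using q(2) unfolding fibre_hom_class[OF q(1)] p(1) by (simp add: loop_class_eq_iff[OF p(2)])
    thus "A \<in> \<J> ` carrier \<F>" using F.cls_closed[OF q(1)] by blast
  qed
qed

end

section \<open>The covering of unordered by ordered configurations\<close>

lemma permute_in_PB:
  assumes "z \<in> topspace (PB n)" "\<pi> permutes {1..n}"
  shows "z \<circ> \<pi> \<in> topspace (PB n)"
proof -
  have "inj_on (z \<circ> \<pi>) {1..n}"
    using assms by (intro comp_inj_on) (auto simp: topspace_PB permutes_inj_on permutes_image)
  moreover have "z \<circ> \<pi> \<in> extensional {1..n}"
    using assms by (auto simp: topspace_PB extensional_def permutes_not_in)
  ultimately show ?thesis by (simp add: topspace_PB)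
qed

lemma continuous_map_PB_proj: "k \<in> {1..n} \<Longrightarrow> continuous_map (PB n) euclidean (\<lambda>z. z k)"
  by (auto simp: PB_def intro!: continuous_map_from_subtopology continuous_map_product_projection)

lemma continuous_map_permute:
  assumes "\<pi> permutes {1..n}"
  shows "continuous_map (PB n) (PB n) (\<lambda>z. z \<circ> \<pi>)"
proof -
  have "continuous_map (PB n) euclidean (\<lambda>z. (z \<circ> \<pi>) k)" if "k \<in> {1..n}" for k
    using continuous_map_PB_proj[of "\<pi> k" n] permutes_in_image[OF assms] that by simp
  moreover have "z \<circ> \<pi> \<in> {z \<in> extensional {1..n}. inj_on z {1..n}}" if "z \<in> topspace (PB n)" for z
    using permute_in_PB[OF that assms] unfolding topspace_PB .
  ultimately show ?thesis
    unfolding PB_def[of n] continuous_map_in_subtopology continuous_map_componentwise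
    unfolding PB_def[of n, symmetric]
    by (auto simp: image_subset_iff)
qed

lemma orbit_map_eqD: "orbit_map n z = orbit_map n w \<Longrightarrow> \<exists>\<pi>. \<pi> permutes {1..n} \<and> w = z \<circ> \<pi>"
proof -
  assume eq: "orbit_map n z = orbit_map n w"
  have "w \<in> orbit_map n w"
    unfolding orbit_map_def by (auto intro!: exI[of _ id] permutes_id)
  thus ?thesis unfolding eq[symmetric] by (auto simp: orbit_map_def)
qed

text \<open>The preimage of the image is the union of the permuted copies of \<open>W\<close>, and
  permuting coordinates is continuous.\<close>

lemma open_orbit_map:
  assumes W: "openin (PB n) W"
  shows "openin (UB n) (orbit_map n ` W)"
proof -
  have "{z \<in> topspace (PB n). orbit_map n z \<in> orbit_map n ` W} =
      (\<Union>\<pi>\<in>{\<pi>. \<pi> permutes {1..n}}. {z \<in> topspace (PB n). z \<circ> \<pi> \<in> W})"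
  proof (intro equalityI subsetI)
    fix z assume "z \<in> {z \<in> topspace (PB n). orbit_map n z \<in> orbit_map n ` W}"
    then obtain w where "z \<in> topspace (PB n)" "w \<in> W" "orbit_map n z = orbit_map n w" by auto
    thus "z \<in> (\<Union>\<pi>\<in>{\<pi>. \<pi> permutes {1..n}}. {z \<in> topspace (PB n). z \<circ> \<pi> \<in> W})"
      using orbit_map_eqD[of n z w] by blast
  next
    fix z assume "z \<in> (\<Union>\<pi>\<in>{\<pi>. \<pi> permutes {1..n}}. {z \<in> topspace (PB n). z \<circ> \<pi> \<in> W})"
    then obtain \<pi> where "\<pi> permutes {1..n}" "z \<in> topspace (PB n)" "z \<circ> \<pi> \<in> W" by blast
    thus "z \<in> {z \<in> topspace (PB n). orbit_map n z \<in> orbit_map n ` W}"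
      using orbit_map_permute[of \<pi> n z] by (intro CollectI conjI image_eqI[of _ _ "z \<circ> \<pi>"]) simp_all
  qed
  moreover have "openin (PB n) {z \<in> topspace (PB n). z \<circ> \<pi> \<in> W}" if "\<pi> permutes {1..n}" for \<pi>
    by (rule openin_continuous_map_preimage[OF continuous_map_permute[OF that] W])
  ultimately show ?thesis
    using openin_subset[OF W] unfolding UB_def openin_quotient_topology by auto
qed

text \<open>Let each point of \<open>z\<close> vary by less than \<open>d\<close>, where distinct
  points of \<open>z\<close> are at least \<open>2 * d\<close> apart. A permutation other than the
  identity cannot keep a configuration in this neighbourhood, so its permuted copies are disjoint;
  there is one section for each permutation.\<close>

lemma covering_orbit_map: "covering_of (PB n) (UB n) (orbit_map n)"
  unfolding covering_of_def
proof (intro conjI ballI continuous_map_orbit_map)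
  fix b assume "b \<in> topspace (UB n)"
  then obtain z where z: "z \<in> topspace (PB n)" "b = orbit_map n z"
    by (auto simp: UB_def topspace_quotient_topology)
  have "\<exists>d>0. \<forall>p\<in>{(k, l). k \<in> {1..n} \<and> l \<in> {1..n} \<and> k \<noteq> l}. 2 * d \<le> cmod (z (fst p) - z (snd p))"
  proof (rule finite_uniform_bound)
    show "finite {(k, l). k \<in> {1..n} \<and> l \<in> {1..n} \<and> k \<noteq> l}"
      by (rule finite_subset[of _ "{1..n} \<times> {1..n}"]) auto
    fix p assume "p \<in> {(k, l). k \<in> {1..n} \<and> l \<in> {1..n} \<and> k \<noteq> l}"
    then obtain k l where p: "p = (k, l)" "k \<in> {1..n}" "l \<in> {1..n}" "k \<noteq> l" by blast
    have "inj_on z {1..n}" using z(1) by (simp add: topspace_PB)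
    hence "z k \<noteq> z l" using p(2-4) by (meson inj_onD)
    hence "cmod (z (fst p) - z (snd p)) > 0" by (simp add: p(1))
    thus "\<exists>d>0. 2 * d \<le> cmod (z (fst p) - z (snd p))"
      by (intro exI[of _ "cmod (z (fst p) - z (snd p)) / 2"]) simp
  qed simp
  then obtain d where d: "d > 0" "\<And>k l. k \<in> {1..n} \<Longrightarrow> l \<in> {1..n} \<Longrightarrow> k \<noteq> l \<Longrightarrow> 2 * d \<le> cmod (z k - z l)"
    by force
  \<comment> \<open>For \<open>n = 0\<close> the intersection over the empty index set is the whole
    type, so the space itself is intersected as well.\<close>
  define V where "V = (\<Inter>k\<in>{1..n}. {w \<in> topspace (PB n). w k \<in> ball (z k) d}) \<inter> topspace (PB n)"
  have "openin (PB n) {w \<in> topspace (PB n). w k \<in> ball (z k) d}" if "k \<in> {1..n}" for k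
    by (rule openin_continuous_map_preimage[OF continuous_map_PB_proj[OF that]]) simp
  hence V: "openin (PB n) V"
    unfolding V_def by (cases "n = 0") (auto intro: openin_INT)
  have zV: "z \<in> V" using z(1) d(1) by (simp add: V_def)
  have VE: "w \<in> topspace (PB n)" if "w \<in> V" for w using that by (simp add: V_def)
  have Vd: "cmod (w k - z k) < d" if "w \<in> V" "k \<in> {1..n}" for w k
    using that by (simp add: V_def dist_norm norm_minus_commute)
  have permV: "\<pi> = id" if w: "w \<in> V" "w \<circ> \<pi> \<in> V" and \<pi>: "\<pi> permutes {1..n}" for w \<pi>
  proof
    fix k
    show "\<pi> k = id k"
    proof (cases "k \<in> {1..n}")
      case True
      hence \<pi>k: "\<pi> k \<in> {1..n}" using permutes_in_image[OF \<pi>] by simp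
      have "cmod (z (\<pi> k) - z k) \<le> cmod (w (\<pi> k) - z k) + cmod (w (\<pi> k) - z (\<pi> k))"
        using norm_triangle_ineq4[of "w (\<pi> k) - z k" "w (\<pi> k) - z (\<pi> k)"] by simp
      also have "\<dots> < 2 * d" using Vd[OF w(2) True] Vd[OF w(1) \<pi>k] by simp
      finally show ?thesis using d(2)[OF \<pi>k True] by (cases "\<pi> k = k") auto
    qed (use permutes_not_in[OF \<pi>] in simp)
  qed
  have inj: "inj_on (orbit_map n) V"
  proof (rule inj_onI)
    fix w v assume "w \<in> V" "v \<in> V" "orbit_map n w = orbit_map n v"
    thus "w = v" using orbit_map_eqD[of n w v] permV[of w] by (metis comp_id)
  qed
  define U where "U = orbit_map n ` V"
  define s where "s = inv_into V (orbit_map n)"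
  have U: "openin (UB n) U" unfolding U_def by (rule open_orbit_map[OF V])
  have sV: "s u \<in> V" "orbit_map n (s u) = u" if "u \<in> U" for u
    using that inv_into_into f_inv_into_f unfolding U_def s_def by metis+
  have s_orbit: "s (orbit_map n w) = w" if "w \<in> V" for w
    unfolding s_def using inj that by (rule inv_into_f_f)
  have s: "continuous_map (subtopology (UB n) U) (PB n) s"
    unfolding continuous_map_def
  proof (intro conjI allI impI)
    show "s \<in> topspace (subtopology (UB n) U) \<rightarrow> topspace (PB n)"
      using sV VE by auto
    fix W assume "openin (PB n) W"
    hence "openin (UB n) (orbit_map n ` (V \<inter> W))"
      using V by (intro open_orbit_map) auto
    moreover have "{u \<in> topspace (subtopology (UB n) U). s u \<in> W} = orbit_map n ` (V \<inter> W)"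
    proof (intro equalityI subsetI)
      fix u assume "u \<in> {u \<in> topspace (subtopology (UB n) U). s u \<in> W}"
      hence "u \<in> U" "s u \<in> W" by auto
      thus "u \<in> orbit_map n ` (V \<inter> W)" using sV[of u] by (metis IntI imageI)
    next
      fix u assume "u \<in> orbit_map n ` (V \<inter> W)"
      then obtain w where "w \<in> V" "w \<in> W" "u = orbit_map n w" by blast
      thus "u \<in> {u \<in> topspace (subtopology (UB n) U). s u \<in> W}"
        using s_orbit openin_subset[OF U] by (auto simp: U_def)
    qed
    moreover have "orbit_map n ` (V \<inter> W) \<subseteq> U" by (auto simp: U_def)
    ultimately show "openin (subtopology (UB n) U) {u \<in> topspace (subtopology (UB n) U). s u \<in> W}"
      by (metis openin_open_subtopology U)
  qed
  have "even_cover (PB n) (UB n) (orbit_map n) U {\<lambda>u. s u \<circ> \<pi> |\<pi>. \<pi> permutes {1..n}}"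
    unfolding even_cover_def
  proof (intro conjI ballI impI)
    fix \<sigma> assume "\<sigma> \<in> {\<lambda>u. s u \<circ> \<pi> |\<pi>. \<pi> permutes {1..n}}"
    then obtain \<pi> where \<pi>: "\<sigma> = (\<lambda>u. s u \<circ> \<pi>)" "\<pi> permutes {1..n}" by blast
    show "continuous_map (subtopology (UB n) U) (PB n) \<sigma>"
      unfolding \<pi>(1) using continuous_map_compose[OF s continuous_map_permute[OF \<pi>(2)]] by (simp add: o_def)
    note inv = permutes_inv[OF \<pi>(2)] permutes_inv_o[OF \<pi>(2)]
    have "\<sigma> ` U = {v \<in> topspace (PB n). v \<circ> inv_into UNIV \<pi> \<in> V}"
    proof (intro equalityI subsetI)
      fix v assume "v \<in> \<sigma> ` U"
      then obtain u where u: "u \<in> U" "v = s u \<circ> \<pi>" by (auto simp: \<pi>(1))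
      hence "v \<circ> inv_into UNIV \<pi> = s u" using inv(2) by (simp add: comp_assoc)
      thus "v \<in> {v \<in> topspace (PB n). v \<circ> inv_into UNIV \<pi> \<in> V}"
        using u sV(1)[OF u(1)] permute_in_PB[OF VE \<pi>(2)] by auto
    next
      fix v assume v: "v \<in> {v \<in> topspace (PB n). v \<circ> inv_into UNIV \<pi> \<in> V}"
      have "v = (v \<circ> inv_into UNIV \<pi>) \<circ> \<pi>" using inv(3) by (simp add: comp_assoc)
      thus "v \<in> \<sigma> ` U"
        using v s_orbit[of "v \<circ> inv_into UNIV \<pi>"] unfolding \<pi>(1) U_def by (intro image_eqI[of _ _ "orbit_map n (v \<circ> inv_into UNIV \<pi>)"]) auto
    qed
    thus "openin (PB n) (\<sigma> ` U)"
      using openin_continuous_map_preimage[OF continuous_map_permute[OF inv(1)] V] by simp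
    show "orbit_map n (\<sigma> u) = u" if "u \<in> U" for u
      using sV(2)[OF that] by (simp add: \<pi>(1) orbit_map_permute[OF \<pi>(2)])
    fix \<tau> u assume "\<tau> \<in> {\<lambda>u. s u \<circ> \<pi> |\<pi>. \<pi> permutes {1..n}}" and u: "u \<in> U" and eq: "\<sigma> u = \<tau> u"
    then obtain \<rho> where \<rho>: "\<tau> = (\<lambda>u. s u \<circ> \<rho>)" "\<rho> permutes {1..n}" by blast
    have "\<pi> k = \<rho> k" for k
    proof (cases "k \<in> {1..n}")
      case True
      have "s u (\<pi> k) = s u (\<rho> k)"
        using fun_cong[OF eq, of k] by (simp add: \<pi>(1) \<rho>(1))
      moreover have "inj_on (s u) {1..n}" using VE[OF sV(1)[OF u]] by (simp add: topspace_PB)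
      moreover have "\<pi> k \<in> {1..n}" "\<rho> k \<in> {1..n}"
        using True permutes_in_image[OF \<pi>(2)] permutes_in_image[OF \<rho>(2)] by blast+
      ultimately show ?thesis by (meson inj_onD)
    qed (use permutes_not_in[OF \<pi>(2)] permutes_not_in[OF \<rho>(2)] in simp)
    hence "\<pi> = \<rho>" by blast
    thus "\<sigma> = \<tau>" by (simp add: \<pi>(1) \<rho>(1))
  next
    fix e assume e: "e \<in> topspace (PB n)" "orbit_map n e \<in> U"
    then obtain w where w: "w \<in> V" "orbit_map n w = orbit_map n e" by (auto simp: U_def)
    then obtain \<pi> where \<pi>: "\<pi> permutes {1..n}" "e = w \<circ> \<pi>" using orbit_map_eqD by blast
    have "s (orbit_map n e) = w" using s_orbit[OF w(1)] w(2) by metis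
    hence "(\<lambda>u. s u \<circ> \<pi>) (orbit_map n e) = e" using \<pi>(2) by metis
    thus "\<exists>\<sigma>\<in>{\<lambda>u. s u \<circ> \<pi> |\<pi>. \<pi> permutes {1..n}}. \<sigma> (orbit_map n e) = e"
      by (intro bexI[of _ "\<lambda>u. s u \<circ> \<pi>"]) (use \<pi>(1) in blast)+
  qed (rule U)
  moreover have "b \<in> U" using zV z(2) by (simp add: U_def)
  ultimately show "\<exists>U S. b \<in> U \<and> even_cover (PB n) (UB n) (orbit_map n) U S" by blast
qed

lemma pure_incl_class:
  "loop_in (PB n) (base_conf n x) p \<Longrightarrow>
     pure_incl n x (loop_class (PB n) (base_conf n x) p) =
     loop_class (UB n) (orbit_map n (base_conf n x)) (orbit_map n \<circ> p)"
  unfolding pure_incl_def by (rule induced_hom_loop_class[OF continuous_map_orbit_map])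

text \<open>A homotopy between the projected loops lifts to the covering with fixed ends. This gives
  the inverse taken in \<open>pure_gen\<close> its meaning.\<close>

lemma inj_pure_incl: "inj_on (pure_incl n x) (carrier (pure_braid_group n x))"
proof (rule inj_onI)
  fix P Q assume "P \<in> carrier (pure_braid_group n x)" "Q \<in> carrier (pure_braid_group n x)"
  then obtain p q where p: "P = loop_class (PB n) (base_conf n x) p" "loop_in (PB n) (base_conf n x) p"
    and q: "Q = loop_class (PB n) (base_conf n x) q" "loop_in (PB n) (base_conf n x) q"
    by (auto simp: pure_braid_group_def fundamental_group_def)
  assume eq: "pure_incl n x P = pure_incl n x Q"
  have hom: "loop_homotopic (UB n) (orbit_map n (base_conf n x)) (orbit_map n \<circ> p) (orbit_map n \<circ> q)"
    using eq loop_in_compose[OF continuous_map_orbit_map p(2)]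
    unfolding p(1) q(1) pure_incl_class[OF p(2)] pure_incl_class[OF q(2)]
    by (simp add: loop_class_eq_iff)
  note P = p(2)[unfolded loop_in_def] and Q = q(2)[unfolded loop_in_def]
  obtain h where h: "continuous_map (top_of_set unit_square) (PB n) h"
    "\<And>t. t \<in> {0..1} \<Longrightarrow> h (0, t) = p t" "\<And>t. t \<in> {0..1} \<Longrightarrow> h (1, t) = q t"
    "\<And>s. s \<in> {0..1} \<Longrightarrow> h (s, 0) = p 0" "\<And>s. s \<in> {0..1} \<Longrightarrow> h (s, 1) = p 1"
    by (rule lift_loop_homotopy[OF covering_orbit_map hom, of p q]) (use P Q in auto)
  have "loop_homotopic (PB n) (base_conf n x) p q"
    by (rule loop_homotopicI[OF h(1-3)]) (use h P in auto)
  thus "P = Q" unfolding p(1) q(1) by (simp add: loop_class_eq_iff[OF p(2)])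
qed

section \<open>Straight-line homotopies of configurations\<close>

text \<open>This is the condition under which the straight-line homotopy between the two
  configurations has no collision: no difference of two points passes through 0 on its way.\<close>

definition apart :: "nat \<Rightarrow> (nat \<Rightarrow> complex) \<Rightarrow> (nat \<Rightarrow> complex) \<Rightarrow> bool" where
  "apart n u v \<longleftrightarrow> (\<forall>k\<in>{1..n}. \<forall>l\<in>{1..n}. k < l \<longrightarrow> 0 \<notin> closed_segment (u k - u l) (v k - v l))"

lemma apart_homotopic:
  assumes p: "loop_in (PB n) b p" and q: "loop_in (PB n) b q"
    and apart: "\<And>t. t \<in> {0..1} \<Longrightarrow> apart n (p t) (q t)"
  shows "loop_homotopic (PB n) b p q"
proof (rule loop_homotopicI)
  let ?G = "\<lambda>z. \<lambda>k\<in>{1..n}. (1 - fst z) *\<^sub>R p (snd z) k + fst z *\<^sub>R q (snd z) k"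
  have P: "continuous_on {0..1} (\<lambda>t. p t k)" "continuous_on {0..1} (\<lambda>t. q t k)" if "k \<in> {1..n}" for k
    using p q that unfolding loop_in_def pathin_def continuous_map_PB_iff by blast+
  have e: "p t \<in> extensional {1..n}" "q t \<in> extensional {1..n}" if "t \<in> {0..1}" for t
    using p q that unfolding loop_in_def pathin_def continuous_map_PB_iff by blast+
  show "continuous_map (top_of_set unit_square) (PB n) ?G"
    unfolding continuous_map_PB_iff
  proof (intro conjI ballI)
    fix k assume k: "k \<in> {1..n}"
    have "continuous_on unit_square (\<lambda>z. (1 - fst z) *\<^sub>R p (snd z) k + fst z *\<^sub>R q (snd z) k)"
      by (intro continuous_intros continuous_on_compose2[OF P(1)[OF k]] continuous_on_compose2[OF P(2)[OF k]]) auto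
    thus "continuous_on unit_square (\<lambda>z. ?G z k)" using k by simp
  next
    fix z :: "real \<times> real" assume z: "z \<in> unit_square"
    have ne: "?G z k \<noteq> ?G z l" if kl: "k \<in> {1..n}" "l \<in> {1..n}" "k < l" for k l
    proof
      assume "?G z k = ?G z l"
      hence "(1 - fst z) *\<^sub>R (p (snd z) k - p (snd z) l) + fst z *\<^sub>R (q (snd z) k - q (snd z) l) = 0"
        using kl by (simp add: algebra_simps)
      hence "0 \<in> closed_segment (p (snd z) k - p (snd z) l) (q (snd z) k - q (snd z) l)"
        unfolding closed_segment_def using z by (intro CollectI exI[of _ "fst z"]) (auto simp: eq_commute[of 0])
      thus False using apart[of "snd z"] z kl unfolding apart_def by auto
    qed
    show "inj_on (?G z) {1..n}"
    proof (rule inj_onI)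
      fix k l assume "k \<in> {1..n}" "l \<in> {1..n}" "?G z k = ?G z l"
      thus "k = l" using ne[of k l] ne[of l k] by (metis linorder_neqE_nat)
    qed
  qed simp
  have b: "p 0 = b" "q 0 = b" "p 1 = b" "q 1 = b" using p q by (auto simp: loop_in_def)
  have "b \<in> extensional {1..n}" using e(1)[of 0] b by simp
  hence B: "(\<lambda>k\<in>{1..n}. (1 - s) *\<^sub>R b k + s *\<^sub>R b k) = b" for s :: real
    by (auto simp: fun_eq_iff extensional_def algebra_simps)
  fix t :: real assume t: "t \<in> {0..1}"
  show "?G (0, t) = p t" "?G (1, t) = q t"
    using e[OF t] by (auto simp: fun_eq_iff extensional_def)
  show "?G (t, 0) = b" "?G (t, 1) = b" using B[of t] by (simp_all only: b fst_conv snd_conv)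
qed

text \<open>Both ends lie in the open half-plane with inner normal \<open>cnj c\<close>, which is
  convex and misses 0.\<close>

lemma segment_half_plane:
  assumes "Re (c * v) > 0" "Re (c * w) > 0"
  shows "0 \<notin> closed_segment v w"
proof
  assume "0 \<in> closed_segment v w"
  then obtain s where s: "0 \<le> s" "s \<le> 1" "0 = (1 - s) *\<^sub>R v + s *\<^sub>R w" by (auto simp: closed_segment_def)
  have "0 = Re (c * ((1 - s) *\<^sub>R v + s *\<^sub>R w))" using s(3) by simp
  also have "\<dots> = (1 - s) * Re (c * v) + s * Re (c * w)" by (simp add: algebra_simps)
  also have "\<dots> > 0"
  proof (cases "s = 0")
    case False
    hence "s * Re (c * w) > 0" using s assms by simp
    thus ?thesis using s assms by (intro add_nonneg_pos) auto
  qed (use assms in simp)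
  finally show False by simp
qed

text \<open>If \<open>v\<close> lies on the real axis, it is the only point of the segment there,
  and it is not 0. This boundary case occurs whenever a half twist begins or ends.\<close>

lemma segment_lower:
  assumes "Im v \<le> 0" "v \<noteq> 0" "Im w < 0"
  shows "0 \<notin> closed_segment v w"
proof
  assume "0 \<in> closed_segment v w"
  then obtain s where s: "0 \<le> s" "s \<le> 1" "0 = (1 - s) *\<^sub>R v + s *\<^sub>R w" by (auto simp: closed_segment_def)
  have "0 = (1 - s) * Im v + s * Im w" using arg_cong[OF s(3), of Im] by simp
  moreover have "(1 - s) * Im v \<le> 0" using s assms by (simp add: mult_nonneg_nonpos)
  moreover have "s * Im w < 0" if "s > 0" using that assms by (simp add: mult_pos_neg)
  ultimately have "s = 0" using s(1) by (cases "s > 0") auto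
  thus False using s(3) assms(2) by simp
qed

text \<open>The order of the real parts settles every pair of strands that does not involve the last
  one.\<close>

lemma apart_fibre_incl:
  assumes o1: "\<And>k l. k \<in> {1..<n} \<Longrightarrow> l \<in> {1..<n} \<Longrightarrow> k < l \<Longrightarrow> Re (u k) < Re (u l)"
    and o2: "\<And>k l. k \<in> {1..<n} \<Longrightarrow> l \<in> {1..<n} \<Longrightarrow> k < l \<Longrightarrow> x k < x l"
    and z: "\<And>k. k \<in> {1..<n} \<Longrightarrow> 0 \<notin> closed_segment (u k - u n) (of_real (x k) - z)"
  shows "apart n u (fibre_incl n x z)"
  unfolding apart_def
proof (intro ballI impI)
  fix k l assume kl: "k \<in> {1..n}" "l \<in> {1..n}" "k < l"
  show "0 \<notin> closed_segment (u k - u l) (fibre_incl n x z k - fibre_incl n x z l)"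
  proof (cases "l = n")
    case True
    thus ?thesis using z[of k] kl by (simp add: fibre_incl_def)
  next
    case False
    thus ?thesis
      using kl o1[of k l] o2[of k l]
      by (intro segment_half_plane[of "-1"]) (auto simp: fibre_incl_def)
  qed
qed


section \<open>Lifting the braid words\<close>

context group
begin

lemma list_mult_closed: "set xs \<subseteq> carrier G \<Longrightarrow> list_mult G xs \<in> carrier G"
  by (induction xs) (auto simp: list_mult_def)

lemma list_mult_append:
  "set xs \<subseteq> carrier G \<Longrightarrow> set ys \<subseteq> carrier G \<Longrightarrow> list_mult G (xs @ ys) = list_mult G xs \<otimes> list_mult G ys"
proof (induction xs)
  case Nil
  thus ?case using list_mult_closed by (simp add: list_mult_def)
next
  case (Cons a xs)
  thus ?case using list_mult_closed[of xs] list_mult_closed[of ys] by (simp add: list_mult_def m_assoc)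
qed

lemma list_mult_inv:
  "f ` set xs \<subseteq> carrier G \<Longrightarrow> list_mult G (map (\<lambda>k. inv f k) xs) = inv (list_mult G (map f (rev xs)))"
proof (induction xs)
  case (Cons a xs)
  have "list_mult G (map f (rev (a # xs))) = list_mult G (map f (rev xs)) \<otimes> f a"
    using Cons.prems by (simp add: list_mult_append) (simp add: list_mult_def)
  moreover have "list_mult G (map f (rev xs)) \<in> carrier G" using Cons.prems by (intro list_mult_closed) auto
  ultimately show ?case using Cons by (simp add: inv_mult_group) (simp add: list_mult_def)
qed (simp add: list_mult_def)

end

text \<open>The positions of the strands after the last strand has moved left to position \<open>j\<close>.\<close>
definition pos :: "nat \<Rightarrow> nat \<Rightarrow> nat \<Rightarrow> nat" where
  "pos n j k = (if k = n then j else if j \<le> k \<and> k < n then k + 1 else k)"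

lemma pos_n: "pos n n = id"
  by (auto simp: pos_def fun_eq_iff)

text \<open>A half twist ends at the base configuration composed with the transposition, so this
  takes the last strand one position further to the left.\<close>

lemma pos_step: "j < n \<Longrightarrow> Transposition.transpose j (j + 1) \<circ> pos n (j + 1) = pos n j"
  by (auto simp: pos_def fun_eq_iff Transposition.transpose_def)

lemma transpose_pos: "j < n \<Longrightarrow> Transposition.transpose j (j + 1) \<circ> pos n j = pos n (j + 1)"
  by (auto simp: pos_def fun_eq_iff Transposition.transpose_def)

lemma pos_permutes: "1 \<le> j \<Longrightarrow> j \<le> n \<Longrightarrow> pos n j permutes {1..n}"
proof (induction "n - j" arbitrary: j)
  case 0
  thus ?case using pos_n[of n] permutes_id by (metis diff_is_0_eq le_antisym)
next
  case (Suc d)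
  hence "pos n (j + 1) permutes {1..n}" by (intro Suc.hyps(1)) auto
  moreover have "Transposition.transpose j (j + 1) permutes {1..n}"
    using Suc by (intro permutes_swap_id) auto
  ultimately show ?case
    using pos_step[of j n] Suc permutes_compose by (metis diff_is_0_eq' not_less nat.distinct(1))
qed

text \<open>
  While strands \<open>i\<close> and \<open>n\<close> rotate about each other, the strands between them wait one
  position to the right of their own.
\<close>
definition twisted :: "nat \<Rightarrow> (nat \<Rightarrow> real) \<Rightarrow> nat \<Rightarrow> complex \<Rightarrow> (nat \<Rightarrow> complex) \<Rightarrow> bool" where
  "twisted n x i w u \<longleftrightarrow>
     u n = of_real ((x i + x (i + 1)) / 2) + w \<and> u i = of_real ((x i + x (i + 1)) / 2) - w \<and>
     (\<forall>k\<in>{1..<i}. u k = of_real (x k)) \<and> (\<forall>k\<in>{i<..<n}. u k = of_real (x (k + 1)))"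

definition half_arc :: "(nat \<Rightarrow> real) \<Rightarrow> nat \<Rightarrow> real \<Rightarrow> complex" where
  "half_arc x i t = of_real ((x (i + 1) - x i) / 2) * cis (pi * t)"

text \<open>In the first of the two half twists the last strand starts at position
  \<open>i + 1\<close>. In the second it starts at position \<open>i\<close>, where its displacement
  from the midpoint has the opposite sign.\<close>

lemma twisted_right:
  "1 \<le> i \<Longrightarrow> i < n \<Longrightarrow> twisted n x i (half_arc x i t) (half_twist n x i t \<circ> pos n (i + 1))"
  by (auto simp: twisted_def half_arc_def half_twist_def pos_def base_conf_def Let_def)

lemma twisted_left:
  "1 \<le> i \<Longrightarrow> i < n \<Longrightarrow> twisted n x i (- half_arc x i t) (half_twist n x i t \<circ> pos n i)"
  by (auto simp: twisted_def half_arc_def half_twist_def pos_def base_conf_def Let_def)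

lemma pathin_comp_permute:
  "pathin (PB n) p \<Longrightarrow> \<pi> permutes {1..n} \<Longrightarrow> pathin (PB n) (\<lambda>t. p t \<circ> \<pi>)"
  using continuous_map_compose[OF _ continuous_map_permute] by (auto simp: pathin_def o_def)

lemma loop_join_comp: "f \<circ> loop_join p q = loop_join (f \<circ> p) (f \<circ> q)"
  by (auto simp: loop_join_def fun_eq_iff)

lemma loop_rev_comp: "f \<circ> loop_rev p = loop_rev (f \<circ> p)"
  by (auto simp: loop_rev_def fun_eq_iff)

lemma loop_join_0: "loop_join p q 0 = p 0" and loop_join_1: "loop_join p q 1 = q 1"
  by (simp_all add: loop_join_def)

lemma loop_join_pointwise:
  assumes "\<And>t. t \<in> {0..1} \<Longrightarrow> P (p t) (q t)" "\<And>t. t \<in> {0..1} \<Longrightarrow> P (p' t) (q' t)" "t \<in> {0..1}"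
  shows "P (loop_join p p' t) (loop_join q q' t)"
  using assms(1)[of "2 * t"] assms(2)[of "2 * t - 1"] assms(3) by (auto simp: loop_join_def)

text \<open>The inequalities for imaginary parts are weak because all points are real when a half
  twist begins or ends; \<open>apart_passing\<close> compensates by a strict inequality for the
  lasso.\<close>

definition passing :: "nat \<Rightarrow> (nat \<Rightarrow> complex) \<Rightarrow> bool" where
  "passing n u \<longleftrightarrow> Im (u n) \<ge> 0 \<and> (\<forall>k\<in>{1..<n}. Im (u k) \<le> 0) \<and>
     (\<forall>k\<in>{1..<n}. \<forall>l\<in>{1..<n}. k < l \<longrightarrow> Re (u k) < Re (u l))"

context
  fixes n :: nat and x :: "nat \<Rightarrow> real"
  assumes n: "n \<ge> 2" and x: "strict_mono_on {1..n} x"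
begin

lemma points_le: "i \<in> {1..n} \<Longrightarrow> j \<in> {1..n} \<Longrightarrow> i \<le> j \<Longrightarrow> x i \<le> x j"
  using points_less[OF n x, of i j] by (cases "i = j") auto

lemma half_arc_bounds:
  assumes "i \<in> {1..<n}"
  shows "\<bar>Re (half_arc x i t)\<bar> \<le> (x (i + 1) - x i) / 2" "cmod (half_arc x i t) = (x (i + 1) - x i) / 2"
proof -
  have "x i < x (i + 1)" using points_less[OF n x, of i "i + 1"] assms by auto
  thus c: "cmod (half_arc x i t) = (x (i + 1) - x i) / 2"
    by (simp add: half_arc_def norm_mult del: of_real_divide of_real_diff)
  show "\<bar>Re (half_arc x i t)\<bar> \<le> (x (i + 1) - x i) / 2" using abs_Re_le_cmod[of "half_arc x i t"] c by simp
qed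

text \<open>The real part of strand \<open>i\<close> stays between \<open>x i\<close> and
  \<open>x (i + 1)\<close>, while the strands to its right have made room by moving one position on,
  to \<open>x (i + 2)\<close> or beyond.\<close>

lemma twisted_ordered:
  assumes i: "i \<in> {1..<n}" and u: "twisted n x i w u" and w: "\<bar>Re w\<bar> \<le> (x (i + 1) - x i) / 2"
    and kl: "k \<in> {1..<n}" "l \<in> {1..<n}" "k < l"
  shows "Re (u k) < Re (u l)"
proof -
  have "Re (u i) = (x i + x (i + 1)) / 2 - Re w" using u by (simp add: twisted_def)
  hence ui: "x i \<le> Re (u i)" "Re (u i) \<le> x (i + 1)" using w by (auto simp: abs_le_iff field_simps)
  have *: "Re (u j) = (if j < i then x j else x (j + 1))" if "j \<in> {1..<n}" "j \<noteq> i" for j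
    using u that by (auto simp: twisted_def)
  consider "k = i" | "l = i" | "k \<noteq> i" "l \<noteq> i" by blast
  thus ?thesis
  proof cases
    case 1
    thus ?thesis using *[OF kl(2)] kl ui points_less[OF n x, of "i + 1" "l + 1"] by auto
  next
    case 2
    thus ?thesis using *[OF kl(1)] kl ui points_less[OF n x, of k i] by auto
  next
    case 3
    thus ?thesis
      using *[OF kl(1)] *[OF kl(2)] kl points_less[OF n x, of k l] points_less[OF n x, of k "l + 1"]
        points_less[OF n x, of "k + 1" "l + 1"] by auto
  qed
qed

text \<open>Seen from strand \<open>i\<close>, the last strand lies in direction \<open>w\<close> in
  both configurations. For every other strand the real parts decide: in both configurations the last
  strand is on the same side of it.\<close>

lemma apart_twisted:
  assumes i: "i \<in> {1..<n}" and u: "twisted n x i w u" and w: "cmod w = (x (i + 1) - x i) / 2"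
    and z: "z = of_real (x i) + of_real a * w" and a: "a > 0"
    and near: "\<And>k. k \<in> {1..n} \<Longrightarrow> k \<noteq> i \<Longrightarrow> a * cmod w < \<bar>x k - x i\<bar>"
  shows "apart n u (fibre_incl n x z)"
proof (rule apart_fibre_incl)
  have Rew: "\<bar>Re w\<bar> \<le> (x (i + 1) - x i) / 2" using abs_Re_le_cmod[of w] w by simp
  show "Re (u k) < Re (u l)" if "k \<in> {1..<n}" "l \<in> {1..<n}" "k < l" for k l
    using twisted_ordered[OF i u Rew] that by blast
  show "x k < x l" if "k \<in> {1..<n}" "l \<in> {1..<n}" "k < l" for k l
    using points_less[OF n x, of k l] that by auto
  have lt: "x i < x (i + 1)" using points_less[OF n x, of i "i + 1"] i by auto
  fix k assume k: "k \<in> {1..<n}"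
  have "Re (u n) = (x i + x (i + 1)) / 2 + Re w" using u by (simp add: twisted_def)
  hence un: "x i \<le> Re (u n)" "Re (u n) \<le> x (i + 1)" using Rew by (auto simp: abs_le_iff field_simps)
  have Rez: "\<bar>Re z - x i\<bar> < \<bar>x k - x i\<bar>" if "k \<noteq> i"
  proof -
    have "\<bar>Re z - x i\<bar> = a * \<bar>Re w\<bar>" using a by (simp add: z abs_mult)
    also have "\<dots> \<le> a * cmod w" using a abs_Re_le_cmod[of w] by simp
    finally show ?thesis using near[of k] k that by auto
  qed
  consider "k < i" | "k = i" | "i < k" by linarith
  thus "0 \<notin> closed_segment (u k - u n) (of_real (x k) - z)"
  proof cases
    case 1
    hence "Re (u k) = x k" using u k by (auto simp: twisted_def)
    moreover have "x k < x i" using points_less[OF n x, of k i] 1 i k by auto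
    ultimately show ?thesis using un Rez 1 by (intro segment_half_plane[of "-1"]) auto
  next
    case 2
    have "w \<noteq> 0" using w lt by auto
    hence pos: "Re (cnj w * w) > 0" by (simp add: complex_norm_square[symmetric] mult.commute)
    have "u k - u n = - (2 * w)" "of_real (x k) - z = - (of_real a * w)"
      using u 2 by (auto simp: twisted_def z)
    moreover have "Re (- cnj w * - (2 * w)) > 0" using pos by simp
    moreover have "Re (- cnj w * - (of_real a * w)) > 0"
    proof -
      have "- cnj w * - (of_real a * w) = a *\<^sub>R (cnj w * w)" by (simp add: scaleR_conv_of_real algebra_simps)
      thus ?thesis using mult_pos_pos[OF a pos] by (simp only: scaleR_complex.simps)
    qed
    ultimately show ?thesis using segment_half_plane[of "- cnj w"] by metis
  next
    case 3
    hence "Re (u k) = x (k + 1)" using u k by (auto simp: twisted_def)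
    moreover have "x (i + 1) < x (k + 1)" "x i < x k" using points_less[OF n x] 3 i k by auto
    ultimately show ?thesis using un Rez 3 by (intro segment_half_plane[of 1]) auto
  qed
qed

text \<open>Seen from the last strand, the others never rise above the horizontal in
  \<open>u\<close> and are strictly below it in the lasso. Injectivity provides the non-zero
  difference that \<open>segment_lower\<close> asks for.\<close>

lemma apart_passing:
  assumes u: "passing n u" "inj_on u {1..n}" and z: "Im z > 0"
  shows "apart n u (fibre_incl n x z)"
proof (rule apart_fibre_incl)
  fix k assume k: "k \<in> {1..<n}"
  have "u k \<noteq> u n" using inj_onD[OF u(2), of k n] k by auto
  moreover have "Im (u k) \<le> 0" "Im (u n) \<ge> 0" using u(1) k unfolding passing_def by blast+
  ultimately show "0 \<notin> closed_segment (u k - u n) (of_real (x k) - z)"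
    using z by (intro segment_lower) simp_all
next
  show "Re (u k) < Re (u l)" if "k \<in> {1..<n}" "l \<in> {1..<n}" "k < l" for k l
    using u(1) that unfolding passing_def by blast
  show "x k < x l" if "k \<in> {1..<n}" "l \<in> {1..<n}" "k < l" for k l
    using points_less[OF n x, of k l] that by auto
qed

section \<open>Lifting products of Artin generators\<close>

abbreviation "\<B> \<equiv> braid_group n x"
abbreviation "ucls \<equiv> loop_class (UB n) (orbit_map n (base_conf n x))"
abbreviation "uloop \<equiv> loop_in (UB n) (orbit_map n (base_conf n x))"

lemma orbit_base_in_UB: "orbit_map n (base_conf n x) \<in> topspace (UB n)"
  using base_conf_in_PB[OF x] by (auto simp: UB_def topspace_quotient_topology)

lemma group_braid_group: "group \<B>"
  unfolding braid_group_def by (rule group_fundamental_group[OF orbit_base_in_UB])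

lemma ucls_mult: "uloop p \<Longrightarrow> uloop q \<Longrightarrow> ucls p \<otimes>\<^bsub>\<B>\<^esub> ucls q = ucls (loop_join p q)"
  unfolding braid_group_def by (rule fundamental_group_mult)

lemma ucls_closed: "uloop p \<Longrightarrow> ucls p \<in> carrier \<B>"
  by (simp add: braid_group_def fundamental_group_def)

lemma ucls_inv: "uloop p \<Longrightarrow> inv\<^bsub>\<B>\<^esub> ucls p = ucls (loop_rev p)"
proof -
  assume p: "uloop p"
  have "ucls (loop_rev p) \<otimes>\<^bsub>\<B>\<^esub> ucls p = \<one>\<^bsub>\<B>\<^esub>"
    using loop_homotopic_rev_join[OF p] loop_class_eq_iff[OF loop_in_join[OF loop_in_rev[OF p] p]]
    by (simp add: ucls_mult[OF loop_in_rev[OF p] p]) (simp add: braid_group_def fundamental_group_def)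
  thus ?thesis
    using group.inv_equality[OF group_braid_group _ ucls_closed[OF p] ucls_closed[OF loop_in_rev[OF p]]] by simp
qed

lemma uloop_orbit:
  "pathin (PB n) p \<Longrightarrow> orbit_map n (p 0) = orbit_map n (base_conf n x) \<Longrightarrow>
     orbit_map n (p 1) = orbit_map n (base_conf n x) \<Longrightarrow> uloop (orbit_map n \<circ> p)"
  using continuous_map_compose[OF _ continuous_map_orbit_map] by (auto simp: loop_in_def pathin_def)

text \<open>In each step the last strand is at position \<open>j + 1\<close>, and a counterclockwise
  half twist takes it over the top to position \<open>j\<close>. Composition with
  \<open>pos n (j + 1)\<close> attaches the right labels to the positions and is invisible to
  \<open>orbit_map\<close>.\<close>

lemma approach_exists:
  assumes "1 \<le> j" "j \<le> n"
  shows "\<exists>\<rho>. pathin (PB n) \<rho> \<and> \<rho> 0 = base_conf n x \<and> \<rho> 1 = base_conf n x \<circ> pos n j \<and>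
     (\<forall>t\<in>{0..1}. passing n (\<rho> t)) \<and> ucls (orbit_map n \<circ> \<rho>) = list_mult \<B> (map (artin_gen n x) (rev [j..<n]))"
  using assms
proof (induction "n - j" arbitrary: j)
  case 0
  hence j: "j = n" by simp
  have "passing n (base_conf n x)" using points_less[OF n x] n by (auto simp: passing_def base_conf_def)
  moreover have "pathin (PB n) (\<lambda>_. base_conf n x)" using base_conf_in_PB[OF x] by (simp add: pathin_def)
  moreover have "ucls (orbit_map n \<circ> (\<lambda>_. base_conf n x)) = list_mult \<B> []"
    by (simp add: list_mult_def braid_group_def fundamental_group_def o_def)
  ultimately show ?case
    by (intro exI[of _ "\<lambda>_. base_conf n x"]) (simp add: j pos_n)
next
  case (Suc d)
  hence j: "j \<in> {1..<n}" by auto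
  have "d = n - (j + 1)" "1 \<le> j + 1" "j + 1 \<le> n" using Suc.hyps(2) j by auto
  from Suc.hyps(1)[OF this]
  obtain \<rho> where \<rho>: "pathin (PB n) \<rho>" "\<rho> 0 = base_conf n x" "\<rho> 1 = base_conf n x \<circ> pos n (j + 1)"
     "\<forall>t\<in>{0..1}. passing n (\<rho> t)" "ucls (orbit_map n \<circ> \<rho>) = list_mult \<B> (map (artin_gen n x) (rev [j + 1..<n]))"
    by blast
  have perm: "pos n (j + 1) permutes {1..n}" by (rule pos_permutes) (use j in auto)
  let ?\<tau> = "\<lambda>t. half_twist n x j t \<circ> pos n (j + 1)"
  have \<tau>: "pathin (PB n) ?\<tau>" by (rule pathin_comp_permute[OF pathin_half_twist[OF x j] perm])
  have \<tau>01: "?\<tau> 0 = base_conf n x \<circ> pos n (j + 1)" "?\<tau> 1 = base_conf n x \<circ> pos n j"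
    using half_twist_0[OF j] half_twist_1[OF j] pos_step[of j n] j by (simp_all add: comp_assoc)
  have o: "orbit_map n \<circ> ?\<tau> = (\<lambda>t. orbit_map n (half_twist n x j t))"
    by (rule ext) (simp only: o_apply orbit_map_permute[OF perm])
  have "passing n (?\<tau> t)" if t: "t \<in> {0..1}" for t
  proof -
    have tw: "twisted n x j (half_arc x j t) (?\<tau> t)" using twisted_right j by auto
    have "Im (half_arc x j t) \<ge> 0"
      using points_less[OF n x, of j "j + 1"] j t sin_ge_zero[of "pi * t"] by (auto simp: half_arc_def)
    moreover have "Im (?\<tau> t k) \<le> 0" if "k \<in> {1..<n}" for k
      using tw that calculation by (cases k j rule: linorder_cases) (auto simp: twisted_def)
    moreover have "Im (?\<tau> t n) = Im (half_arc x j t)" using tw by (simp add: twisted_def)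
    ultimately show ?thesis
      using twisted_ordered[OF j tw half_arc_bounds(1)[OF j]] unfolding passing_def by auto
  qed
  hence pass: "\<forall>t\<in>{0..1}. passing n (loop_join \<rho> ?\<tau> t)"
    using \<rho>(4) by (auto simp: loop_join_def)
  have ul: "uloop (orbit_map n \<circ> \<rho>)" "uloop (orbit_map n \<circ> ?\<tau>)"
    using \<rho>(1-3) \<tau> \<tau>01 orbit_map_permute[OF perm] orbit_map_permute[OF pos_permutes[of j n]] j
    by (auto intro!: uloop_orbit)
  interpret group \<B> by (rule group_braid_group)
  have "ucls (orbit_map n \<circ> loop_join \<rho> ?\<tau>) = list_mult \<B> (map (artin_gen n x) (rev [j + 1..<n])) \<otimes>\<^bsub>\<B>\<^esub> artin_gen n x j"
    using ucls_mult[OF ul] unfolding loop_join_comp o \<rho>(5) artin_gen_def by (rule sym)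
  also have "\<dots> = list_mult \<B> (map (artin_gen n x) (rev [j + 1..<n]) @ [artin_gen n x j])"
    using artin_gen_in_braid_group[OF x] j
    by (subst list_mult_append) (auto simp: list_mult_def)
  also have "map (artin_gen n x) (rev [j + 1..<n]) @ [artin_gen n x j] = map (artin_gen n x) (rev [j..<n])"
    using j by (simp add: upt_conv_Cons[of j n])
  finally have cls: "ucls (orbit_map n \<circ> loop_join \<rho> ?\<tau>) = list_mult \<B> (map (artin_gen n x) (rev [j..<n]))" .
  have "pathin (PB n) (loop_join \<rho> ?\<tau>)" by (rule pathin_join[OF \<rho>(1) \<tau>]) (simp only: \<rho>(3) \<tau>01(1))
  thus ?case
    using cls pass \<rho>(2) \<tau>01(2)
    by (intro exI[of _ "loop_join \<rho> ?\<tau>"] conjI) (simp_all only: loop_join_0 loop_join_1)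
qed

end

text \<open>The summand \<open>t * (1 - t)\<close> keeps the path strictly above the real axis
  except at its ends.\<close>

definition descent :: "nat \<Rightarrow> (nat \<Rightarrow> real) \<Rightarrow> nat \<Rightarrow> real \<Rightarrow> real \<Rightarrow> complex" where
  "descent n x i e t = of_real ((1 - t) * x n + t * (x i + e)) + \<i> * of_real (t * (1 - t))"

text \<open>With \<open>- e\<close> in place of \<open>e\<close> this is the lower semicircle, from
  \<open>x i - e\<close> back to \<open>x i + e\<close>.\<close>

definition turn :: "(nat \<Rightarrow> real) \<Rightarrow> nat \<Rightarrow> real \<Rightarrow> real \<Rightarrow> complex" where
  "turn x i e t = of_real (x i) + of_real e * cis (pi * t)"

text \<open>The bracketing copies that of the lifted braid word \<open>p\<close> in
  \<open>pure_gen_lasso\<close>, so that the two loops can be compared piece by piece at equal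
  times.\<close>

definition lasso :: "nat \<Rightarrow> (nat \<Rightarrow> real) \<Rightarrow> nat \<Rightarrow> real \<Rightarrow> real \<Rightarrow> complex" where
  "lasso n x i e = loop_join (descent n x i e)
     (loop_join (loop_join (turn x i e) (turn x i (- e))) (loop_rev (descent n x i e)))"

context
  fixes n :: nat and x :: "nat \<Rightarrow> real"
  assumes n: "n \<ge> 2" and x: "strict_mono_on {1..n} x"
begin

text \<open>The loop \<open>p\<close> of ordered configurations projects to the braid word, so by
  injectivity of \<open>pure_incl\<close> its class is the generator. Approach and return are
  compared by \<open>apart_passing\<close>, the two half twists by
  \<open>apart_twisted\<close>.\<close>

lemma pure_gen_lasso:
  assumes i: "i \<in> {1..<n}" and e: "e > 0" and near: "\<And>k. k \<in> {1..n} \<Longrightarrow> k \<noteq> i \<Longrightarrow> e < \<bar>x k - x i\<bar>"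
    and lasso: "pth (fibre n x) (lasso n x i e) (of_real (x n)) (of_real (x n))"
  shows "pure_gen n x i n = loop_class (PB n) (base_conf n x) (fibre_incl n x \<circ> lasso n x i e)"
proof -
  let ?b = "base_conf n x" and ?w = "list_mult (braid_group n x) (map (artin_gen n x) (rev [i + 1..<n]))"
  let ?ucls = "loop_class (UB n) (orbit_map n ?b)"
  have i': "1 \<le> i" "i < n" "1 \<le> i + 1" "i + 1 \<le> n" using i by auto
  obtain \<rho> where \<rho>: "pathin (PB n) \<rho>" "\<rho> 0 = ?b" "\<rho> 1 = ?b \<circ> pos n (i + 1)"
     "\<And>t. t \<in> {0..1} \<Longrightarrow> passing n (\<rho> t)" "?ucls (orbit_map n \<circ> \<rho>) = ?w"
    using approach_exists[OF n x i'(3,4)] by blast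
  note perm = pos_permutes[OF i'(3,4)] pos_permutes[of i n]
  let ?\<tau> = "\<lambda>t. half_twist n x i t \<circ> pos n (i + 1)" and ?\<tau>' = "\<lambda>t. half_twist n x i t \<circ> pos n i"
  have perm': "pos n i permutes {1..n}" using perm(2) i' by simp
  have \<tau>: "pathin (PB n) ?\<tau>" "pathin (PB n) ?\<tau>'"
    by (rule pathin_comp_permute[OF pathin_half_twist[OF x i] perm(1)])
      (rule pathin_comp_permute[OF pathin_half_twist[OF x i] perm'])
  have ends: "?\<tau> 0 = ?b \<circ> pos n (i + 1)" "?\<tau> 1 = ?b \<circ> pos n i" "?\<tau>' 0 = ?b \<circ> pos n i"
    "?\<tau>' 1 = ?b \<circ> pos n (i + 1)"
    using half_twist_0[OF i, of x] half_twist_1[OF i, of x] pos_step[OF i'(2)] transpose_pos[OF i'(2)]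
    by (simp_all add: comp_assoc)
  have orbit: "orbit_map n \<circ> ?\<tau> = (\<lambda>t. orbit_map n (half_twist n x i t))"
    "orbit_map n \<circ> ?\<tau>' = (\<lambda>t. orbit_map n (half_twist n x i t))"
    by (rule ext, simp only: o_apply orbit_map_permute[OF perm(1)])
      (rule ext, simp only: o_apply orbit_map_permute[OF perm'])
  define p where "p = loop_join \<rho> (loop_join (loop_join ?\<tau> ?\<tau>') (loop_rev \<rho>))"
  have rev: "loop_rev \<rho> 0 = \<rho> 1" "loop_rev \<rho> 1 = \<rho> 0" by (simp_all add: loop_rev_def)
  have p: "loop_in (PB n) ?b p"
    unfolding loop_in_def p_def
    by (intro conjI pathin_join \<tau> \<rho>(1) pathin_rev)
      (simp_all only: loop_join_0 loop_join_1 rev ends \<rho>(2,3))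
  have ul: "loop_in (UB n) (orbit_map n ?b) (orbit_map n \<circ> \<rho>)"
    by (rule uloop_orbit[OF n x \<rho>(1)]) (simp_all only: \<rho>(2,3) orbit_map_permute[OF perm(1)])
  have ut: "loop_in (UB n) (orbit_map n ?b) (orbit_map n \<circ> ?\<tau>)"
    by (rule uloop_orbit[OF n x \<tau>(1)]) (simp_all only: ends orbit_map_permute[OF perm(1)] orbit_map_permute[OF perm'])
  have artin: "artin_gen n x i = ?ucls (orbit_map n \<circ> ?\<tau>)" "artin_gen n x i = ?ucls (orbit_map n \<circ> ?\<tau>')"
    unfolding orbit artin_gen_def by simp_all
  have ut': "loop_in (UB n) (orbit_map n ?b) (orbit_map n \<circ> ?\<tau>')"
    using ut unfolding orbit .
  interpret BG: group "braid_group n x" by (rule group_braid_group[OF n x])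
  have gens: "artin_gen n x k \<in> carrier (braid_group n x)" if "k \<in> {1..<n}" for k
    by (rule artin_gen_in_braid_group[OF x that])
  have w: "?w \<in> carrier (braid_group n x)"
    by (rule BG.list_mult_closed) (use gens in auto)
  have "?ucls (orbit_map n \<circ> p) = ?w \<otimes>\<^bsub>braid_group n x\<^esub>
      ((artin_gen n x i \<otimes>\<^bsub>braid_group n x\<^esub> artin_gen n x i) \<otimes>\<^bsub>braid_group n x\<^esub> inv\<^bsub>braid_group n x\<^esub> ?w)"
  proof -
    have "?ucls (orbit_map n \<circ> p) = ?ucls (orbit_map n \<circ> \<rho>) \<otimes>\<^bsub>braid_group n x\<^esub>
      ((?ucls (orbit_map n \<circ> ?\<tau>) \<otimes>\<^bsub>braid_group n x\<^esub> ?ucls (orbit_map n \<circ> ?\<tau>'))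
        \<otimes>\<^bsub>braid_group n x\<^esub> ?ucls (loop_rev (orbit_map n \<circ> \<rho>)))"
      unfolding p_def loop_join_comp loop_rev_comp
      by (simp only: ucls_mult[OF n x] ul ut ut' loop_in_join loop_in_rev)
    thus ?thesis
      unfolding artin(1)[symmetric] artin(2)[symmetric] ucls_inv[OF n x ul, symmetric] \<rho>(5) .
  qed
  also have "\<dots> = braid_word_B n x i n"
  proof -
    have "braid_word_B n x i n = ?w \<otimes>\<^bsub>braid_group n x\<^esub> (list_mult (braid_group n x) [artin_gen n x i, artin_gen n x i]
        \<otimes>\<^bsub>braid_group n x\<^esub> list_mult (braid_group n x) (map (\<lambda>k. inv\<^bsub>braid_group n x\<^esub> artin_gen n x k) [i + 1..<n]))"
    proof -
      have "set (map (artin_gen n x) (rev [i + 1..<n])) \<subseteq> carrier (braid_group n x)"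
        and mid: "set [artin_gen n x i, artin_gen n x i] \<subseteq> carrier (braid_group n x)"
        and inv: "set (map (\<lambda>k. inv\<^bsub>braid_group n x\<^esub> artin_gen n x k) [i + 1..<n]) \<subseteq> carrier (braid_group n x)"
        using gens i by auto
      moreover from mid inv have "set ([artin_gen n x i, artin_gen n x i] @
          map (\<lambda>k. inv\<^bsub>braid_group n x\<^esub> artin_gen n x k) [i + 1..<n]) \<subseteq> carrier (braid_group n x)"
        by (simp only: set_append Un_subset_iff simp_thms)
      ultimately show ?thesis
        unfolding braid_word_B_def by (simp only: BG.list_mult_append)
    qed
    also have "list_mult (braid_group n x) (map (\<lambda>k. inv\<^bsub>braid_group n x\<^esub> artin_gen n x k) [i + 1..<n]) =
        inv\<^bsub>braid_group n x\<^esub> ?w"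
      by (rule BG.list_mult_inv) (use gens in auto)
    finally show ?thesis using gens[OF i] by (simp add: list_mult_def)
  qed
  finally have "pure_incl n x (loop_class (PB n) ?b p) = braid_word_B n x i n"
    using pure_incl_class[OF p] by simp
  moreover have "loop_class (PB n) ?b p \<in> carrier (pure_braid_group n x)"
    using p by (simp add: pure_braid_group_def fundamental_group_def)
  ultimately have gen: "pure_gen n x i n = loop_class (PB n) ?b p"
    unfolding pure_gen_def by (intro the_inv_into_f_eq inj_pure_incl)
  have lt: "x i < x (i + 1)" using points_less[OF n x, of i "i + 1"] i by auto
  \<comment> \<open>The descent touches the real axis only at its two ends. There both
    configurations are real, and the order of the points decides instead of the imaginary
    parts.\<close>
  have A: "apart n (\<rho> t) (fibre_incl n x (descent n x i e t))" if t: "t \<in> {0..1}" for t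
  proof -
    have inj: "inj_on (\<rho> t) {1..n}"
      using \<rho>(1) t unfolding pathin_def continuous_map_PB_iff by blast
    have order: "Re (\<rho> t k) < Re (\<rho> t l)" "x k < x l" if "k \<in> {1..<n}" "l \<in> {1..<n}" "k < l" for k l
      using \<rho>(4)[OF t] points_less[OF n x, of k l] that unfolding passing_def by auto
    consider "t = 0" | "t = 1" | "0 < t" "t < 1" using t by force
    thus ?thesis
    proof cases
      case 1
      show ?thesis
      proof (rule apart_fibre_incl[OF order])
        fix k assume k: "k \<in> {1..<n}"
        have "x k < x n" using points_less[OF n x, of k n] k by auto
        thus "0 \<notin> closed_segment (\<rho> t k - \<rho> t n) (of_real (x k) - descent n x i e t)"
          using k n by (intro segment_half_plane[of "-1"]) (auto simp: 1 \<rho>(2) base_conf_def descent_def)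
      qed
    next
      case 2
      show ?thesis
      proof (rule apart_fibre_incl[OF order])
        fix k assume k: "k \<in> {1..<n}"
        have \<rho>n: "\<rho> t n = of_real (x (i + 1))" and \<rho>k: "\<rho> t k = of_real (x (if i + 1 \<le> k then k + 1 else k))"
          using k i by (auto simp: 2 \<rho>(3) base_conf_def pos_def)
        have d: "descent n x i e t = of_real (x i + e)" by (simp add: 2 descent_def)
        show "0 \<notin> closed_segment (\<rho> t k - \<rho> t n) (of_real (x k) - descent n x i e t)"
        proof (cases "k \<le> i")
          case True
          hence "x k \<le> x i" "x k < x (i + 1)" using points_less[OF n x, of k "i + 1"] points_le[OF n x, of k i] k i by auto
          thus ?thesis using True e by (intro segment_half_plane[of "-1"]) (auto simp: \<rho>n \<rho>k d)
        next
          case False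
          hence "x i < x k" "x (i + 1) < x (k + 1)" using points_less[OF n x] k i by auto
          thus ?thesis using False near[of k] k by (intro segment_half_plane[of 1]) (auto simp: \<rho>n \<rho>k d)
        qed
      qed
    next
      case 3
      thus ?thesis
        using \<rho>(4)[OF t] inj by (intro apart_passing[OF n x]) (auto simp: descent_def)
    qed
  qed
  \<comment> \<open>The factor scales the radius of the half twist, half the distance of
    \<open>x i\<close> and \<open>x (i + 1)\<close>, to the radius \<open>e\<close> of the
    lasso.\<close>
  have small: "e / ((x (i + 1) - x i) / 2) > 0" using lt e by simp
  have scale: "e / ((x (i + 1) - x i) / 2) * cmod w = e" if "cmod w = (x (i + 1) - x i) / 2" for w
    using lt by (simp add: that)
  have turn: "turn x i e t = of_real (x i) + of_real (e / ((x (i + 1) - x i) / 2)) * half_arc x i t" for t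
    using lt by (simp add: turn_def half_arc_def flip: of_real_diff)
  have turn': "turn x i (- e) t = of_real (x i) + of_real (e / ((x (i + 1) - x i) / 2)) * (- half_arc x i t)" for t
    using turn[of t] by (simp add: turn_def)
  have B: "apart n (?\<tau> t) (fibre_incl n x (turn x i e t))" for t
  proof (rule apart_twisted[OF n x i twisted_right[OF i'(1,2)] half_arc_bounds(2)[OF n x i] turn small])
    show "e / ((x (i + 1) - x i) / 2) * cmod (half_arc x i t) < \<bar>x k - x i\<bar>" if "k \<in> {1..n}" "k \<noteq> i" for k
      by (simp only: scale[OF half_arc_bounds(2)[OF n x i]] near[OF that])
  qed
  have B': "apart n (?\<tau>' t) (fibre_incl n x (turn x i (- e) t))" for t
  proof (rule apart_twisted[OF n x i twisted_left[OF i'(1,2)] _ turn' small])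
    show c: "cmod (- half_arc x i t) = (x (i + 1) - x i) / 2"
      using half_arc_bounds(2)[OF n x i] by simp
    show "e / ((x (i + 1) - x i) / 2) * cmod (- half_arc x i t) < \<bar>x k - x i\<bar>" if "k \<in> {1..n}" "k \<noteq> i" for k
      by (simp only: scale[OF c] near[OF that])
  qed
  txt \<open>
    At no time do two coordinates of the lifted braid word differ by a negative multiple of the
    difference of the same coordinates in the configuration of the lasso.
  \<close>
  have "loop_homotopic (PB n) ?b p (fibre_incl n x \<circ> lasso n x i e)"
  proof (rule apart_homotopic[OF p loop_in_fibre_incl[OF n x lasso]])
    fix t :: real assume t: "t \<in> {0..1}"
    have "apart n (p t) (fibre_incl n x (lasso n x i e t))"
      unfolding p_def lasso_def
    proof (intro loop_join_pointwise[where P = "\<lambda>u z. apart n u (fibre_incl n x z)"] t)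
      fix s :: real assume "s \<in> {0..1}"
      thus "apart n (loop_rev \<rho> s) (fibre_incl n x (loop_rev (descent n x i e) s))"
        using A[of "1 - s"] by (simp add: loop_rev_def)
    qed (simp_all only: A B B')
    thus "apart n (p t) ((fibre_incl n x \<circ> lasso n x i e) t)" by simp
  qed
  thus ?thesis unfolding gen by (simp add: loop_class_eq_iff[OF p])
qed

end

theorem corollary4p7:
  fixes n :: nat and x :: "nat \<Rightarrow> real"
  assumes "n \<ge> 2" and "strict_mono_on {1..n} x"
  shows "freely_generated_by (pure_braid_group n x)
           (kernel (pure_braid_group n x) (pure_braid_group (n - 1) x) (forget_hom n x))
           {1..n - 1} (\<lambda>i. pure_gen n x i n)"
proof -
  note n = assms(1) and x = assms(2)
  have "\<exists>d>0. \<forall>p\<in>{(k, l). k \<in> {1..n} \<and> l \<in> {1..n} \<and> k \<noteq> l}. 2 * d \<le> \<bar>x (fst p) - x (snd p)\<bar>"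
  proof (rule finite_uniform_bound)
    show "finite {(k, l). k \<in> {1..n} \<and> l \<in> {1..n} \<and> k \<noteq> l}"
      by (rule finite_subset[of _ "{1..n} \<times> {1..n}"]) auto
    fix p assume "p \<in> {(k, l). k \<in> {1..n} \<and> l \<in> {1..n} \<and> k \<noteq> l}"
    then obtain k l where p: "p = (k, l)" "k \<in> {1..n}" "l \<in> {1..n}" "k \<noteq> l" by blast
    show "\<exists>d>0. 2 * d \<le> \<bar>x (fst p) - x (snd p)\<bar>"
      using points_eq_iff[OF n x p(2,3)] p(4)
      by (intro exI[of _ "\<bar>x (fst p) - x (snd p)\<bar> / 2"]) (simp add: p(1))
  qed simp
  then obtain d where d: "d > 0" "\<And>k l. k \<in> {1..n} \<Longrightarrow> l \<in> {1..n} \<Longrightarrow> k \<noteq> l \<Longrightarrow> 2 * d \<le> \<bar>x k - x l\<bar>"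
    by force
  let ?I = "{1..n - 1}" and ?b = "complex_of_real (x n)"
  have I: "i \<in> {1..n}" "i \<noteq> n" "i \<in> {1..<n}" if "i \<in> ?I" for i using that n by auto
  interpret punctured_plane ?I x d ?b
  proof
    show "Re ?b \<noteq> x i" if "i \<in> ?I" for i
      using points_eq_iff[OF n x _ I(1)[OF that], of n] I(2)[OF that] n by auto
  qed (use d I in auto)
  have S: "S = fibre n x" unfolding S_def fibre_def ..
  have A_iff: "z \<in> A \<longleftrightarrow> (\<forall>k\<in>?I. Re z = x k \<longrightarrow> Im z > 0)" for z
    unfolding A_def by (rule mem_Collect_eq)
  \<comment> \<open>The half-width of the strips is \<open>d\<close>; a circle of the smaller radius
    \<open>e\<close> about a puncture stays inside its strip.\<close>
  define e where "e = d / 2"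
  have e: "e > 0" "e < d" using d(1) by (simp_all add: e_def)
  have near: "d < \<bar>x k - x i\<bar>" if "k \<in> {1..n}" "i \<in> {1..n}" "k \<noteq> i" for k i
    using d(2)[OF that] d(1) by linarith
  \<comment> \<open>Descent and upper semicircle run in \<open>A\<close> to the left half, and the
    lower semicircle crosses the strip to the right half: together an entering path. The descent
    alone is a staying path with the same end, so the lasso has the required form up to
    bracketing.\<close>
  have enc: "encircling i (lasso n x i e)" if i: "i \<in> ?I" for i
  proof -
    have off: "x i + s \<noteq> x k" if "k \<in> {1..n}" "\<bar>s\<bar> = e" for k s
      using near[OF that(1) I(1)[OF i]] that(2) e by (cases "k = i") auto
    have turn_A: "turn x i e t \<in> A" if t: "t \<in> {0..1}" for t
    proof -
      consider "t = 0" | "t = 1" | "0 < t" "t < 1" using t by force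
      thus ?thesis
      proof cases
        case 1
        hence "Re (turn x i e t) = x i + e" by (simp add: turn_def)
        thus ?thesis unfolding A_iff using off[OF I(1), of _ e] e(1) by simp
      next
        case 2
        hence "Re (turn x i e t) = x i + - e" by (simp add: turn_def)
        thus ?thesis unfolding A_iff using off[OF I(1), of _ "- e"] e(1) by simp
      next
        case 3
        hence "sin (pi * t) > 0" by (intro sin_gt_zero) auto
        thus ?thesis unfolding A_iff using e by (simp add: turn_def)
      qed
    qed
    have descent_A: "descent n x i e t \<in> A" if t: "t \<in> {0..1}" for t
    proof -
      consider "t = 0" | "t = 1" | "0 < t" "t < 1" using t by force
      thus ?thesis
      proof cases
        case 1
        thus ?thesis using b_in_A by (simp add: descent_def)
      next
        case 2
        hence "Re (descent n x i e t) = x i + e" by (simp add: descent_def)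
        thus ?thesis unfolding A_iff using off[OF I(1), of _ e] e(1) by simp
      next
        case 3
        thus ?thesis unfolding A_iff by (simp add: descent_def)
      qed
    qed
    have turn_B: "turn x i (- e) t \<in> B i" if t: "t \<in> {0..1}" for t
    proof -
      have "\<bar>e * cos (pi * t)\<bar> \<le> e"
        using e mult_left_mono[of "\<bar>cos (pi * t)\<bar>" 1 e] by (simp add: abs_mult)
      hence "\<bar>Re (turn x i (- e) t) - x i\<bar> < d" using e by (simp add: turn_def)
      moreover have "sin (pi * t) > 0" if "cos (pi * t) = 0"
      proof -
        have "(sin (pi * t))\<^sup>2 = 1" using sin_cos_squared_add[of "pi * t"] that by simp
        moreover have "sin (pi * t) \<ge> 0" using t by (intro sin_ge_zero) auto
        ultimately show ?thesis by (simp add: power2_eq_1_iff)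
      qed
      ultimately show ?thesis using e by (simp add: B_def turn_def)
    qed
    let ?l = "complex_of_real (x i - e)" and ?r = "complex_of_real (x i + e)"
    have "continuous_on {0..1} (descent n x i e)" "continuous_on {0..1} (turn x i e)" "continuous_on {0..1} (turn x i (- e))"
      unfolding descent_def turn_def by (intro continuous_intros)+
    hence P: "pth A (descent n x i e) ?b ?r" "pth A (turn x i e) ?r ?l" "pth (B i) (turn x i (- e)) ?l ?r"
      using descent_A turn_A turn_B
      by (auto simp: pth_def path_def path_image_def pathstart_def pathfinish_def) (simp_all add: descent_def turn_def)
    have lr: "?l \<in> L i" "?r \<in> R i" using e by (simp_all add: L_def R_def)
    note Q = P(1,2)[THEN pth_mono[OF _ A_subset]] pth_mono[OF P(3) B_subset[OF i]]
    have rev: "loop_rev (descent n x i e) = reversepath (descent n x i e)"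
      by (simp add: loop_rev_def reversepath_def)
    have a: "entering i ((descent n x i e +++ turn x i e) +++ turn x i (- e)) ?r"
      unfolding entering_def
      using lr(1) pth_join[OF P(1,2)] P(3) pth_refl[OF pth_join[OF pth_join[OF Q(1,2)] Q(3)]] by blast
    have b: "staying (descent n x i e) ?r" unfolding staying_def using P(1) pth_refl[OF Q(1)] by blast
    have "homotopic_paths S (((descent n x i e +++ turn x i e) +++ turn x i (- e)) +++ reversepath (descent n x i e))
        ((descent n x i e +++ (turn x i e +++ turn x i (- e))) +++ reversepath (descent n x i e))"
      using pth_join[OF pth_join[OF Q(1,2)] Q(3)] pth_reverse[OF Q(1)]
        homotopic_paths_sym[OF pth_assoc[OF Q]] pth_refl[OF pth_reverse[OF Q(1)]] by (rule pth_join_cong)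
    also have "homotopic_paths S \<dots> (lasso n x i e)"
      unfolding lasso_def loop_join_eq rev
      by (rule homotopic_paths_sym[OF pth_assoc[OF Q(1) pth_join[OF Q(2,3)] pth_reverse[OF Q(1)]]])
    finally show ?thesis unfolding encircling_def using lr(2) a b by blast
  qed
  have free: "freely_generated_by (fundamental_group (top_of_set (fibre n x)) ?b)
      (carrier (fundamental_group (top_of_set (fibre n x)) ?b)) ?I
      (\<lambda>i. loop_class (top_of_set (fibre n x)) ?b (lasso n x i e))"
    using free_fundamental_group[OF enc] unfolding S .
  have "freely_generated_by (pure_braid_group n x)
      (induced_hom (PB n) (base_conf n x) (fibre_incl n x) ` carrier (fundamental_group (top_of_set (fibre n x)) ?b))
      ?I (\<lambda>i. pure_gen n x i n)"
  proof (rule freely_generated_by_hom[OF _ group_pure_braid_group[OF n x] fibre_hom[OF n x] fibre_hom_inj[OF n x] free])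
    show "group (fundamental_group (top_of_set (fibre n x)) ?b)"
      using group_axioms unfolding S .
    fix i assume i: "i \<in> ?I"
    have lasso: "pth (fibre n x) (lasso n x i e) ?b ?b"
      using encircling_pth[OF i enc[OF i]] unfolding S .
    show "pure_gen n x i n = induced_hom (PB n) (base_conf n x) (fibre_incl n x)
        (loop_class (top_of_set (fibre n x)) ?b (lasso n x i e))"
      unfolding fibre_hom_class[OF n x lasso]
      by (rule pure_gen_lasso[OF n x I(3)[OF i] e(1) _ lasso])
        (use near[OF _ I(1)[OF i]] e in force)
  qed
  thus ?thesis unfolding fibre_hom_image[OF n x] .
qed

end
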